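(* For all integers $n\geq 42$, $s(n)u_n^2-2u_n+1>0$, where $u_m=\dfrac{\overline{p}(m-1)\overline{p}(m+1)}{\overline{p}(m)^2}$ and $s(n)=u_{n-1}+u_{n+1}-u_{n-1}u_{n+1}$.
   Context: $\overline{p}(n)$ denotes the number of overpartitions of $n$ (nonincreasing sequences of positive integers summing to $n$ in which the first occurrence of each distinct part may be overlined), with $\overline{p}(0)=1$. *)

theory Defs
  imports Complex_Main "HOL-Library.Multiset"
begin

text \<open>An overpartition of n: a partition of n (a multiset of positive integers
summing to n) together with the set of distinct parts whose first occurrence
is overlined.\<close>

definition overpartitions :: "nat \<Rightarrow> (nat multiset \<times> nat set) set" where
  "overpartitions n = {(M, S). (\<forall>x\<in>#M. 0 < x) \<and> sum_mset M = n \<and> S \<subseteq> set_mset M}"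

definition overpart :: "nat \<Rightarrow> nat" where
  "overpart n = card (overpartitions n)"

definition u_op :: "nat \<Rightarrow> real" where
  "u_op m = real (overpart (m - 1)) * real (overpart (m + 1)) / (real (overpart m))^2"

definition s_op :: "nat \<Rightarrow> real" where
  "s_op n = u_op (n - 1) + u_op (n + 1) - u_op (n - 1) * u_op (n + 1)"

end

theory Submission
  imports Defs "HOL-Complex_Analysis.Complex_Analysis" "HOL-Probability.Probability"
begin

text \<open>
  Put \<open>h n = - ln (u_op n)\<close>, so that \<open>- h\<close> is the second difference of \<open>ln \<circ> overpart\<close>. The claim
  says \<open>(1 - u\<^sub>n)\<^sup>2 > (1 - u\<^sub>n\<^sub>-\<^sub>1) (1 - u\<^sub>n\<^sub>+\<^sub>1) u\<^sub>n\<^sup>2\<close>, and by convexity it holds as soon as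
  \<open>- \<Delta>\<^sup>4 (ln \<circ> overpart) n / 2\<close>, of order \<open>n powr (- 7 / 2)\<close>, is smaller than about \<open>(h n)\<^sup>2\<close>, of order \<open>n powr (- 3)\<close>.
  For this it suffices to know \<open>overpart n\<close> up to a relative error \<open>1 / (40 n\<^sup>3)\<close>.

  The generating function of \<open>overpart\<close> is \<open>1 / \<theta>\<^sub>4\<close> by Gauss' identity, and the modular transformation of \<open>\<theta>\<^sub>4\<close>
  describes it near \<open>q = 1\<close>. In the Cauchy integral with \<open>q = exp (- z)\<close> the path follows the circle
  \<open>\<bar>z\<bar> = pi / (2 sqrt n)\<close>, on which the dominant exponent \<open>n z + pi\<^sup>2 / (4 z)\<close> is real, as long as \<open>cos (Arg z) \<ge> 1 / 3\<close>;
  there the integral reduces to a Gaussian one with value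
  \<open>exp (pi sqrt n) / (8 n) (1 - 1 / (pi sqrt n))\<close>. On the remaining vertical segments the product formula bounds
  the integrand by about \<open>n exp (- 13 / 10 sqrt n)\<close> times the main term. The cases \<open>n \<le> 577\<close> are computed from the
  recurrence given by \<open>\<theta>\<^sub>4\<close>.
\<close>

section \<open>Overpartitions with bounded parts\<close>

text \<open>The end \<open>cos (Arg z) = 1 / 3\<close> of the arc balances two effects. If
  \<open>c\<close> is the cosine at the end, the segments lie on
  \<open>Re z = c * pi / (2 sqrt n)\<close>. There the value at real \<open>q\<close> exceeds the
  main term by about \<open>exp (pi (1 - c)^2 / (2 c) * sqrt n)\<close>, while the oscillation of
  the product saves about \<open>exp (4 (1 - c^2) / (pi c) * sqrt n)\<close>. The net rate is
  largest for \<open>c\<close> close to \<open>1 / 3\<close>, where it is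
  \<open>32 / (3 pi) - 2 pi / 3 > 13 / 10\<close>. Thus no modular information at other roots of
  unity enters. The accuracy \<open>1 / (40 n^3)\<close> is dictated by the fourth difference:
  relative errors at \<open>n - 2, ..., n + 2\<close> enter with weights 1, 4, 6, 4, 1, halved, so
  eight times the error must stay well below \<open>(h n)^2\<close>, about
  \<open>(pi / 4)^2 / n^3\<close>. The estimates are made for \<open>sqrt k >= 24\<close>, that is
  \<open>k >= 576\<close>; since \<open>k = n - 2\<close> occurs, they serve
  \<open>n >= 578\<close>.\<close>

definition bounded_overpartitions :: "nat \<Rightarrow> nat \<Rightarrow> (nat multiset \<times> nat set) set" where
  "bounded_overpartitions m n = {(M, S). set_mset M \<subseteq> {1..m} \<and> sum_mset M = n \<and> S \<subseteq> set_mset M}"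

definition bounded_overpart :: "nat \<Rightarrow> nat \<Rightarrow> nat" where
  "bounded_overpart m n = card (bounded_overpartitions m n)"

lemma member_le_sum_mset: "x \<in># M \<Longrightarrow> x \<le> sum_mset (M :: nat multiset)"
  by (induction M) auto

lemma size_le_sum_mset: "(\<forall>x\<in>#M. 0 < x) \<Longrightarrow> size M \<le> sum_mset (M :: nat multiset)"
proof (induction M)
  case (add x M)
  then have "0 < x" "size M \<le> sum_mset M" by simp_all
  then show ?case by simp
qed simp

lemma overpartitions_eq_bounded:
  assumes "n \<le> m"
  shows "overpartitions n = bounded_overpartitions m n"
proof -
  have "(\<forall>x\<in>#M. 0 < x) \<longleftrightarrow> set_mset M \<subseteq> {1..m}" if M: "sum_mset M = n" for M
  proof -
    have "x \<le> m" if "x \<in># M" for x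
      using member_le_sum_mset[OF that] M assms by linarith
    then show ?thesis by (auto simp: Suc_le_eq)
  qed
  then show ?thesis
    unfolding overpartitions_def bounded_overpartitions_def by blast
qed

lemma finite_bounded_overpartitions: "finite (bounded_overpartitions m n)"
proof (rule finite_subset)
  show "bounded_overpartitions m n \<subseteq> (\<Union>k\<in>{..n}. {M. size M = k \<and> set_mset M \<subseteq> {1..m}}) \<times> Pow {1..m}"
  proof
    fix z assume z: "z \<in> bounded_overpartitions m n"
    obtain M S where zMS: "z = (M, S)" by (cases z)
    from z have M: "set_mset M \<subseteq> {1..m}" "sum_mset M = n" "S \<subseteq> set_mset M"
      unfolding zMS by (auto simp: bounded_overpartitions_def)
    then have "size M \<le> n"
      using size_le_sum_mset[of M] by fastforce
    with M show "z \<in> (\<Union>k\<in>{..n}. {M. size M = k \<and> set_mset M \<subseteq> {1..m}}) \<times> Pow {1..m}"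
      unfolding zMS by auto
  qed
  have "finite {M :: nat multiset. size M = k \<and> set_mset M \<subseteq> {1..m}}" for k
    using finite_multisets_of_size[of "{1..m}" k]  by (simp add: conj_commute multisets_of_size_def)
  then show "finite ((\<Union>k\<in>{..n}. {M. size M = k \<and> set_mset M \<subseteq> {1..m}}) \<times> Pow {1..m})"
    by auto
qed

lemma overpart_eq_bounded: "n \<le> m \<Longrightarrow> overpart n = bounded_overpart m n"
  by (simp add: overpart_def bounded_overpart_def overpartitions_eq_bounded)

lemma bounded_overpart_0: "bounded_overpart 0 n = (if n = 0 then 1 else 0)"
proof -
  have "bounded_overpartitions 0 n = (if n = 0 then {({#}, {})} else {})"
    by (auto simp: bounded_overpartitions_def)
  then show ?thesis by (simp add: bounded_overpart_def)
qed

text \<open>With \<open>k = Suc m\<close> there are three cases: \<open>k\<close> does not occur;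
  one copy of \<open>k\<close> can be removed with \<open>S\<close> still a set of parts; or
  \<open>k\<close> occurs once and is overlined, so that its mark goes with it. On generating
  functions \<open>F_j\<close> of \<open>bounded_overpart j\<close> this is
  \<open>(1 - q^k) F_k = (1 + q^k) F_m\<close>.\<close>

lemma bounded_overpart_Suc:
  "bounded_overpart (Suc m) n = bounded_overpart m n +
     (if Suc m \<le> n then bounded_overpart (Suc m) (n - Suc m) + bounded_overpart m (n - Suc m) else 0)"
proof -
  define k where "k = Suc m"
  let ?f = "\<lambda>(M :: nat multiset, S :: nat set). (add_mset k M, S)"
  let ?g = "\<lambda>(M :: nat multiset, S :: nat set). (add_mset k M, insert k S)"
  define A where "A = bounded_overpartitions m n"
  define B where "B = (if k \<le> n then ?f ` bounded_overpartitions k (n - k) else {})"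
  define C where "C = (if k \<le> n then ?g ` bounded_overpartitions m (n - k) else {})"
  have split: "bounded_overpartitions k n = A \<union> (B \<union> C)"
  proof (intro equalityI subsetI)
    fix z assume z: "z \<in> bounded_overpartitions k n"
    obtain M S where zMS: "z = (M, S)" by (cases z)
    have M: "set_mset M \<subseteq> {1..k}" "sum_mset M = n" "S \<subseteq> set_mset M"
      using z zMS by (auto simp: bounded_overpartitions_def)
    show "z \<in> A \<union> (B \<union> C)"
    proof (cases "k \<in># M")
      case False
      then have "set_mset M \<subseteq> {1..m}"
        using M(1) by (fastforce simp: k_def le_Suc_eq)
      with M zMS show ?thesis by (auto simp: A_def bounded_overpartitions_def)
    next
      case True
      then obtain M' where M': "M = add_mset k M'" by (metis insert_DiffM)
      have kn: "k \<le> n" using True M(2) member_le_sum_mset by blast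
      show ?thesis
      proof (cases "S \<subseteq> set_mset M'")
        case True
        have "(M', S) \<in> bounded_overpartitions k (n - k)"
          using M M' True by (auto simp: bounded_overpartitions_def)
        moreover have "z = ?f (M', S)" using zMS M' by simp
        ultimately show ?thesis using kn unfolding B_def by (simp only: if_True) blast
      next
        case False
        then have kS: "k \<in> S" "k \<notin># M'" using M(3) M' by auto
        have "set_mset M' \<subseteq> {1..m}"
          using M(1) M' kS(2) by (fastforce simp: k_def le_Suc_eq)
        then have "(M', S - {k}) \<in> bounded_overpartitions m (n - k)"
          using M M' kS by (auto simp: bounded_overpartitions_def)
        moreover have "z = ?g (M', S - {k})" using zMS M' kS by auto
        ultimately show ?thesis using kn unfolding C_def by (simp only: if_True) blast
      qed
    qed
  next
    fix z assume "z \<in> A \<union> (B \<union> C)"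
    then consider "z \<in> A" | "z \<in> B" | "z \<in> C" by blast
    then show "z \<in> bounded_overpartitions k n"
    proof cases
      case 1
      then show ?thesis by (force simp: A_def bounded_overpartitions_def k_def)
    next
      case 2
      then obtain M S where "k \<le> n" "(M, S) \<in> bounded_overpartitions k (n - k)" "z = (add_mset k M, S)"
        unfolding B_def by (cases "k \<le> n") auto
      then show ?thesis by (auto simp: bounded_overpartitions_def k_def)
    next
      case 3
      then obtain M S where "k \<le> n" "(M, S) \<in> bounded_overpartitions m (n - k)" "z = (add_mset k M, insert k S)"
        unfolding C_def by (cases "k \<le> n") auto
      then show ?thesis by (fastforce simp: bounded_overpartitions_def k_def)
    qed
  qed
  have fin: "finite A" "finite B" "finite C"
    using finite_bounded_overpartitions by (auto simp: A_def B_def C_def)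
  have inA: "k \<notin># fst z" if "z \<in> A" for z
    using that by (auto simp: A_def bounded_overpartitions_def k_def)
  have inBC: "k \<in># fst z" if "z \<in> B \<or> z \<in> C" for z
    using that by (auto simp: B_def C_def split: if_splits)
  have inC: "k \<in> snd z \<and> count (fst z) k = 1" if zC: "z \<in> C" for z
  proof -
    obtain M S where "(M, S) \<in> bounded_overpartitions m (n - k)" "z = (add_mset k M, insert k S)"
      using zC unfolding C_def by (cases "k \<le> n") auto
    moreover from this have "k \<notin># M" by (auto simp: bounded_overpartitions_def k_def)
    ultimately show ?thesis by (simp add: not_in_iff)
  qed
  have inB: "k \<notin> snd z" if zB: "z \<in> B" and cnt: "count (fst z) k = 1" for z
  proof -
    obtain M S where "(M, S) \<in> bounded_overpartitions k (n - k)" "z = (add_mset k M, S)"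
      using zB unfolding B_def by (cases "k \<le> n") auto
    moreover from this cnt have "k \<notin># M" by (simp add: not_in_iff)
    ultimately show ?thesis by (auto simp: bounded_overpartitions_def)
  qed
  have "A \<inter> (B \<union> C) = {}" using inA inBC by blast
  moreover have "B \<inter> C = {}" using inB inC by blast
  ultimately have "card (bounded_overpartitions k n) = card A + (card B + card C)"
    unfolding split using fin by (simp add: card_Un_disjoint)
  moreover have "card B = (if k \<le> n then bounded_overpart k (n - k) else 0)"
  proof -
    have "inj_on ?f (bounded_overpartitions k (n - k))"
      by (rule inj_onI) auto
    then show ?thesis unfolding B_def bounded_overpart_def using card_image by fastforce
  qed
  moreover have "card C = (if k \<le> n then bounded_overpart m (n - k) else 0)"
  proof -
    have "inj_on ?g (bounded_overpartitions m (n - k))"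
    proof (rule inj_onI, clarify)
      fix M S M' S'
      assume MS: "(M, S) \<in> bounded_overpartitions m (n - k)" "(M', S') \<in> bounded_overpartitions m (n - k)"
        and eq: "add_mset k M = add_mset k M'" "insert k S = insert k S'"
      have "k \<notin> S" "k \<notin> S'" using MS by (force simp: bounded_overpartitions_def k_def)+
      with eq show "M = M' \<and> S = S'" by (simp add: insert_ident)
    qed
    then show ?thesis unfolding C_def bounded_overpart_def using card_image by fastforce
  qed
  ultimately show ?thesis
    by (simp add: A_def bounded_overpart_def k_def)
qed

section \<open>The generating function as an infinite product\<close>

definition overpart_prod :: "nat \<Rightarrow> 'a::field \<Rightarrow> 'a" where
  "overpart_prod m q = (\<Prod>k=1..m. (1 + q ^ k) / (1 - q ^ k))"

definition overpart_gf :: "'a \<Rightarrow> 'a::{real_normed_field,banach}" where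
  "overpart_gf q = (\<Sum>n. of_nat (overpart n) * q ^ n)"

lemma one_minus_power_pos: "0 \<le> \<rho> \<Longrightarrow> \<rho> < 1 \<Longrightarrow> 0 < k \<Longrightarrow> 0 < 1 - (\<rho>::real) ^ k"
  using power_Suc_less_one[of \<rho> "k - 1"] by (cases "\<rho> = 0") (auto simp: power_0_left)

lemma one_pm_power_neq_0:
  fixes q :: "'a::real_normed_field"
  assumes "norm q < 1" "0 < k"
  shows "1 - q ^ k \<noteq> 0" "1 + q ^ k \<noteq> 0"
proof -
  have *: "norm (q ^ k) < 1"
    using one_minus_power_pos[of "norm q" k] assms by (simp add: norm_power)
  show "1 - q ^ k \<noteq> 0"
    using * by (metis eq_iff_diff_eq_0 less_irrefl norm_one)
  show "1 + q ^ k \<noteq> 0"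
    using * by (metis add_eq_0_iff less_irrefl norm_minus_cancel norm_one)
qed

text \<open>Convergence is not known at this point, so the recurrence is applied to truncated sums:
  the shift by \<open>Suc m\<close> only loses nonnegative terms, and the resulting inequality is
  solved for the sum belonging to \<open>Suc m\<close>. Independence of \<open>N\<close> then yields
  summability.\<close>

lemma bounded_overpart_partial_sum_le:
  fixes \<rho> :: real
  assumes "0 \<le> \<rho>" "\<rho> < 1"
  shows "(\<Sum>n\<le>N. bounded_overpart m n * \<rho> ^ n) \<le> overpart_prod m \<rho>"
proof (induction m)
  case 0
  have "(\<Sum>n\<le>N. bounded_overpart 0 n * \<rho> ^ n) = (\<Sum>n\<le>N. if n = 0 then 1 else 0)"
    by (intro sum.cong) (auto simp: bounded_overpart_0)
  also have "\<dots> = 1" by (subst sum.delta) auto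
  finally show ?case by (simp add: overpart_prod_def)
next
  case (Suc m)
  let ?k = "Suc m"
  let ?T = "\<lambda>m. (\<Sum>n\<le>N. bounded_overpart m n * \<rho> ^ n)"
  have shift: "(\<Sum>n\<le>N. (if ?k \<le> n then bounded_overpart j (n - ?k) * \<rho> ^ n else 0)) \<le> \<rho> ^ ?k * ?T j" for j
  proof -
    have "(\<Sum>n\<le>N. (if ?k \<le> n then bounded_overpart j (n - ?k) * \<rho> ^ n else 0)) =
          (\<Sum>n\<in>{?k..N}. bounded_overpart j (n - ?k) * \<rho> ^ n)"
      by (subst sum.inter_filter[symmetric]) (auto intro!: sum.cong)
    also have "\<dots> \<le> (\<Sum>n\<le>N. bounded_overpart j n * \<rho> ^ (n + ?k))"
    proof -
      have "(\<Sum>n\<in>{?k..N}. bounded_overpart j (n - ?k) * \<rho> ^ n) =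
            (\<Sum>n\<in>(\<lambda>n. n - ?k) ` {?k..N}. bounded_overpart j n * \<rho> ^ (n + ?k))"
        by (subst sum.reindex) (auto simp: inj_on_def simp del: power_Suc intro!: sum.cong)
      also have "\<dots> \<le> (\<Sum>n\<le>N. bounded_overpart j n * \<rho> ^ (n + ?k))"
        using assms by (intro sum_mono2) auto
      finally show ?thesis .
    qed
    also have "\<dots> = \<rho> ^ ?k * ?T j"
      by (simp only: power_add sum_distrib_left mult_ac)
    finally show ?thesis .
  qed
  have "?T ?k = ?T m + (\<Sum>n\<le>N. (if ?k \<le> n then bounded_overpart ?k (n - ?k) * \<rho> ^ n else 0))
      + (\<Sum>n\<le>N. (if ?k \<le> n then bounded_overpart m (n - ?k) * \<rho> ^ n else 0))"
    unfolding sum.distrib[symmetric]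
    by (intro sum.cong refl, subst bounded_overpart_Suc) (auto simp: algebra_simps)
  also have "\<dots> \<le> ?T m + \<rho> ^ ?k * ?T ?k + \<rho> ^ ?k * ?T m"
    using shift[of ?k] shift[of m] by linarith
  finally have "?T ?k * (1 - \<rho> ^ ?k) \<le> ?T m * (1 + \<rho> ^ ?k)"
    by (simp add: algebra_simps)
  then have "?T ?k \<le> ?T m * ((1 + \<rho> ^ ?k) / (1 - \<rho> ^ ?k))"
    using one_minus_power_pos[OF assms, of ?k] by (simp add: pos_le_divide_eq)
  also have "\<dots> \<le> overpart_prod m \<rho> * ((1 + \<rho> ^ ?k) / (1 - \<rho> ^ ?k))"
    using Suc one_minus_power_pos[OF assms, of ?k] assms
    by (intro mult_right_mono divide_nonneg_pos) auto
  finally show ?case by (simp add: overpart_prod_def)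
qed

text \<open>For \<open>a = \<rho> ^ k\<close> one has \<open>(1 + a) / (1 - a) = 1 + 2 a / (1 - a)
  \<le> exp (2 a / (1 - \<rho>))\<close>, and the exponents form a geometric series. The uniformity
  in \<open>I\<close> serves both the convergence of the generating function and the error terms in
  Shanks' identity.\<close>

lemma ratio_prod_le_exp:
  fixes \<rho> :: real
  assumes "0 \<le> \<rho>" "\<rho> < 1" "finite I" "0 \<notin> I"
  shows "(\<Prod>k\<in>I. (1 + \<rho> ^ k) / (1 - \<rho> ^ k)) \<le> exp (2 / (1 - \<rho>) ^ 2)"
proof -
  have "(\<Prod>k\<in>I. (1 + \<rho> ^ k) / (1 - \<rho> ^ k)) \<le> (\<Prod>k\<in>I. exp (2 / (1 - \<rho>) * \<rho> ^ k))"
  proof (intro prod_mono conjI)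
    fix k assume "k \<in> I"
    then have k: "0 < k" using assms by (metis gr0I)
    have pos: "0 < 1 - \<rho> ^ k" using one_minus_power_pos assms k by blast
    then show "0 \<le> (1 + \<rho> ^ k) / (1 - \<rho> ^ k)" using assms by (intro divide_nonneg_pos) auto
    have "\<rho> ^ k \<le> \<rho>" using k assms power_decreasing[of 1 k \<rho>] by simp
    then have "2 * \<rho> ^ k / (1 - \<rho> ^ k) \<le> 2 * \<rho> ^ k / (1 - \<rho>)"
      using pos assms by (intro divide_left_mono mult_pos_pos) auto
    moreover have "(1 + \<rho> ^ k) / (1 - \<rho> ^ k) = 1 + 2 * \<rho> ^ k / (1 - \<rho> ^ k)"
      using pos by (simp add: field_simps)
    ultimately have "(1 + \<rho> ^ k) / (1 - \<rho> ^ k) \<le> 1 + 2 / (1 - \<rho>) * \<rho> ^ k" by simp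
    also have "\<dots> \<le> exp (2 / (1 - \<rho>) * \<rho> ^ k)" by (rule exp_ge_add_one_self)
    finally show "(1 + \<rho> ^ k) / (1 - \<rho> ^ k) \<le> exp (2 / (1 - \<rho>) * \<rho> ^ k)" .
  qed
  also have "\<dots> = exp (2 / (1 - \<rho>) * (\<Sum>k\<in>I. \<rho> ^ k))"
    using assms by (simp add: exp_sum sum_distrib_left)
  also have "\<dots> \<le> exp (2 / (1 - \<rho>) * (1 / (1 - \<rho>)))"
  proof -
    have "(\<Sum>k\<in>I. \<rho> ^ k) \<le> (\<Sum>k. \<rho> ^ k)"
      using assms by (intro sum_le_suminf summable_geometric) auto
    also have "\<dots> = 1 / (1 - \<rho>)" using assms by (simp add: suminf_geometric)
    finally have "2 / (1 - \<rho>) * (\<Sum>k\<in>I. \<rho> ^ k) \<le> 2 / (1 - \<rho>) * (1 / (1 - \<rho>))"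
      using assms by (intro mult_left_mono) auto
    then show ?thesis by simp
  qed
  finally show ?thesis by (simp add: power2_eq_square)
qed

lemma summable_bounded_overpart:
  fixes \<rho> :: real
  assumes "0 \<le> \<rho>" "\<rho> < 1"
  shows "summable (\<lambda>n. bounded_overpart m n * \<rho> ^ n)"
proof (rule summableI_nonneg_bounded)
  fix n
  have "(\<Sum>i<n. bounded_overpart m i * \<rho> ^ i) \<le> (\<Sum>i\<le>n. bounded_overpart m i * \<rho> ^ i)"
    using assms by (intro sum_mono2) auto
  then show "(\<Sum>i<n. bounded_overpart m i * \<rho> ^ i) \<le> overpart_prod m \<rho>"
    using bounded_overpart_partial_sum_le[OF assms, of m n] by linarith
qed (use assms in auto)

text \<open>For indices below \<open>n\<close> the part bound \<open>n\<close> is no restriction, so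
  partial sums are dominated by \<open>overpart_prod n \<rho>\<close>, which is bounded uniformly in
  \<open>n\<close>.\<close>

lemma summable_overpart_real:
  fixes \<rho> :: real
  assumes "0 \<le> \<rho>" "\<rho> < 1"
  shows "summable (\<lambda>n. overpart n * \<rho> ^ n)"
proof (rule summableI_nonneg_bounded)
  fix n
  have "(\<Sum>i<n. overpart i * \<rho> ^ i) = (\<Sum>i<n. bounded_overpart n i * \<rho> ^ i)"
    by (intro sum.cong) (auto simp: overpart_eq_bounded)
  also have "\<dots> \<le> (\<Sum>i\<le>n. bounded_overpart n i * \<rho> ^ i)"
    using assms by (intro sum_mono2) auto
  also have "\<dots> \<le> overpart_prod n \<rho>"
    by (rule bounded_overpart_partial_sum_le[OF assms])
  also have "\<dots> \<le> exp (2 / (1 - \<rho>) ^ 2)"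
    unfolding overpart_prod_def using assms by (intro ratio_prod_le_exp) auto
  finally show "(\<Sum>i<n. overpart i * \<rho> ^ i) \<le> exp (2 / (1 - \<rho>) ^ 2)" .
qed (use assms in auto)

lemma summable_norm_overpart:
  fixes q :: "'a::{real_normed_field,banach}"
  assumes "norm q < 1"
  shows "summable (\<lambda>n. norm (of_nat (overpart n) * q ^ n))"
  using summable_overpart_real[of "norm q"] assms by (simp add: norm_mult norm_power)

text \<open>Once the series converges, the recurrence becomes an exact linear equation for its value
  \<open>a\<close>.\<close>

lemma bounded_overpart_sums:
  fixes q :: "'a::{real_normed_field,banach}"
  assumes "norm q < 1"
  shows "(\<lambda>n. of_nat (bounded_overpart m n) * q ^ n) sums overpart_prod m q"
proof (induction m)
  case 0
  have "(\<lambda>n. if n = 0 then 1 else 0) sums (1 :: 'a)"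
    using sums_single[of 0 "\<lambda>_. 1 :: 'a"] by simp
  moreover have "(\<lambda>n. of_nat (bounded_overpart 0 n) * q ^ n) = (\<lambda>n. if n = 0 then 1 else 0)"
    by (auto simp: bounded_overpart_0)
  ultimately show ?case by (simp add: overpart_prod_def)
next
  case (Suc m)
  let ?k = "Suc m"
  have summ: "summable (\<lambda>n. of_nat (bounded_overpart ?k n) * q ^ n)"
    by (rule summable_norm_cancel)
      (use summable_bounded_overpart[of "norm q" ?k] assms in \<open>simp add: norm_mult norm_power\<close>)
  define a where "a = (\<Sum>n. of_nat (bounded_overpart ?k n) * q ^ n)"
  have a: "(\<lambda>n. of_nat (bounded_overpart ?k n) * q ^ n) sums a"
    unfolding a_def by (rule summable_sums[OF summ])
  have shift: "(\<lambda>n. if ?k \<le> n then of_nat (bounded_overpart j (n - ?k)) * q ^ n else 0) sums (q ^ ?k * x)"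
    if "(\<lambda>n. of_nat (bounded_overpart j n) * q ^ n) sums x" for j x
  proof -
    have "(\<lambda>n. of_nat (bounded_overpart j n) * q ^ (n + ?k)) sums (q ^ ?k * x)"
      using sums_mult[OF that, of "q ^ ?k"] by (simp add: power_add mult_ac)
    then have "(\<lambda>n. (\<lambda>n. if ?k \<le> n then of_nat (bounded_overpart j (n - ?k)) * q ^ n else 0) (n + ?k)) sums (q ^ ?k * x)"
      by simp
    then show ?thesis
      by (subst (asm) sums_iff_shift) simp
  qed
  have "(\<lambda>n. of_nat (bounded_overpart m n) * q ^ n
      + (if ?k \<le> n then of_nat (bounded_overpart ?k (n - ?k)) * q ^ n else 0)
      + (if ?k \<le> n then of_nat (bounded_overpart m (n - ?k)) * q ^ n else 0))
      sums (overpart_prod m q + q ^ ?k * a + q ^ ?k * overpart_prod m q)"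
    by (intro sums_add Suc shift a)
  also have "(\<lambda>n. of_nat (bounded_overpart m n) * q ^ n
      + (if ?k \<le> n then of_nat (bounded_overpart ?k (n - ?k)) * q ^ n else 0)
      + (if ?k \<le> n then of_nat (bounded_overpart m (n - ?k)) * q ^ n else 0))
      = (\<lambda>n. of_nat (bounded_overpart ?k n) * q ^ n)"
  proof
    fix n
    show "of_nat (bounded_overpart m n) * q ^ n
      + (if ?k \<le> n then of_nat (bounded_overpart ?k (n - ?k)) * q ^ n else 0)
      + (if ?k \<le> n then of_nat (bounded_overpart m (n - ?k)) * q ^ n else 0)
      = of_nat (bounded_overpart ?k n) * q ^ n"
      unfolding bounded_overpart_Suc[of m n] by (simp add: algebra_simps del: power_Suc)
  qed
  finally have "a = overpart_prod m q + q ^ ?k * a + q ^ ?k * overpart_prod m q"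
    using a sums_unique2 by blast
  then have "a * (1 - q ^ ?k) = overpart_prod m q * (1 + q ^ ?k)"
    by (simp add: algebra_simps)
  then have "a = overpart_prod m q * ((1 + q ^ ?k) / (1 - q ^ ?k))"
    using one_pm_power_neq_0[OF assms, of ?k] by (simp add: eq_divide_eq)
  then show ?case using a by (simp add: overpart_prod_def)
qed

lemma bounded_overpart_le: "bounded_overpart m n \<le> overpart n"
proof (cases "n \<le> m")
  case False
  then have "bounded_overpartitions m n \<subseteq> bounded_overpartitions n n"
    by (auto simp: bounded_overpartitions_def subset_iff)
  then show ?thesis
    using overpart_eq_bounded[of n n] finite_bounded_overpartitions
    by (simp add: bounded_overpart_def card_mono)
qed (simp add: overpart_eq_bounded)

text \<open>Tannery's theorem: each coefficient is constant in \<open>m\<close> from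
  \<open>m = n\<close> on, and the series of \<open>overpart\<close> dominates.\<close>

lemma overpart_prod_tendsto:
  fixes q :: "'a::{real_normed_field,banach}"
  assumes "norm q < 1"
  shows "(\<lambda>m. overpart_prod m q) \<longlonglongrightarrow> overpart_gf q"
proof -
  let ?f = "\<lambda>n m. of_nat (bounded_overpart m n) * q ^ n"
  have "(\<lambda>m. \<Sum>n. ?f n m) \<longlonglongrightarrow> (\<Sum>n. of_nat (overpart n) * q ^ n)"
  proof (rule tannerys_theorem[THEN conjunct2, THEN conjunct2])
    show "(\<lambda>m. ?f n m) \<longlonglongrightarrow> of_nat (overpart n) * q ^ n" for n
      by (rule tendsto_eventually, rule eventually_sequentiallyI[of n]) (simp add: overpart_eq_bounded)
    show "\<forall>\<^sub>F (n, m) in at_top \<times>\<^sub>F sequentially. norm (?f n m) \<le> overpart n * norm q ^ n"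
      by (rule always_eventually) (auto simp: norm_mult norm_power bounded_overpart_le intro!: mult_right_mono)
    show "summable (\<lambda>n. overpart n * norm q ^ n)"
      using assms by (intro summable_overpart_real) auto
  qed auto
  moreover have "(\<Sum>n. ?f n m) = overpart_prod m q" for m
    by (rule sums_unique[OF bounded_overpart_sums[OF assms], symmetric])
  ultimately show ?thesis by (simp add: overpart_gf_def)
qed

section \<open>Gauss' identity\<close>

text \<open>Jacobi's theta constant, the sum of \<open>(-1)^j q^(j^2)\<close> over all integers
  \<open>j\<close>, with \<open>j\<close> and \<open>- j\<close> combined.\<close>

definition theta4 :: "'a \<Rightarrow> 'a::{real_normed_field,banach}" where
  "theta4 q = 1 + 2 * (\<Sum>j. (-1) ^ Suc j * q ^ (Suc j)\<^sup>2)"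

definition ratio_prod :: "'a::field \<Rightarrow> nat \<Rightarrow> nat \<Rightarrow> 'a" where
  "ratio_prod q n s = (\<Prod>k\<in>{s<..n}. (1 - q ^ k) / (1 + q ^ k))"

text \<open>Shanks' identity. The increments in \<open>n\<close> of the summands on the right telescope in \<open>s\<close>.\<close>

lemma shanks_identity:
  fixes q :: "'a::field"
  assumes "\<And>k. 0 < k \<Longrightarrow> 1 + q ^ k \<noteq> 0" "(2::'a) \<noteq> 0"
  shows "1 + 2 * (\<Sum>j<n. (-1) ^ Suc j * q ^ (Suc j)\<^sup>2) =
    (\<Sum>s\<le>n. (-1) ^ s * (2 / (1 + q ^ s)) * ratio_prod q n s * q ^ (s * Suc n))"
proof (induction n)
  case 0
  show ?case using assms(2) by (simp add: ratio_prod_def)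
next
  case (Suc n)
  let ?N = "Suc n"
  let ?a = "\<lambda>n s. (-1) ^ s * (2 / (1 + q ^ s)) * ratio_prod q n s * q ^ (s * Suc n)"
  have nz: "1 + q ^ k \<noteq> 0" for k
    using assms by (cases "k = 0") auto
  have rSuc: "ratio_prod q ?N s = ratio_prod q n s * ((1 - q ^ ?N) / (1 + q ^ ?N))" if "s \<le> n" for s
  proof -
    have "{s<..?N} = insert ?N {s<..n}" using that by auto
    then show ?thesis by (simp add: ratio_prod_def)
  qed
  have rstep: "ratio_prod q n s = ratio_prod q n (Suc s) * ((1 - q ^ Suc s) / (1 + q ^ Suc s))" if "s < n" for s
  proof -
    have "{s<..n} = insert (Suc s) {Suc s<..n}" using that by auto
    then show ?thesis by (simp add: ratio_prod_def)
  qed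
  \<comment> \<open>The telescoping quantity. For \<open>s > 0\<close> its last factor equals
    \<open>ratio_prod q n s * (1 - q ^ s) / (1 + q ^ s)\<close>, which would vanish at
    \<open>s = 0\<close>; as \<open>s - 1\<close> is truncated on \<open>nat\<close>, that value is
    set by hand.\<close>
  define U where "U = (\<lambda>s. if s = 0 then 0 else (-1) ^ s * (2 / (1 + q ^ ?N)) * q ^ (s * ?N) * ratio_prod q n (s - 1))"
  have diff: "?a ?N s - ?a n s = U (Suc s) - U s" if "s \<le> n" for s
  proof -
    define R where "R = ratio_prod q n s"
    define x where "x = q ^ s"
    define y where "y = q ^ ?N"
    define z where "z = q ^ (s * ?N)"
    have nz': "1 + x \<noteq> 0" "1 + y \<noteq> 0" unfolding x_def y_def by (rule nz)+
    have e1: "q ^ (s * Suc ?N) = z * x"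
      by (simp add: z_def x_def power_add[symmetric] algebra_simps)
    have e2: "q ^ (Suc s * ?N) = z * y"
      by (simp add: z_def y_def power_add[symmetric] algebra_simps)
    have "U s = (-1) ^ s * (2 / (1 + y)) * z * (R * ((1 - x) / (1 + x)))"
    proof (cases s)
      case 0
      then show ?thesis by (simp add: U_def x_def)
    next
      case (Suc s')
      then show ?thesis
        using rstep[of s'] that by (simp add: U_def x_def y_def z_def R_def)
    qed
    moreover have "U (Suc s) = - ((-1) ^ s * (2 / (1 + y)) * (z * y) * R)"
      unfolding U_def by (simp only: e2) (simp add: y_def R_def)
    moreover have "?a ?N s = (-1) ^ s * (2 / (1 + x)) * (R * ((1 - y) / (1 + y))) * (z * x)"
      unfolding e1 rSuc[OF that] by (simp only: x_def y_def R_def)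
    moreover have "?a n s = (-1) ^ s * (2 / (1 + x)) * R * z"
      by (simp only: x_def R_def z_def)
    moreover have "(-1) ^ s * (2 / (1 + x)) * (R * ((1 - y) / (1 + y))) * (z * x) - (-1) ^ s * (2 / (1 + x)) * R * z
      = - ((-1) ^ s * (2 / (1 + y)) * (z * y) * R) - (-1) ^ s * (2 / (1 + y)) * z * (R * ((1 - x) / (1 + x)))"
      using nz' by (simp add: divide_simps) algebra
    ultimately show ?thesis by simp
  qed
  have "(\<Sum>s\<le>?N. ?a ?N s) - (\<Sum>s\<le>n. ?a n s) = (\<Sum>s\<le>n. ?a ?N s - ?a n s) + ?a ?N ?N"
    by (simp add: sum_subtractf)
  also have "(\<Sum>s\<le>n. ?a ?N s - ?a n s) = (\<Sum>s\<le>n. U (Suc s) - U s)"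
    using diff by (intro sum.cong) auto
  also have "\<dots> = U ?N"
    by (simp only: lessThan_Suc_atMost[symmetric] sum_lessThan_telescope) (simp add: U_def)
  also have "U ?N + ?a ?N ?N = 2 * ((-1) ^ ?N * q ^ (?N)\<^sup>2)"
  proof -
    have r: "ratio_prod q n n = 1" "ratio_prod q ?N ?N = 1" by (simp_all add: ratio_prod_def)
    have e: "q ^ (?N * Suc ?N) = q ^ (?N)\<^sup>2 * q ^ ?N" "q ^ (?N * ?N) = q ^ (?N)\<^sup>2"
      by (simp_all only: power_add[symmetric] power2_eq_square mult_Suc_right add.commute)
    have "U ?N = (-1) ^ ?N * (2 / (1 + q ^ ?N)) * q ^ (?N)\<^sup>2"
      unfolding U_def e by (simp add: r)
    moreover have "?a ?N ?N = (-1) ^ ?N * (2 / (1 + q ^ ?N)) * (q ^ (?N)\<^sup>2 * q ^ ?N)"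
      unfolding e r by (simp only: mult_1_right)
    moreover have "A * (2 / (1 + y)) * B + A * (2 / (1 + y)) * (B * y) = 2 * (A * B)"
      if "1 + y \<noteq> 0" for A B y :: 'a
      using that by (simp add: divide_simps) algebra
    ultimately show ?thesis using nz[of ?N] by presburger
  qed
  finally have "(\<Sum>s\<le>?N. ?a ?N s) = (\<Sum>s\<le>n. ?a n s) + 2 * ((-1) ^ ?N * q ^ (?N)\<^sup>2)"
    by (simp only: diff_eq_eq add.commute)
  then show ?case
    unfolding Suc.IH[symmetric] by (simp only: sum.lessThan_Suc distrib_left add.assoc)
qed

lemma summable_power_squares:
  fixes q :: "'a::{real_normed_field,banach}"
  assumes "norm q < 1"
  shows "summable (\<lambda>j. (-1) ^ Suc j * q ^ (Suc j)\<^sup>2)"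
proof (rule summable_comparison_test[OF _ summable_geometric[of "norm q"]])
  show "\<exists>N. \<forall>n\<ge>N. norm ((-1) ^ Suc n * q ^ (Suc n)\<^sup>2) \<le> norm q ^ n"
  proof (intro exI allI impI)
    fix n
    have "n \<le> (Suc n)\<^sup>2" by (simp add: power2_eq_square)
    then show "norm ((-1) ^ Suc n * q ^ (Suc n)\<^sup>2) \<le> norm q ^ n"
      using assms by (simp add: norm_mult norm_power power_decreasing del: power_Suc)
  qed
qed (use assms in auto)

text \<open>In Shanks' identity the summand \<open>s = 0\<close> is the product itself, because
  \<open>2 / (1 + q ^ 0) = 1\<close>. Each of the other \<open>n\<close> summands contains
  \<open>q ^ (s * Suc n)\<close> with \<open>s > 0\<close>, so together they are
  \<open>O (n * \<rho> ^ n)\<close>, while the left side is a partial sum of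
  \<open>theta4 q\<close>.\<close>

lemma ratio_prod_tendsto_theta4:
  fixes q :: "'a::{real_normed_field,banach}"
  assumes "norm q < 1"
  shows "(\<lambda>n. ratio_prod q n 0) \<longlonglongrightarrow> theta4 q"
proof -
  define \<rho> where "\<rho> = norm q"
  have \<rho>: "0 \<le> \<rho>" "\<rho> < 1" using assms by (auto simp: \<rho>_def)
  define B where "B = exp (2 / (1 - \<rho>)\<^sup>2)"
  let ?a = "\<lambda>n s. (-1) ^ s * (2 / (1 + q ^ s)) * ratio_prod q n s * q ^ (s * Suc n)"
  have nz: "1 + q ^ k \<noteq> 0" for k
    using one_pm_power_neq_0[OF assms] by (cases "k = 0") auto
  have R: "norm (ratio_prod q n s) \<le> B" for n s
  proof -
    have "norm (ratio_prod q n s) \<le> (\<Prod>k\<in>{s<..n}. (1 + \<rho> ^ k) / (1 - \<rho> ^ k))"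
      unfolding ratio_prod_def prod_norm[symmetric]
    proof (intro prod_mono conjI)
      fix k assume "k \<in> {s<..n}"
      then have pos: "0 < 1 - \<rho> ^ k" using one_minus_power_pos[OF \<rho>] by simp
      have "norm (1 - q ^ k) \<le> 1 + \<rho> ^ k"
        using norm_triangle_ineq4[of 1 "q ^ k"] by (simp add: norm_power \<rho>_def)
      moreover have "1 - \<rho> ^ k \<le> norm (1 + q ^ k)"
        using norm_diff_ineq[of 1 "q ^ k"] by (simp add: norm_power \<rho>_def)
      ultimately show "norm ((1 - q ^ k) / (1 + q ^ k)) \<le> (1 + \<rho> ^ k) / (1 - \<rho> ^ k)"
        using pos \<rho> by (auto simp: norm_divide intro!: frac_le)
    qed auto
    also have "\<dots> \<le> B" unfolding B_def using \<rho> by (intro ratio_prod_le_exp) auto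
    finally show ?thesis .
  qed
  have a: "norm (?a n (Suc s)) \<le> 2 / (1 - \<rho>) * B * \<rho> ^ n" for n s
  proof -
    have "1 - \<rho> \<le> norm (1 + q ^ Suc s)"
    proof -
      have "\<rho> ^ Suc s \<le> \<rho>" using \<rho> power_decreasing[of 1 "Suc s" \<rho>] by simp
      then show ?thesis
        using norm_diff_ineq[of 1 "q ^ Suc s"] by (simp add: norm_power \<rho>_def norm_mult)
    qed
    then have "norm (2 / (1 + q ^ Suc s)) \<le> 2 / (1 - \<rho>)"
      using \<rho> by (auto simp: norm_divide intro!: divide_left_mono mult_pos_pos)
    moreover have "norm (q ^ (Suc s * Suc n)) \<le> \<rho> ^ n"
      unfolding norm_power \<rho>_def[symmetric] using \<rho> by (intro power_decreasing) auto
    ultimately have "norm (2 / (1 + q ^ Suc s)) * norm (ratio_prod q n (Suc s)) * norm (q ^ (Suc s * Suc n))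
      \<le> 2 / (1 - \<rho>) * B * \<rho> ^ n"
      using R[of n "Suc s"] \<rho> by (intro mult_mono) (auto simp: B_def)
    moreover have "norm ((-1 :: 'a) ^ Suc s) = 1" by (simp add: norm_power del: power_Suc)
    ultimately show ?thesis by (simp only: norm_mult[of "_ * _ * _"] norm_mult[of "_ * _"] norm_mult[of "_ ^ _"] mult_1)
  qed
  have lim: "(\<lambda>n. 1 + 2 * (\<Sum>j<n. (-1) ^ Suc j * q ^ (Suc j)\<^sup>2)) \<longlonglongrightarrow> theta4 q"
    unfolding theta4_def
    by (intro tendsto_intros summable_LIMSEQ summable_power_squares assms)
  have eq: "1 + 2 * (\<Sum>j<n. (-1) ^ Suc j * q ^ (Suc j)\<^sup>2) = ratio_prod q n 0 + (\<Sum>s<n. ?a n (Suc s))" for n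
  proof -
    have "1 + 2 * (\<Sum>j<n. (-1) ^ Suc j * q ^ (Suc j)\<^sup>2) = (\<Sum>s\<le>n. ?a n s)"
      by (rule shanks_identity) (use nz in auto)
    also have "\<dots> = (\<Sum>s<Suc n. ?a n s)" by (simp only: lessThan_Suc_atMost)
    also have "\<dots> = ?a n 0 + (\<Sum>s<n. ?a n (Suc s))" by (rule sum.lessThan_Suc_shift)
    finally show ?thesis by simp
  qed
  have "(\<lambda>n. \<Sum>s<n. ?a n (Suc s)) \<longlonglongrightarrow> 0"
  proof (rule Lim_null_comparison)
    show "\<forall>\<^sub>F n in sequentially. norm (\<Sum>s<n. ?a n (Suc s)) \<le> (2 / (1 - \<rho>) * B) * (real n * \<rho> ^ n)"
    proof (intro always_eventually allI)
      fix n
      have "norm (\<Sum>s<n. ?a n (Suc s)) \<le> (\<Sum>s<n. 2 / (1 - \<rho>) * B * \<rho> ^ n)"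
        by (rule sum_norm_le) (rule a)
      then show "norm (\<Sum>s<n. ?a n (Suc s)) \<le> (2 / (1 - \<rho>) * B) * (real n * \<rho> ^ n)"
        by (simp add: mult_ac)
    qed
    have "(\<lambda>n. real n * \<rho> ^ n) \<longlonglongrightarrow> 0"
      using \<rho> by (intro powser_times_n_limit_0) auto
    then show "(\<lambda>n. (2 / (1 - \<rho>) * B) * (real n * \<rho> ^ n)) \<longlonglongrightarrow> 0"
      by (rule tendsto_mult_right_zero)
  qed
  from tendsto_diff[OF lim this] show ?thesis
    unfolding eq by simp
qed

theorem theta4_mult_overpart_gf:
  fixes q :: "'a::{real_normed_field,banach}"
  assumes "norm q < 1"
  shows "theta4 q * overpart_gf q = 1"
proof -
  have "ratio_prod q n 0 * overpart_prod n q = 1" for n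
  proof -
    have "{0<..n} = {1..n}" by auto
    then have "ratio_prod q n 0 * overpart_prod n q =
        (\<Prod>k=1..n. (1 - q ^ k) / (1 + q ^ k) * ((1 + q ^ k) / (1 - q ^ k)))"
      unfolding ratio_prod_def overpart_prod_def by (simp only: prod.distrib)
    also have "\<dots> = 1"
      by (rule prod.neutral) (use one_pm_power_neq_0[OF assms] in auto)
    finally show ?thesis .
  qed
  with tendsto_mult[OF ratio_prod_tendsto_theta4[OF assms] overpart_prod_tendsto[OF assms]]
  show ?thesis by (simp add: LIMSEQ_const_iff)
qed

section \<open>Poisson summation for the Gaussian\<close>

text \<open>Orthogonality to all \<open>cos (n t)\<close> implies orthogonality to all polynomials
  in \<open>cos t\<close>. Weierstrass approximation of \<open>H\<close> composed with
  \<open>arccos\<close> then bounds the integral of \<open>H^2\<close> by \<open>e\<close> times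
  that of the absolute value of \<open>H\<close>, for every \<open>e > 0\<close>.\<close>

lemma cosine_coeffs_zero_imp_zero:
  fixes H :: "real \<Rightarrow> real"
  assumes cont: "continuous_on {0..pi} H"
    and zero: "\<And>n::nat. integral {0..pi} (\<lambda>t. H t * cos (real n * t)) = 0"
    and "t \<in> {0..pi}"
  shows "H t = 0"
proof -
  note ci [continuous_intros] = cont
  have int: "f integrable_on {0..pi}" if "continuous_on {0..pi} f" for f :: "real \<Rightarrow> real"
    using that integrable_continuous_interval by blast
  have pow: "integral {0..pi} (\<lambda>t. H t * cos t ^ k * cos (real n * t)) = 0" for k n :: nat
  proof (induction k arbitrary: n)
    case 0
    then show ?case using zero by simp
  next
    case (Suc k)
    \<comment> \<open>\<open>m\<close> is the absolute value of \<open>n - 1\<close>: for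
      \<open>n = 0\<close> the product formula reads
      \<open>cos t = (cos t + cos t) / 2\<close>.\<close>
    define m where "m = (if n = 0 then 1 else n - 1)"
    have prod: "cos t * cos (real n * t) = (cos (real (Suc n) * t) + cos (real m * t)) / 2" for t :: real
    proof (cases n)
      case (Suc n')
      then have "real (Suc n) * t = real n * t + t" "real m * t = real n * t - t"
        by (simp_all add: m_def algebra_simps)
      then show ?thesis by (simp only: cos_add cos_diff) simp
    qed (simp add: m_def)
    have "(\<lambda>t. H t * cos t ^ Suc k * cos (real n * t)) =
        (\<lambda>t. (1/2) * (H t * cos t ^ k * cos (real (Suc n) * t)) + (1/2) * (H t * cos t ^ k * cos (real m * t)))"
    proof
      fix t :: real
      have "H t * cos t ^ Suc k * cos (real n * t) = H t * cos t ^ k * (cos t * cos (real n * t))" by simp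
      then show "H t * cos t ^ Suc k * cos (real n * t) = (1/2) * (H t * cos t ^ k * cos (real (Suc n) * t))
          + (1/2) * (H t * cos t ^ k * cos (real m * t))"
        unfolding prod by (simp add: algebra_simps)
    qed
    then have "integral {0..pi} (\<lambda>t. H t * cos t ^ Suc k * cos (real n * t)) =
        integral {0..pi} (\<lambda>t. (1/2) * (H t * cos t ^ k * cos (real (Suc n) * t))
          + (1/2) * (H t * cos t ^ k * cos (real m * t)))"
      by (simp only:)
    also have "\<dots> = (1/2) * integral {0..pi} (\<lambda>t. H t * cos t ^ k * cos (real (Suc n) * t))
        + (1/2) * integral {0..pi} (\<lambda>t. H t * cos t ^ k * cos (real m * t))"
      by (subst integral_add) (auto intro!: int continuous_intros)
    finally show ?case by (simp only: Suc mult_zero_right add_0)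
  qed
  have poly: "integral {0..pi} (\<lambda>t. H t * p (cos t)) = 0" if "real_polynomial_function p" for p
  proof -
    obtain a N where p: "p = (\<lambda>x. \<Sum>i\<le>N::nat. a i * x ^ i)"
      using \<open>real_polynomial_function p\<close> real_polynomial_function_iff_sum by blast
    have "(\<lambda>t. H t * p (cos t)) = (\<lambda>t. \<Sum>i\<le>N. a i * (H t * cos t ^ i * cos (real 0 * t)))"
      by (auto simp: p sum_distrib_left algebra_simps)
    then have "integral {0..pi} (\<lambda>t. H t * p (cos t)) =
        (\<Sum>i\<le>N. integral {0..pi} (\<lambda>t. a i * (H t * cos t ^ i * cos (real 0 * t))))"
      by (simp only:) (rule integral_sum, auto intro!: int continuous_intros)
    also have "\<dots> = 0"
      using pow[of _ 0] by (simp only: integral_mult_right mult_zero_right sum.neutral_const)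
    finally show ?thesis .
  qed
  have bound: "integral {0..pi} (\<lambda>t. H t * H t) \<le> e * integral {0..pi} (\<lambda>t. \<bar>H t\<bar>)" if e0: "0 < e" for e
  proof -
    have "continuous_on {-1..1} (\<lambda>x. H (arccos x))"
      using arccos_bounded by (intro continuous_on_compose2[OF cont continuous_on_arccos']) auto
    then obtain p where p: "real_polynomial_function p" "\<And>x. x \<in> {-1..1} \<Longrightarrow> \<bar>H (arccos x) - p x\<bar> < e"
      using Stone_Weierstrass_real_polynomial_function[of "{-1..1::real}" "\<lambda>x. H (arccos x)" e] e0 by auto
    have cp [continuous_intros]: "continuous_on {0..pi} (\<lambda>t. p (cos t))"
      using p(1) by (intro continuous_on_compose2[OF continuous_on_polymonial_function[of p UNIV]] continuous_intros)
        (auto simp: real_polynomial_function_eq)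
    have "integral {0..pi} (\<lambda>t. H t * H t) = integral {0..pi} (\<lambda>t. H t * (H t - p (cos t)) + H t * p (cos t))"
      by (simp add: algebra_simps)
    also have "\<dots> = integral {0..pi} (\<lambda>t. H t * (H t - p (cos t)))"
      using poly[OF p(1)] by (subst integral_add) (auto intro!: int continuous_intros)
    also have "\<dots> \<le> integral {0..pi} (\<lambda>t. e * \<bar>H t\<bar>)"
    proof (rule integral_le)
      fix t assume t: "t \<in> {0..pi}"
      have "\<bar>H t - p (cos t)\<bar> \<le> e"
        using p(2)[of "cos t"] t by (simp add: arccos_cos)
      then have "\<bar>H t\<bar> * \<bar>H t - p (cos t)\<bar> \<le> \<bar>H t\<bar> * e" by (intro mult_left_mono) auto
      moreover have "H t * (H t - p (cos t)) \<le> \<bar>H t\<bar> * \<bar>H t - p (cos t)\<bar>"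
        by (metis abs_ge_self abs_mult)
      ultimately show "H t * (H t - p (cos t)) \<le> e * \<bar>H t\<bar>" by (simp add: mult.commute)
    qed (auto intro!: int continuous_intros)
    finally show ?thesis by simp
  qed
  define J where "J = integral {0..pi} (\<lambda>t. \<bar>H t\<bar>)"
  have J: "0 \<le> J" unfolding J_def by (rule integral_nonneg) (auto intro!: int continuous_intros)
  have "integral {0..pi} (\<lambda>t. H t * H t) \<le> 0"
  proof (rule field_le_epsilon)
    fix e :: real assume e: "0 < e"
    have "integral {0..pi} (\<lambda>t. H t * H t) \<le> e / (J + 1) * J"
      using bound[of "e / (J + 1)"] e J by (simp add: J_def)
    also have "\<dots> \<le> e" using e J by (simp add: field_simps)
    finally show "integral {0..pi} (\<lambda>t. H t * H t) \<le> 0 + e" by simp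
  qed
  moreover have "0 \<le> integral {0..pi} (\<lambda>t. H t * H t)"
    by (rule integral_nonneg) (auto intro!: int continuous_intros)
  ultimately have "integral {0..pi} (\<lambda>t. H t * H t) = 0" by simp
  then have "\<forall>t\<in>{0..pi}. H t * H t = 0"
    by (subst (asm) integral_eq_0_iff) (auto intro!: continuous_intros)
  then show ?thesis using assms(3) by simp
qed

text \<open>Real part of the characteristic function of the standard normal distribution.\<close>

lemma integral_std_normal_cos:
  "integrable lborel (\<lambda>x. std_normal_density x * cos (t * x))"
  "(LINT x|lborel. std_normal_density x * cos (t * x)) = exp (- t\<^sup>2 / 2)"
proof -
  interpret real_distribution std_normal_distribution by (rule real_dist_normal_dist)
  have int: "integrable std_normal_distribution (\<lambda>x. iexp (t * x))"
    by (rule integrable_const_bound[of _ 1]) auto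
  have "(CLINT x|std_normal_distribution. iexp (t * x)) = complex_of_real (exp (- t\<^sup>2 / 2))"
    using char_std_normal_distribution unfolding char_def by metis
  then have "(LINT x|std_normal_distribution. Re (iexp (t * x))) = exp (- t\<^sup>2 / 2)"
    using integral_Re[OF int] by simp
  then have *: "(LINT x|std_normal_distribution. cos (t * x)) = exp (- t\<^sup>2 / 2)"
    by (simp add: Re_exp)
  have "integrable std_normal_distribution (\<lambda>x. Re (iexp (t * x)))"
    using int by (rule integrable_Re)
  then have i: "integrable std_normal_distribution (\<lambda>x. cos (t * x))"
    by (simp add: Re_exp)
  show "integrable lborel (\<lambda>x. std_normal_density x * cos (t * x))"
    using i by (subst (asm) integrable_density) (auto simp: normal_density_nonneg)
  show "(LINT x|lborel. std_normal_density x * cos (t * x)) = exp (- t\<^sup>2 / 2)"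
    using * by (subst (asm) integral_density) (auto simp: normal_density_nonneg)
qed

lemma gaussian_cosine_integral:
  fixes c n :: real
  assumes "0 < c"
  shows "((\<lambda>u. exp (- c * u\<^sup>2) * cos (n * u)) has_integral (sqrt (pi / c) * exp (- n\<^sup>2 / (4 * c)))) UNIV"
proof -
  define s where "s = sqrt (2 * c)"
  have s: "0 < s" "s\<^sup>2 = 2 * c" using assms by (auto simp: s_def)
  define f where "f = (\<lambda>x. std_normal_density x * cos ((n / s) * x))"
  have "(f has_integral exp (- (n / s)\<^sup>2 / 2)) UNIV"
    using has_integral_integral_real[OF integral_std_normal_cos(1)[of "n / s"]]
    unfolding integral_std_normal_cos(2) f_def .
  then have "has_bochner_integral lborel f (exp (- (n / s)\<^sup>2 / 2))"
    using integral_std_normal_cos[of "n / s"] unfolding f_def has_bochner_integral_iff by simp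
  then have "has_bochner_integral lborel (\<lambda>x. f (0 + s * x)) (exp (- (n / s)\<^sup>2 / 2) /\<^sub>R \<bar>s\<bar>)"
    by (rule lborel_has_bochner_integral_real_affine_iff[THEN iffD1, rotated]) (use s(1) in simp)
  then have "((\<lambda>x. f (0 + s * x)) has_integral (exp (- (n / s)\<^sup>2 / 2) /\<^sub>R \<bar>s\<bar>)) UNIV"
    using has_integral_integral_real[of "\<lambda>x. f (0 + s * x)"] unfolding has_bochner_integral_iff by simp
  then have "((\<lambda>x. sqrt (2 * pi) * f (0 + s * x)) has_integral sqrt (2 * pi) * (exp (- (n / s)\<^sup>2 / 2) /\<^sub>R \<bar>s\<bar>)) UNIV"
    by (rule has_integral_mult_right)
  moreover have "sqrt (2 * pi) * f (0 + s * x) = exp (- c * x\<^sup>2) * cos (n * x)" for x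
    using s by (simp add: f_def std_normal_density_def power_mult_distrib)
  moreover have "sqrt (2 * pi) * (exp (- (n / s)\<^sup>2 / 2) /\<^sub>R \<bar>s\<bar>) = sqrt (pi / c) * exp (- n\<^sup>2 / (4 * c))"
  proof -
    have "- (n / s)\<^sup>2 / 2 = - n\<^sup>2 / (4 * c)" using s by (simp add: power_divide)
    moreover have "sqrt (2 * pi) / \<bar>s\<bar> = sqrt (pi / c)"
    proof -
      have "sqrt (2 * pi) / \<bar>s\<bar> = sqrt ((2 * pi) / (2 * c))"
        using s by (simp only: s_def real_sqrt_divide abs_of_pos)
      then show ?thesis by simp
    qed
    moreover have "sqrt (2 * pi) * (E /\<^sub>R \<bar>s\<bar>) = sqrt (2 * pi) / \<bar>s\<bar> * E" for E
      by (simp add: divide_inverse)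
    ultimately show ?thesis by (simp only:)
  qed
  ultimately show ?thesis by (simp only:)
qed

lemma series_integral:
  fixes f :: "nat \<Rightarrow> real \<Rightarrow> 'a::banach"
  assumes cont: "\<And>j. continuous_on {a..b} (f j)"
    and bound: "\<And>j t. t \<in> {a..b} \<Longrightarrow> norm (f j t) \<le> M j" and M: "summable M"
  shows "continuous_on {a..b} (\<lambda>t. \<Sum>j. f j t)"
    and "(\<lambda>j. integral {a..b} (f j)) sums integral {a..b} (\<lambda>t. \<Sum>j. f j t)"
proof -
  have u: "uniform_limit {a..b} (\<lambda>n t. \<Sum>j<n. f j t) (\<lambda>t. \<Sum>j. f j t) sequentially"
    by (rule Weierstrass_m_test[OF _ M]) (use bound in auto)
  have c: "continuous_on {a..b} (\<lambda>t. \<Sum>j<n. f j t)" for n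
    by (intro continuous_intros cont)
  show "continuous_on {a..b} (\<lambda>t. \<Sum>j. f j t)"
    by (rule uniform_limit_theorem[OF _ u]) (auto intro!: always_eventually c)
  obtain I J where I: "\<And>n. ((\<lambda>t. \<Sum>j<n. f j t) has_integral I n) {a..b}"
    and J: "((\<lambda>t. \<Sum>j. f j t) has_integral J) {a..b}" and lim: "I \<longlonglongrightarrow> J"
    using uniform_limit_integral[OF u c sequentially_bot] by blast
  have "I = (\<lambda>n. \<Sum>j<n. integral {a..b} (f j))"
    using integral_unique[OF I] integral_sum[of _ f "{a..b}"]
      integrable_continuous_interval[OF cont] by fastforce
  with lim integral_unique[OF J] show "(\<lambda>j. integral {a..b} (f j)) sums integral {a..b} (\<lambda>t. \<Sum>j. f j t)"
    by (simp add: sums_def)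
qed

lemma integral_cos_multiple:
  "integral {0..pi} (\<lambda>t. cos (of_int k * t)) = (if k = 0 then pi else 0)"
proof (cases "k = 0")
  case False
  have "((\<lambda>t. cos (of_int k * t)) has_integral (sin (of_int k * pi) / of_int k - sin (of_int k * 0) / of_int k)) {0..pi}"
  proof (rule fundamental_theorem_of_calculus)
    fix t :: real
    show "((\<lambda>t. sin (of_int k * t) / of_int k) has_vector_derivative cos (of_int k * t)) (at t within {0..pi})"
      unfolding has_real_derivative_iff_has_vector_derivative[symmetric]
      by (rule derivative_eq_intros refl | use False in simp)+
  qed simp
  then show ?thesis using False by (simp add: integral_unique mult.commute)
qed simp

lemma integral_cos_cos:
  "integral {0..pi} (\<lambda>t. cos (real n * t) * cos (real m * t)) =
     (if n = m then (if n = 0 then pi else pi / 2) else 0)"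
proof -
  have "cos (real n * t) * cos (real m * t) =
      (1/2) * cos (of_int (int n - int m) * t) + (1/2) * cos (of_int (int n + int m) * t)" for t :: real
  proof -
    have "of_int (int n - int m) * t = real n * t - real m * t" "of_int (int n + int m) * t = real n * t + real m * t"
      by (simp_all add: algebra_simps)
    then show ?thesis by (simp only: cos_add cos_diff) (simp add: field_simps)
  qed
  then have "integral {0..pi} (\<lambda>t. cos (real n * t) * cos (real m * t)) =
     integral {0..pi} (\<lambda>t. (1/2) * cos (of_int (int n - int m) * t) + (1/2) * cos (of_int (int n + int m) * t))"
    by (simp only:)
  also have "\<dots> = (1/2) * integral {0..pi} (\<lambda>t. cos (of_int (int n - int m) * t))
      + (1/2) * integral {0..pi} (\<lambda>t. cos (of_int (int n + int m) * t))"
    by (subst integral_add) (auto intro!: integrable_continuous_interval continuous_intros)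
  finally show ?thesis unfolding integral_cos_multiple by auto
qed

text \<open>By evenness the half-line carries half of the integral. The limit runs along multiples
  of \<open>pi\<close> because the intervals unfolded from \<open>[0, pi]\<close> end there.\<close>

lemma gaussian_cosine_half_line:
  fixes c n :: real
  assumes "0 < c"
  shows "(\<lambda>N. integral {0..real N * pi} (\<lambda>u. exp (- c * u\<^sup>2) * cos (n * u)))
    \<longlonglongrightarrow> sqrt (pi / c) * exp (- n\<^sup>2 / (4 * c)) / 2"
proof -
  define g where "g = (\<lambda>u. exp (- c * u\<^sup>2) * cos (n * u))"
  define I where "I = sqrt (pi / c) * exp (- n\<^sup>2 / (4 * c))"
  have g: "(g has_integral I) UNIV"
    unfolding g_def I_def by (rule gaussian_cosine_integral[OF assms])
  have int: "g integrable_on {a..b}" for a b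
    unfolding g_def by (intro integrable_continuous_interval continuous_intros)
  have "(\<lambda>N. integral {- (real N * pi)..real N * pi} g) \<longlonglongrightarrow> I"
  proof (rule LIMSEQ_I)
    fix e :: real assume "0 < e"
    then obtain B where B: "\<And>a b. ball 0 B \<subseteq> cbox a b \<Longrightarrow> norm (integral (cbox a b) g - I) < e"
      using g unfolding has_integral_alt' by (simp only: UNIV_I if_True) meson
    obtain N0 :: nat where N0: "B < real N0" using reals_Archimedean2 by blast
    show "\<exists>no. \<forall>n\<ge>no. norm (integral {- (real n * pi)..real n * pi} g - I) < e"
    proof (intro exI allI impI)
      fix N assume "N0 \<le> N"
      have "real N0 \<le> real N * pi"
        using \<open>N0 \<le> N\<close> pi_ge_two mult_mono[of "real N0" "real N" 1 pi] by simp
      then have "ball 0 B \<subseteq> cbox (- (real N * pi)) (real N * pi)"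
        using N0 by (auto simp: dist_real_def)
      from B[OF this] show "norm (integral {- (real N * pi)..real N * pi} g - I) < e" by simp
    qed
  qed
  moreover have "integral {- b..b} g = 2 * integral {0..b} g" if "0 \<le> b" for b
  proof -
    have "integral {- b..b} g = integral {-b..0} g + integral {0..b} g"
      using Henstock_Kurzweil_Integration.integral_combine[of "-b" 0 b g] that int by simp
    also have "integral {-b..0} g = integral {-b..0} (\<lambda>x. g (- x))" by (simp add: g_def)
    also have "\<dots> = integral {0..b} g" using Henstock_Kurzweil_Integration.integral_reflect_real[of b 0 g] by simp
    finally show ?thesis by simp
  qed
  ultimately have "(\<lambda>N. 2 * integral {0..real N * pi} g) \<longlonglongrightarrow> I" by simp
  then have "(\<lambda>N. (1/2) * (2 * integral {0..real N * pi} g)) \<longlonglongrightarrow> (1/2) * I"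
    by (rule tendsto_mult_left)
  then show ?thesis by (simp add: g_def I_def)
qed

lemma cos_even_shift: "cos (real n * (t + 2 * real i * pi)) = cos (real n * t)"
proof -
  have "real n * (t + 2 * real i * pi) = real n * t + 2 * real (n * i) * pi"
    by (simp add: algebra_simps)
  then show ?thesis by (simp only: cos_add cos_2npi sin_2npi mult_1_right mult_zero_right diff_zero)
qed

text \<open>\<open>unfold_line j\<close> maps \<open>[0, \<pi>]\<close> onto \<open>[j \<pi>, (j + 1) \<pi>]\<close> by a translation or reflection preserving \<open>cos\<close>,
  so that integrals of the periodization over \<open>[0, \<pi>]\<close> unfold to integrals over the half-line.\<close>

definition unfold_line :: "nat \<Rightarrow> real \<Rightarrow> real" where
  "unfold_line j t = (if even j then t + real j * pi else real (Suc j) * pi - t)"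

lemma unfold_line_ge: "t \<in> {0..pi} \<Longrightarrow> real j * pi \<le> unfold_line j t"
  by (auto simp: unfold_line_def algebra_simps)

lemma cos_unfold_line: "cos (real n * unfold_line j t) = cos (real n * t)"
proof (cases "even j")
  case True
  then obtain i where "j = 2 * i" by blast
  then show ?thesis using cos_even_shift[of n t i] by (simp add: unfold_line_def)
next
  case False
  then obtain i where i: "Suc j = 2 * i" by (metis even_Suc evenE)
  have "unfold_line j t = - t + 2 * real i * pi"
    using False i by (simp add: unfold_line_def)
  then have "cos (real n * unfold_line j t) = cos (real n * (- t))"
    using cos_even_shift[of n "-t" i] by simp
  then show ?thesis by simp
qed

lemma integral_unfold_line:
  assumes "continuous_on UNIV g"
  shows "integral {0..pi} (\<lambda>t. g (unfold_line j t)) = integral {real j * pi..real (Suc j) * pi} (g :: real \<Rightarrow> real)"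
proof -
  let ?I = "integral {real j * pi..real (Suc j) * pi} g"
  have g: "(g has_integral ?I) (cbox (real j * pi) (real (Suc j) * pi))"
    unfolding interval_cbox[symmetric] using continuous_on_subset[OF assms subset_UNIV]
    by (intro integrable_integral integrable_continuous_interval)
  show ?thesis
  proof (cases "even j")
    case True
    have "((\<lambda>x. g (x + real j * pi)) has_integral ?I) {0..pi}"
      using has_integral_affinity'[OF g, of 1 "real j * pi"] by (simp add: algebra_simps)
    then show ?thesis using True by (simp add: unfold_line_def integral_unique)
  next
    case False
    have "((\<lambda>x. g (- x)) has_integral ?I) (cbox (- (real (Suc j) * pi)) (- (real j * pi)))"
      using g by (rule has_integral_reflect_lemma)
    from has_integral_affinity'[OF this, of 1 "- (real (Suc j) * pi)"]
    have "((\<lambda>x. g (- (x + - (real (Suc j) * pi)))) has_integral ?I) {0..pi}"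
      by (simp add: algebra_simps)
    then have "((\<lambda>x. g (real (Suc j) * pi - x)) has_integral ?I) {0..pi}"
      by (simp only: minus_add_distrib minus_minus add.commute diff_conv_add_uminus)
    then show ?thesis using False by (simp only: unfold_line_def if_False integral_unique)
  qed
qed

text \<open>Both sides are continuous on \<open>[0, pi]\<close> with the same cosine coefficients.
  On the left a coefficient unfolds to a Gaussian integral over the half-line; on the right it comes
  from orthogonality, where the weight \<open>1 / 2\<close> at \<open>n = 0\<close> offsets that the
  constant function has squared norm \<open>pi\<close> instead of \<open>pi / 2\<close>.\<close>

lemma gaussian_poisson:
  fixes c t :: real
  assumes c: "0 < c" and t: "t \<in> {0..pi}"
  defines "\<beta> \<equiv> sqrt (pi / c) / pi"
  shows "(\<Sum>j. exp (- c * (unfold_line j t)\<^sup>2)) =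
    (\<Sum>n. (if n = 0 then 1 / 2 else 1) * \<beta> * exp (- (real n)\<^sup>2 / (4 * c)) * cos (real n * t))"
proof -
  define b where "b = (\<lambda>n::nat. (if n = 0 then 1 / 2 else 1) * \<beta> * exp (- (real n)\<^sup>2 / (4 * c)))"
  define F where "F = (\<lambda>t. \<Sum>j. exp (- c * (unfold_line j t)\<^sup>2))"
  define G where "G = (\<lambda>t. \<Sum>n. b n * cos (real n * t))"
  have geom: "summable (\<lambda>j. exp (- a * (real j)\<^sup>2))" if "0 < a" for a
  proof (rule summable_comparison_test[OF _ summable_geometric[of "exp (- a)"]])
    show "\<exists>N. \<forall>n\<ge>N. norm (exp (- a * (real n)\<^sup>2)) \<le> exp (- a) ^ n"
    proof (intro exI allI impI)
      fix n
      have "real n \<le> (real n)\<^sup>2" by (cases n) (auto simp: power2_eq_square)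
      then have "- a * (real n)\<^sup>2 \<le> real n * (- a)" using that by simp
      then show "norm (exp (- a * (real n)\<^sup>2)) \<le> exp (- a) ^ n"
        by (simp add: exp_of_nat_mult[symmetric])
    qed
  qed (use that in auto)
  have \<beta>: "0 < \<beta>" using c by (simp add: \<beta>_def)
  have cu: "continuous_on A (unfold_line j)" for A j
    unfolding unfold_line_def by (cases "even j") (auto intro!: continuous_intros)
  have Fb: "norm (exp (- c * (unfold_line j t)\<^sup>2) * cos (real n * t)) \<le> exp (- (c * pi\<^sup>2) * (real j)\<^sup>2)"
    if "t \<in> {0..pi}" for j n t
  proof -
    have "(real j * pi)\<^sup>2 \<le> (unfold_line j t)\<^sup>2"
      using unfold_line_ge[OF that] by (intro power_mono) auto
    then have "exp (- c * (unfold_line j t)\<^sup>2) \<le> exp (- (c * pi\<^sup>2) * (real j)\<^sup>2)"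
      using c by (simp add: power_mult_distrib mult_ac)
    then show ?thesis
      using mult_mono[OF _ abs_cos_le_one[of "real n * t"], of "exp (- c * (unfold_line j t)\<^sup>2)"]
      by (simp add: abs_mult)
  qed
  have Gb: "norm (b n * cos (real n * t) * cos (real m * t)) \<le> \<beta> * exp (- (1 / (4 * c)) * (real n)\<^sup>2)" for n m t
  proof -
    have "\<bar>cos (real n * t)\<bar> * \<bar>cos (real m * t)\<bar> \<le> 1 * 1"
      by (intro mult_mono) auto
    then have "\<bar>b n\<bar> * (\<bar>cos (real n * t)\<bar> * \<bar>cos (real m * t)\<bar>) \<le> \<bar>b n\<bar> * 1"
      by (intro mult_left_mono) auto
    moreover have "\<bar>b n\<bar> \<le> \<beta> * exp (- (1 / (4 * c)) * (real n)\<^sup>2)"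
      using \<beta> by (simp add: b_def abs_mult)
    ultimately show ?thesis by (simp add: abs_mult)
  qed
  have sF: "summable (\<lambda>j. exp (- (c * pi\<^sup>2) * (real j)\<^sup>2))" using c by (intro geom) auto
  have sG: "summable (\<lambda>n. \<beta> * exp (- (1 / (4 * c)) * (real n)\<^sup>2))" using c by (intro summable_mult geom) auto
  have sumF: "summable (\<lambda>j. exp (- c * (unfold_line j t)\<^sup>2))" if "t \<in> {0..pi}" for t
    by (rule summable_comparison_test[OF _ sF]) (use Fb[OF that, of _ 0] in auto)
  have sumG: "summable (\<lambda>n. b n * cos (real n * t))" for t
    by (rule summable_comparison_test[OF _ sG]) (use Gb[of _ t 0] in auto)
  have F: "continuous_on {0..pi} F"
  proof -
    have "continuous_on {0..pi} (\<lambda>t. \<Sum>j. exp (- c * (unfold_line j t)\<^sup>2) * cos (real 0 * t))"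
      by (rule series_integral[OF _ Fb sF]) (auto intro!: continuous_intros cu)
    then show ?thesis by (simp add: F_def)
  qed
  have G: "continuous_on {0..pi} G"
  proof -
    have "continuous_on {0..pi} (\<lambda>t. \<Sum>n. b n * cos (real n * t) * cos (real 0 * t))"
      by (rule series_integral[OF _ Gb sG]) (auto intro!: continuous_intros)
    then show ?thesis by (simp add: G_def)
  qed
  have intF: "integral {0..pi} (\<lambda>t. F t * cos (real n * t)) = sqrt (pi / c) * exp (- (real n)\<^sup>2 / (4 * c)) / 2" for n
  proof -
    define g where "g = (\<lambda>u. exp (- c * u\<^sup>2) * cos (real n * u))"
    have cg: "continuous_on A g" for A unfolding g_def by (intro continuous_intros)
    have "(\<lambda>j. integral {0..pi} (\<lambda>t. exp (- c * (unfold_line j t)\<^sup>2) * cos (real n * t))) sums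
        integral {0..pi} (\<lambda>t. \<Sum>j. exp (- c * (unfold_line j t)\<^sup>2) * cos (real n * t))"
      by (rule series_integral[OF _ Fb sF]) (auto intro!: continuous_intros cu)
    moreover have "integral {0..pi} (\<lambda>t. \<Sum>j. exp (- c * (unfold_line j t)\<^sup>2) * cos (real n * t)) =
        integral {0..pi} (\<lambda>t. F t * cos (real n * t))"
      unfolding F_def by (rule integral_cong) (rule suminf_mult2[symmetric, OF sumF])
    moreover have "integral {0..pi} (\<lambda>t. exp (- c * (unfold_line j t)\<^sup>2) * cos (real n * t)) =
        integral {real j * pi..real (Suc j) * pi} g" for j
    proof -
      have "exp (- c * (unfold_line j t)\<^sup>2) * cos (real n * t) = g (unfold_line j t)" for t
        by (simp only: g_def cos_unfold_line)
      then show ?thesis by (simp only: integral_unfold_line[OF cg])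
    qed
    ultimately have "(\<lambda>j. integral {real j * pi..real (Suc j) * pi} g) sums integral {0..pi} (\<lambda>t. F t * cos (real n * t))"
      by (simp only:)
    moreover have "(\<Sum>j<N. integral {real j * pi..real (Suc j) * pi} g) = integral {0..real N * pi} g" for N
    proof (induction N)
      case (Suc N)
      have "integral {0..real N * pi} g + integral {real N * pi..real (Suc N) * pi} g = integral {0..real (Suc N) * pi} g"
        by (rule Henstock_Kurzweil_Integration.integral_combine)
          (auto intro!: integrable_continuous_interval cg)
      then show ?case using Suc by simp
    qed simp
    ultimately have "(\<lambda>N. integral {0..real N * pi} g) \<longlonglongrightarrow> integral {0..pi} (\<lambda>t. F t * cos (real n * t))"
      by (simp only: sums_def)
    with gaussian_cosine_half_line[OF c, of "real n"] show ?thesis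
      unfolding g_def by (rule LIMSEQ_unique[rotated])
  qed
  have intG: "integral {0..pi} (\<lambda>t. G t * cos (real m * t)) = sqrt (pi / c) * exp (- (real m)\<^sup>2 / (4 * c)) / 2" for m
  proof -
    have "(\<lambda>n. integral {0..pi} (\<lambda>t. b n * cos (real n * t) * cos (real m * t))) sums
        integral {0..pi} (\<lambda>t. \<Sum>n. b n * cos (real n * t) * cos (real m * t))"
      by (rule series_integral[OF _ Gb sG]) (auto intro!: continuous_intros)
    moreover have "integral {0..pi} (\<lambda>t. \<Sum>n. b n * cos (real n * t) * cos (real m * t)) =
        integral {0..pi} (\<lambda>t. G t * cos (real m * t))"
      unfolding G_def by (rule integral_cong) (rule suminf_mult2[symmetric, OF sumG])
    moreover have "integral {0..pi} (\<lambda>t. b n * cos (real n * t) * cos (real m * t)) =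
        (if n = m then b m * (if m = 0 then pi else pi / 2) else 0)" for n
      using integral_cos_cos[of n m] by (simp add: mult.assoc)
    ultimately have "(\<lambda>n. if n = m then b m * (if m = 0 then pi else pi / 2) else 0) sums
        integral {0..pi} (\<lambda>t. G t * cos (real m * t))"
      by (simp only:)
    then have "integral {0..pi} (\<lambda>t. G t * cos (real m * t)) = b m * (if m = 0 then pi else pi / 2)"
      using sums_single[of m "\<lambda>_. b m * (if m = 0 then pi else pi / 2)"] sums_unique2 by blast
    then show ?thesis by (auto simp: b_def \<beta>_def)
  qed
  have "F t - G t = 0"
  proof (rule cosine_coeffs_zero_imp_zero[OF _ _ t])
    show "continuous_on {0..pi} (\<lambda>t. F t - G t)" by (intro continuous_intros F G)
    fix n
    have "integral {0..pi} (\<lambda>t. F t * cos (real n * t) - G t * cos (real n * t)) = 0"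
      by (subst integral_diff)
        (auto simp: intF intG intro!: integrable_continuous_interval continuous_intros F G)
    then show "integral {0..pi} (\<lambda>t. (F t - G t) * cos (real n * t)) = 0"
      by (simp add: left_diff_distrib)
  qed
  then show ?thesis by (simp add: F_def G_def b_def)
qed

section \<open>The transformation formula of the theta function\<close>

text \<open>Poisson summation at the endpoint \<open>t = pi\<close> with
  \<open>c = 1 / (4 x)\<close>: there \<open>cos (n pi) = (-1)^n\<close> produces
  \<open>theta4\<close>, and the points \<open>unfold_line j pi\<close> are the odd multiples of
  \<open>pi\<close>, each hit by two consecutive \<open>j\<close>.\<close>

lemma theta4_exp_real:
  fixes x :: real
  assumes x: "0 < x"
  shows "theta4 (exp (- x)) = 2 * sqrt (pi / x) * (\<Sum>m. exp (- pi\<^sup>2 * (2 * real m + 1)\<^sup>2 / (4 * x)))"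
proof -
  define c where "c = 1 / (4 * x)"
  have c: "0 < c" using x by (simp add: c_def)
  define \<beta> where "\<beta> = sqrt (pi / c) / pi"
  have \<beta>: "\<beta> = 2 * sqrt (x / pi)"
  proof -
    have "sqrt (pi / c) = sqrt (4 * (pi * pi) * (x / pi))" by (simp add: c_def)
    also have "\<dots> = 2 * pi * sqrt (x / pi)" by (simp only: real_sqrt_mult) (simp add: real_sqrt_mult[symmetric])
    finally show ?thesis by (simp add: \<beta>_def)
  qed
  define L where "L = (\<lambda>j. exp (- c * (unfold_line j pi)\<^sup>2))"
  define w where "w = (\<lambda>m. exp (- pi\<^sup>2 * (2 * real m + 1)\<^sup>2 / (4 * x)))"
  define e where "e = (\<lambda>n. (if n = 0 then 1 / 2 else 1) * \<beta> * exp (- (real n)\<^sup>2 / (4 * c)) * cos (real n * pi))"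
  have eq: "suminf L = suminf e"
    unfolding L_def e_def \<beta>_def by (rule gaussian_poisson[OF c]) simp
  have L: "summable L"
  proof (rule summable_comparison_test[OF _ summable_geometric[of "exp (- c)"]])
    show "\<exists>N. \<forall>n\<ge>N. norm (L n) \<le> exp (- c) ^ n"
    proof (intro exI allI impI)
      fix n
      have "real n \<le> real n * pi" using pi_ge_two mult_left_mono[of 1 pi "real n"] by simp
      also have "\<dots> \<le> unfold_line n pi" by (rule unfold_line_ge) simp
      finally have "(real n)\<^sup>2 \<le> (unfold_line n pi)\<^sup>2" by (intro power_mono) auto
      moreover have "real n \<le> (real n)\<^sup>2" by (cases n) (auto simp: power2_eq_square)
      ultimately have "real n \<le> (unfold_line n pi)\<^sup>2" by linarith
      then have "- c * (unfold_line n pi)\<^sup>2 \<le> real n * (- c)" using c by simp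
      then show "norm (L n) \<le> exp (- c) ^ n"
        by (simp add: L_def exp_of_nat_mult[symmetric])
    qed
  qed (use c in auto)
  have "(\<lambda>n. sum L {n * 2..<n * 2 + 2}) sums suminf L"
    by (rule sums_group) (use L summable_sums in auto)
  moreover have "sum L {n * 2..<n * 2 + 2} = 2 * w n" for n
  proof -
    have "{n * 2..<n * 2 + 2} = {2 * n, Suc (2 * n)}" by auto
    moreover have "unfold_line (2 * n) pi = (2 * real n + 1) * pi" "unfold_line (Suc (2 * n)) pi = (2 * real n + 1) * pi"
      by (simp_all add: unfold_line_def algebra_simps)
    ultimately show ?thesis by (simp add: L_def w_def c_def power_mult_distrib mult_ac)
  qed
  ultimately have w2: "(\<lambda>n. 2 * w n) sums suminf L" by simp
  have "(\<lambda>n. (1/2) * (2 * w n)) sums ((1/2) * suminf L)"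
    by (rule sums_mult[OF w2])
  then have w: "suminf L = 2 * suminf w" by (simp add: sums_iff)
  have e0: "e 0 = \<beta> / 2" by (simp add: e_def)
  have eS: "e (Suc j) = \<beta> * ((-1) ^ Suc j * exp (- x) ^ (Suc j)\<^sup>2)" for j
  proof -
    have "exp (- x) ^ (Suc j)\<^sup>2 = exp (- (real (Suc j))\<^sup>2 / (4 * c))"
      using x by (simp add: exp_of_nat_mult[symmetric] c_def)
    then show ?thesis unfolding e_def by (simp only: cos_npi) simp
  qed
  have th: "summable (\<lambda>j. (-1) ^ Suc j * exp (- x) ^ (Suc j)\<^sup>2)"
    by (rule summable_power_squares) (use x in simp)
  then have "summable (\<lambda>j. e (Suc j))" unfolding eS by (rule summable_mult)
  then have "summable e" by (subst (asm) summable_Suc_iff)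
  then have "suminf e = e 0 + (\<Sum>j. e (Suc j))" by (rule suminf_split_head[THEN eq_diff_eq[THEN iffD1, THEN sym], simplified add.commute])
  also have "(\<Sum>j. e (Suc j)) = \<beta> * (\<Sum>j. (-1) ^ Suc j * exp (- x) ^ (Suc j)\<^sup>2)"
    unfolding eS by (rule suminf_mult[OF th])
  finally have "suminf e = \<beta> / 2 * theta4 (exp (- x))"
    by (simp add: e0 theta4_def algebra_simps)
  then have "sqrt (x / pi) * theta4 (exp (- x)) = 2 * suminf w"
    using eq w \<beta> by simp
  moreover have "sqrt (pi / x) * sqrt (x / pi) = 1"
    using x by (simp add: real_sqrt_mult[symmetric])
  ultimately have "theta4 (exp (- x)) = sqrt (pi / x) * (2 * suminf w)"
    by (metis mult.assoc mult_1)
  then show ?thesis by (simp add: w_def)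
qed

text \<open>On a small closed disc \<open>Re (h z)\<close> has a positive minimum
  \<open>\<delta>\<close>; with \<open>real j \<le> l j\<close> the terms are at most
  \<open>exp (- \<delta>) ^ j\<close>, so the convergence is locally uniform. Both sides of the
  theta transformation are of this type.\<close>

lemma holomorphic_on_exp_series:
  fixes h :: "complex \<Rightarrow> complex" and a :: "nat \<Rightarrow> complex" and l :: "nat \<Rightarrow> real"
  assumes S: "open S" and h: "h holomorphic_on S" and pos: "\<And>z. z \<in> S \<Longrightarrow> 0 < Re (h z)"
    and a: "\<And>j. norm (a j) \<le> 1" and l: "\<And>j. real j \<le> l j"
  shows "(\<lambda>z. \<Sum>j. a j * exp (- of_real (l j) * h z)) holomorphic_on S"
proof (rule holomorphic_uniform_sequence[OF S])
  show "(\<lambda>z. \<Sum>j<n. a j * exp (- of_real (l j) * h z)) holomorphic_on S" for n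
    by (intro holomorphic_intros h)
  fix z assume "z \<in> S"
  then obtain d where d: "0 < d" "cball z d \<subseteq> S" using S open_contains_cball by blast
  have c: "continuous_on (cball z d) (\<lambda>w. Re (h w))"
    using holomorphic_on_imp_continuous_on[OF holomorphic_on_subset[OF h d(2)]] by (intro continuous_intros)
  then obtain w where w: "w \<in> cball z d" "\<And>v. v \<in> cball z d \<Longrightarrow> Re (h w) \<le> Re (h v)"
    using continuous_attains_inf[OF compact_cball _ c] d(1) by fastforce
  define \<delta> where "\<delta> = Re (h w)"
  have \<delta>: "0 < \<delta>" using w(1) d(2) pos unfolding \<delta>_def by blast
  have "uniform_limit (cball z d) (\<lambda>n z. \<Sum>j<n. a j * exp (- of_real (l j) * h z))
      (\<lambda>z. \<Sum>j. a j * exp (- of_real (l j) * h z)) sequentially"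
  proof (rule Weierstrass_m_test)
    fix j v assume v: "v \<in> cball z d"
    have "real j * \<delta> \<le> l j * Re (h v)"
      using w(2)[OF v] l[of j] \<delta> by (intro mult_mono) (auto simp: \<delta>_def)
    then have "exp (- l j * Re (h v)) \<le> exp (real j * (- \<delta>))" by simp
    then have "norm (a j) * exp (- l j * Re (h v)) \<le> 1 * exp (real j * (- \<delta>))"
      using a by (intro mult_mono) auto
    then show "norm (a j * exp (- of_real (l j) * h v)) \<le> exp (- \<delta>) ^ j"
      by (simp add: norm_mult exp_of_nat_mult[symmetric])
  next
    show "summable (\<lambda>j. exp (- \<delta>) ^ j)" using \<delta> by (intro summable_geometric) auto
  qed
  then show "\<exists>d>0. cball z d \<subseteq> S \<and> uniform_limit (cball z d) (\<lambda>n z. \<Sum>j<n. a j * exp (- of_real (l j) * h z))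
      (\<lambda>z. \<Sum>j. a j * exp (- of_real (l j) * h z)) sequentially"
    using d by blast
qed

text \<open>The series over odd squares without its first term, divided by that term:
  \<open>((2 m + 3)^2 - 1) / 4 = (m + 1) (m + 2)\<close>.\<close>

definition theta_tail :: "complex \<Rightarrow> complex" where
  "theta_tail z = (\<Sum>m. exp (- of_real (real (Suc m * Suc (Suc m))) * ((of_real pi)\<^sup>2 / z)))"

lemma Re_pi2_div_pos: "0 < Re z \<Longrightarrow> 0 < Re ((of_real pi)\<^sup>2 / z)"
  by (simp add: Re_divide power2_eq_square sum_squares_gt_zero_iff)

text \<open>Identity theorem on the right half-plane: both sides are holomorphic there,
  \<open>of_real pi / z\<close> staying off the branch cut of \<open>csqrt\<close>, and they agree
  on the positive axis by the real case.\<close>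

theorem theta4_exp:
  assumes "0 < Re z"
  shows "theta4 (exp (- z)) = 2 * csqrt (of_real pi / z) * exp (- ((of_real pi)\<^sup>2 / (4 * z))) * (1 + theta_tail z)"
proof -
  define S where "S = {z. 0 < Re z}"
  have S: "open S" "connected S"
    unfolding S_def by (auto simp: open_halfspace_Re_gt intro: convex_connected convex_halfspace_Re_gt)
  define f where "f = (\<lambda>z. theta4 (exp (- z)) -
      2 * csqrt (of_real pi / z) * exp (- ((of_real pi)\<^sup>2 / (4 * z))) * (1 + theta_tail z))"
  have "(\<lambda>z. \<Sum>j. (-1) ^ Suc j * exp (- of_real (real ((Suc j)\<^sup>2)) * z)) holomorphic_on S"
  proof (rule holomorphic_on_exp_series[OF S(1)])
    show "real j \<le> real ((Suc j)\<^sup>2)" for j by (simp only: of_nat_le_iff) (simp add: power2_eq_square)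
  qed (auto simp: S_def norm_power intro!: holomorphic_intros simp del: power_Suc)
  moreover have "exp (- z) ^ (Suc j)\<^sup>2 = exp (- of_real (real ((Suc j)\<^sup>2)) * z)" for j and z :: complex
    by (simp only: exp_of_nat_mult[symmetric]) (simp add: mult_ac)
  ultimately have h1: "(\<lambda>z. theta4 (exp (- z))) holomorphic_on S"
    unfolding theta4_def by (auto intro!: holomorphic_intros)
  have nz: "z \<noteq> 0" if "z \<in> S" for z using that by (auto simp: S_def)
  have h2: "theta_tail holomorphic_on S"
    unfolding theta_tail_def
  proof (rule holomorphic_on_exp_series[OF S(1), of _ "\<lambda>_. 1", simplified mult_1])
    show "(\<lambda>z. (of_real pi)\<^sup>2 / z) holomorphic_on S" using nz by (intro holomorphic_intros) auto
    show "real j \<le> real (Suc j * Suc (Suc j))" for j by (simp only: of_nat_le_iff) simp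
  qed (auto simp: S_def Re_pi2_div_pos)
  have "of_real pi / z \<notin> \<real>\<^sub>\<le>\<^sub>0" if "z \<in> S" for z
  proof -
    have "0 < Re (of_real pi / z)"
      using that by (simp add: S_def Re_divide divide_pos_pos complex_eq_iff sum_power2_gt_zero_iff)
    then show ?thesis by (auto elim!: nonpos_Reals_cases)
  qed
  then have h: "f holomorphic_on S"
    unfolding f_def using nz by (intro holomorphic_intros h1 h2) auto
  have real0: "f (of_real x) = 0" if x: "0 < x" for x
  proof -
    have e1: "theta4 (exp (- complex_of_real x)) = of_real (theta4 (exp (- x)))"
    proof -
      have "of_real (\<Sum>j. (-1) ^ Suc j * exp (- x) ^ (Suc j)\<^sup>2) = (\<Sum>j. complex_of_real ((-1) ^ Suc j * exp (- x) ^ (Suc j)\<^sup>2))"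
        by (rule suminf_of_real, rule summable_power_squares) (use x in simp)
      then show ?thesis by (simp add: theta4_def exp_of_real[symmetric])
    qed
    define t where "t = (\<lambda>m. exp (- real (Suc m * Suc (Suc m)) * (pi\<^sup>2 / x)))"
    define g where "g = (\<lambda>m. exp (- pi\<^sup>2 * (2 * real m + 1)\<^sup>2 / (4 * x)))"
    have gt: "g (Suc m) = exp (- (pi\<^sup>2 / (4 * x))) * t m" for m
      unfolding g_def t_def exp_add[symmetric] using x by (simp add: field_simps power2_eq_square)
    have g0: "g 0 = exp (- (pi\<^sup>2 / (4 * x)))" by (simp add: g_def)
    have st: "summable t"
    proof (rule summable_comparison_test[OF _ summable_geometric[of "exp (- (pi\<^sup>2 / x))"]])
      show "\<exists>N. \<forall>n\<ge>N. norm (t n) \<le> exp (- (pi\<^sup>2 / x)) ^ n"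
      proof (intro exI allI impI)
        fix n
        have "real n \<le> real (Suc n * Suc (Suc n))" by (simp only: of_nat_le_iff) simp
        then have "real n * (pi\<^sup>2 / x) \<le> real (Suc n * Suc (Suc n)) * (pi\<^sup>2 / x)"
          using x by (intro mult_right_mono) auto
        then show "norm (t n) \<le> exp (- (pi\<^sup>2 / x)) ^ n"
          by (simp add: t_def exp_of_nat_mult[symmetric] del: of_nat_mult of_nat_Suc mult_Suc mult_Suc_right)
      qed
    qed (use x in auto)
    have "summable (\<lambda>m. g (Suc m))" unfolding gt by (rule summable_mult[OF st])
    then have sg: "summable g" by (subst (asm) summable_Suc_iff)
    have "suminf g = g 0 + (\<Sum>m. g (Suc m))" using suminf_split_head[OF sg] by simp
    also have "\<dots> = exp (- (pi\<^sup>2 / (4 * x))) * (1 + suminf t)"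
      unfolding gt g0 suminf_mult[OF st] by (simp add: algebra_simps)
    finally have r: "theta4 (exp (- x)) = 2 * sqrt (pi / x) * exp (- (pi\<^sup>2 / (4 * x))) * (1 + suminf t)"
      using theta4_exp_real[OF x] by (simp add: g_def mult.assoc)
    have e2: "theta_tail (of_real x) = of_real (suminf t)"
    proof -
      have "exp (- of_real (real (Suc m * Suc (Suc m))) * ((of_real pi)\<^sup>2 / complex_of_real x)) = of_real (t m)" for m
        by (simp only: t_def exp_of_real[symmetric] of_real_mult of_real_minus of_real_divide of_real_power)
      then show ?thesis by (simp only: theta_tail_def suminf_of_real[OF st])
    qed
    have e3: "csqrt (of_real pi / of_real x) = of_real (sqrt (pi / x))"
      using x by (simp add: of_real_divide[symmetric] del: of_real_divide)
    have e4: "exp (- ((of_real pi)\<^sup>2 / (4 * of_real x))) = complex_of_real (exp (- (pi\<^sup>2 / (4 * x))))"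
      by (simp add: exp_of_real[symmetric])
    show ?thesis
      unfolding f_def e1 e2 e3 e4 r by simp
  qed
  have "f z = 0"
  proof (rule analytic_continuation[OF h S])
    show "of_real ` {0<..} \<subseteq> S" by (auto simp: S_def)
    show "1 \<in> S" by (simp add: S_def)
    show "1 islimpt (complex_of_real ` {0<..})"
    proof (rule islimptI)
      fix T :: "complex set" assume "1 \<in> T" "open T"
      then obtain e where e: "0 < e" "ball 1 e \<subseteq> T" by (meson openE)
      have "complex_of_real (1 + e / 2) \<in> ball 1 e" 
      proof -
        have "1 - complex_of_real (1 + e / 2) = - complex_of_real (e / 2)" by simp
        then have "dist 1 (complex_of_real (1 + e / 2)) = e / 2"
          using e(1) by (simp only: dist_norm norm_minus_cancel norm_of_real)
        then show ?thesis using e(1) by simp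
      qed
      then show "\<exists>y\<in>complex_of_real ` {0<..}. y \<in> T \<and> y \<noteq> 1"
        using e by (intro bexI[of _ "complex_of_real (1 + e / 2)"]) (auto simp: complex_eq_iff)
    qed
    show "z \<in> S" using assms by (simp add: S_def)
  qed (use real0 in auto)
  then show ?thesis by (simp add: f_def)
qed

section \<open>Deforming the coefficient integral\<close>

text \<open>\<open>overpart k / (n - k)\<close> vanishes at \<open>k = n\<close>, division by zero being zero.\<close>

definition overpart_primitive :: "nat \<Rightarrow> complex \<Rightarrow> complex" where
  "overpart_primitive n z = of_nat (overpart n) * z +
     exp (of_nat n * z) * (\<Sum>k. of_nat (overpart k) / (of_nat n - of_nat k) * exp (- z) ^ k)"

definition overpart_integrand :: "nat \<Rightarrow> complex \<Rightarrow> complex" where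
  "overpart_integrand n z = exp (of_nat n * z) * overpart_gf (exp (- z))"

text \<open>Termwise, \<open>exp ((n - k) z)\<close> has the primitive
  \<open>exp ((n - k) z) / (n - k)\<close> for \<open>k \<noteq> n\<close> and a linear one for
  \<open>k = n\<close>. With a primitive on the whole half-plane, the path can be deformed by the
  fundamental theorem of calculus alone.\<close>

lemma overpart_primitive_deriv:
  assumes "0 < Re z"
  shows "(overpart_primitive n has_field_derivative overpart_integrand n z) (at z)"
proof -
  define c :: "nat \<Rightarrow> complex" where "c = (\<lambda>k. of_nat (overpart k) / (of_nat n - of_nat k))"
  define S where "S = (\<lambda>q. \<Sum>k. c k * q ^ k)"
  define q where "q = exp (- z)"
  have q: "norm q < 1" using assms by (simp add: q_def)
  have summ: "summable (\<lambda>k. c k * K ^ k)" if "norm K < 1" for K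
  proof (rule summable_comparison_test[OF _ summable_norm_overpart[OF that]], intro exI allI impI)
    fix k
    have "norm (c k) \<le> norm (of_nat (overpart k) :: complex)"
    proof (cases "k = n")
      case False
      have "1 \<le> \<bar>real n - real k\<bar>" using False by linarith
      moreover have "norm (of_nat n - of_nat k :: complex) = \<bar>real n - real k\<bar>"
        by (metis norm_of_real of_real_diff of_real_of_nat_eq)
      ultimately show ?thesis
        using mult_left_mono[of 1 "\<bar>real n - real k\<bar>" "real (overpart k)"]
        by (simp add: c_def norm_divide divide_le_eq)
    qed (simp add: c_def)
    then show "norm (c k * K ^ k) \<le> norm (of_nat (overpart k) * K ^ k)"
      by (simp only: norm_mult mult_right_mono norm_ge_zero)
  qed
  obtain K :: complex where K: "norm q < norm K" "norm K < 1"
  proof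
    define a where "a = (norm q + 1) / 2"
    have "norm q < a" "a < 1" "0 \<le> a" using q by (auto simp: a_def)
    then show "norm q < norm (complex_of_real a)" "norm (complex_of_real a) < 1" by auto
  qed
  define D where "D = (\<Sum>k. diffs c k * q ^ k)"
  have S: "(S has_field_derivative D) (at q)"
    unfolding S_def D_def using termdiffs_strong[OF summ[OF K(2)] K(1)] .
  have D: "(\<lambda>k. of_nat k * c k * q ^ k) sums (q * D)"
  proof -
    have "summable (\<lambda>k. diffs c k * q ^ k)"
    proof (rule termdiff_converges[OF K(1)])
      show "summable (\<lambda>k. c k * x ^ k)" if "norm x < norm K" for x
        using summ[of x] that K(2) by linarith
    qed
    then have "(\<lambda>k. q * (diffs c k * q ^ k)) sums (q * D)"
      unfolding D_def by (intro sums_mult summable_sums)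
    moreover have "q * (diffs c k * q ^ k) = of_nat (Suc k) * c (Suc k) * q ^ Suc k" for k
      by (simp add: diffs_def)
    ultimately have "(\<lambda>k. of_nat (Suc k) * c (Suc k) * q ^ Suc k) sums (q * D)" by (simp only:)
    then show ?thesis by (subst (asm) sums_Suc_iff) simp
  qed
  have gf: "(\<lambda>k. of_nat (overpart k) * q ^ k) sums overpart_gf q"
    unfolding overpart_gf_def by (rule summable_sums, rule summable_norm_cancel, rule summable_norm_overpart[OF q])
  have s1: "(\<lambda>k. of_nat n * (c k * q ^ k) - of_nat k * c k * q ^ k) sums (of_nat n * S q - q * D)"
    unfolding S_def using D summ[OF q] by (intro sums_diff sums_mult summable_sums)
  have s2: "of_nat n * (c k * q ^ k) - of_nat k * c k * q ^ k =
      of_nat (overpart k) * q ^ k - (if k = n then of_nat (overpart n) * q ^ n else 0)" for k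
  proof (cases "k = n")
    case False
    then have "(of_nat n - of_nat k) * c k = of_nat (overpart k)" by (simp add: c_def)
    moreover have "of_nat n * (c k * q ^ k) - of_nat k * c k * q ^ k = (of_nat n - of_nat k) * c k * q ^ k"
      by (simp only: left_diff_distrib mult.assoc)
    ultimately show ?thesis using False by (simp only: if_False diff_zero)
  qed (simp add: c_def)
  have s3: "(\<lambda>k. of_nat (overpart k) * q ^ k - (if k = n then of_nat (overpart n) * q ^ n else 0)) sums
      (overpart_gf q - of_nat (overpart n) * q ^ n)"
    by (intro sums_diff gf sums_single)
  have key: "of_nat n * S q - q * D = overpart_gf q - of_nat (overpart n) * q ^ n"
    by (rule sums_unique2[OF s1[unfolded s2] s3])
  have "((\<lambda>z. S (exp (- z))) has_field_derivative D * (- q)) (at z)"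
  proof (rule DERIV_chain2[where f = S and g = "\<lambda>z. exp (- z)"])
    show "(S has_field_derivative D) (at (exp (- z)))" using S by (simp add: q_def)
    show "((\<lambda>z. exp (- z)) has_field_derivative - q) (at z)"
      by (auto intro!: derivative_eq_intros simp: q_def)
  qed
  then have "((\<lambda>z. of_nat (overpart n) * z + exp (of_nat n * z) * S (exp (- z))) has_field_derivative
      (of_nat (overpart n) + (of_nat n * exp (of_nat n * z) * S q + D * (- q) * exp (of_nat n * z)))) (at z)"
    by (auto intro!: derivative_eq_intros simp: q_def)
  also have "(\<lambda>z. of_nat (overpart n) * z + exp (of_nat n * z) * S (exp (- z))) = overpart_primitive n"
    by (simp add: fun_eq_iff overpart_primitive_def S_def c_def)
  also have "of_nat (overpart n) + (of_nat n * exp (of_nat n * z) * S q + D * (- q) * exp (of_nat n * z)) =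
      of_nat (overpart n) + exp (of_nat n * z) * (of_nat n * S q - q * D)"
    by (simp add: algebra_simps)
  also have "\<dots> = of_nat (overpart n) + exp (of_nat n * z) * overpart_gf q
      - of_nat (overpart n) * (exp (of_nat n * z) * q ^ n)"
    unfolding key by (simp add: algebra_simps)
  also have "exp (of_nat n * z) * q ^ n = 1"
    by (simp add: q_def exp_of_nat_mult[symmetric] exp_add[symmetric])
  finally show ?thesis by (simp add: overpart_integrand_def q_def)
qed

text \<open>Only the linear term fails to have period \<open>2 pi i\<close>; this replaces the
  coefficient extraction by Cauchy's formula.\<close>

lemma overpart_primitive_period:
  "overpart_primitive n (Complex x pi) - overpart_primitive n (Complex x (- pi)) = 2 * pi * \<i> * of_nat (overpart n)"
proof -
  have C: "Complex x pi = of_real x + \<i> * of_real pi" "Complex x (- pi) = of_real x - \<i> * of_real pi"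
    by (simp_all add: complex_eq_iff)
  have e: "exp (\<i> * of_real pi) = -1" "exp (- (\<i> * of_real pi)) = -1"
    by (simp_all add: exp_minus mult.commute)
  have 1: "exp (- Complex x pi) = exp (- Complex x (- pi))"
    unfolding C by (simp add: exp_add exp_diff exp_minus e inverse_eq_divide)
  have 2: "exp (of_nat n * Complex x pi) = exp (of_nat n * Complex x (- pi))"
    unfolding exp_of_nat_mult C by (simp add: exp_add exp_diff e)
  show ?thesis
    unfolding overpart_primitive_def 1 2 by (simp add: C algebra_simps)
qed

text \<open>The segment \<open>[x - i\<pi>, x + i\<pi>]\<close> is deformed: its middle part is replaced by an arc of the circle
  of radius \<open>r\<close> on which the saddle point of the dominant term lies.\<close>

lemma overpart_arc_integral:
  fixes r \<phi> B :: real and n :: nat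
  assumes r: "0 < r" and \<phi>: "0 < \<phi>" "\<phi> < pi / 2" "r * sin \<phi> \<le> pi"
    and B: "\<And>y. r * sin \<phi> \<le> \<bar>y\<bar> \<Longrightarrow> \<bar>y\<bar> \<le> pi \<Longrightarrow> norm (overpart_integrand n (Complex (r * cos \<phi>) y)) \<le> B"
  obtains I where
    "((\<lambda>t. overpart_integrand n (of_real r * cis t) * (of_real r * cis t)) has_integral I) {- \<phi>..\<phi>}"
    "norm (I - 2 * pi * of_nat (overpart n)) \<le> 2 * pi * B"
proof -
  define x where "x = r * cos \<phi>"
  define y0 where "y0 = r * sin \<phi>"
  let ?F = "overpart_primitive n"
  let ?f = "overpart_integrand n"
  have x: "0 < x" using r \<phi> by (simp add: x_def cos_gt_zero)
  have y0: "0 < y0" "y0 \<le> pi" using r \<phi> by (simp_all add: y0_def sin_gt_zero)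
  have vert: "((\<lambda>y. ?f (Complex x y) * \<i>) has_integral (?F (Complex x b) - ?F (Complex x a))) {a..b}" if "a \<le> b" for a b
  proof (rule fundamental_theorem_of_calculus[OF that])
    fix y
    have "((\<lambda>y. Complex x y) has_vector_derivative \<i>) (at y within {a..b})"
    proof -
      have "(\<lambda>y. Complex x y) = (\<lambda>y. of_real x + of_real y * \<i>)" by (auto simp: complex_eq_iff)
      then show ?thesis by (auto intro!: derivative_eq_intros)
    qed
    moreover have "(?F has_field_derivative ?f (Complex x y)) (at (Complex x y) within (\<lambda>y. Complex x y) ` {a..b})"
      using overpart_primitive_deriv[of "Complex x y" n] x by (simp add: has_field_derivative_at_within)
    ultimately have "((?F \<circ> (\<lambda>y. Complex x y)) has_vector_derivative \<i> * ?f (Complex x y)) (at y within {a..b})"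
      by (rule field_vector_diff_chain_within)
    then show "((\<lambda>y. ?F (Complex x y)) has_vector_derivative ?f (Complex x y) * \<i>) (at y within {a..b})"
      by (simp add: o_def mult.commute)
  qed
  have arc: "((\<lambda>t. ?f (of_real r * cis t) * (of_real r * (\<i> * cis t))) has_integral
      (?F (of_real r * cis \<phi>) - ?F (of_real r * cis (- \<phi>)))) {- \<phi>..\<phi>}"
  proof (rule fundamental_theorem_of_calculus)
    fix t assume t: "t \<in> {- \<phi>..\<phi>}"
    have pos: "0 < Re (of_real r * cis t)"
      using r t \<phi> by (simp add: cos_gt_zero_pi)
    have "((\<lambda>t. of_real r * cis t) has_vector_derivative (of_real r * (\<i> * cis t))) (at t within {- \<phi>..\<phi>})"
      unfolding cis_conv_exp
      by (rule derivative_eq_intros refl field_vector_diff_chain_within[unfolded o_def, where f = "\<lambda>t. \<i> * of_real t" and g = exp] | simp add: mult_ac)+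
    moreover have "(?F has_field_derivative ?f (of_real r * cis t)) (at (of_real r * cis t) within (\<lambda>t. of_real r * cis t) ` {- \<phi>..\<phi>})"
      using overpart_primitive_deriv[OF pos] by (simp add: has_field_derivative_at_within)
    ultimately have "((?F \<circ> (\<lambda>t. of_real r * cis t)) has_vector_derivative (of_real r * (\<i> * cis t)) * ?f (of_real r * cis t)) (at t within {- \<phi>..\<phi>})"
      by (rule field_vector_diff_chain_within)
    then show "((\<lambda>t. ?F (of_real r * cis t)) has_vector_derivative ?f (of_real r * cis t) * (of_real r * (\<i> * cis t))) (at t within {- \<phi>..\<phi>})"
      by (simp add: o_def mult.commute)
  qed (use \<phi> in simp)
  have ends: "of_real r * cis \<phi> = Complex x y0" "of_real r * cis (- \<phi>) = Complex x (- y0)"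
    by (simp_all add: complex_eq_iff x_def y0_def)
  define J where "J = ?F (Complex x y0) - ?F (Complex x (- y0))"
  define J1 where "J1 = ?F (Complex x pi) - ?F (Complex x y0)"
  define J2 where "J2 = ?F (Complex x (- y0)) - ?F (Complex x (- pi))"
  \<comment> \<open>The increments over the arc and the two segments telescope to the full increment
    over one period.\<close>
  have "J + J1 + J2 = 2 * pi * \<i> * of_nat (overpart n)"
    unfolding overpart_primitive_period[symmetric, of n x] J_def J1_def J2_def by simp
  then have J: "- \<i> * J - 2 * pi * of_nat (overpart n) = \<i> * (J1 + J2)"
    by (auto simp: complex_eq_iff)
  have B0: "0 \<le> B"
    using B[of y0] y0 by (smt (verit) norm_ge_zero y0_def)
  have bound: "norm (?F (Complex x b) - ?F (Complex x a)) \<le> pi * B"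
    if ab: "a \<le> b" "b - a \<le> pi" "\<And>y. a \<le> y \<Longrightarrow> y \<le> b \<Longrightarrow> y0 \<le> \<bar>y\<bar> \<and> \<bar>y\<bar> \<le> pi" for a b
  proof -
    have y: "norm (?f (Complex x y) * \<i>) \<le> B" if "y \<in> {a..b} - {}" for y
      using ab(3)[of y] B[of y] that by (simp add: norm_mult x_def y0_def)
    have "norm (?F (Complex x b) - ?F (Complex x a)) \<le> B * (b - a)"
      using has_integral_bound_real[OF B0 finite.emptyI vert[OF ab(1)] y] ab(1) by simp
    also have "\<dots> \<le> B * pi" using ab B0 by (intro mult_left_mono) auto
    finally show ?thesis by (simp add: mult.commute)
  qed
  have "norm J1 \<le> pi * B" unfolding J1_def using y0 by (intro bound) auto
  moreover have "norm J2 \<le> pi * B" unfolding J2_def using y0 by (intro bound) auto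
  ultimately have "norm (\<i> * (J1 + J2)) \<le> 2 * pi * B"
    using norm_triangle_ineq[of J1 J2] by (simp add: norm_mult)
  then have n1: "norm (- \<i> * J - 2 * pi * of_nat (overpart n)) \<le> 2 * pi * B"
    unfolding J .
  \<comment> \<open>On the circle \<open>dz = i z dt\<close>; multiplying by \<open>- i\<close>
    removes the \<open>i\<close>, so that the value is compared with \<open>2 pi\<close> times the
    coefficient.\<close>
  have "((\<lambda>t. - \<i> * (?f (of_real r * cis t) * (of_real r * (\<i> * cis t)))) has_integral (- \<i> * J)) {- \<phi>..\<phi>}"
    unfolding J_def ends[symmetric] by (rule has_integral_mult_right[OF arc])
  moreover have "- \<i> * (?f (of_real r * cis t) * (of_real r * (\<i> * cis t))) = ?f (of_real r * cis t) * (of_real r * cis t)" for t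
    by (simp add: algebra_simps)
  ultimately have "((\<lambda>t. ?f (of_real r * cis t) * (of_real r * cis t)) has_integral (- \<i> * J)) {- \<phi>..\<phi>}"
    by (simp only:)
  with n1 show ?thesis by (rule that[rotated])
qed

section \<open>The minor arc\<close>

text \<open>The series \<open>ln ((1 + w) / (1 - w)) = 2 (w + w^3 / 3 + ...)\<close> has nonnegative
  coefficients, so replacing \<open>w\<close> by \<open>norm w\<close> does not decrease the real
  part of any term. Only the gain in the linear term is recorded.\<close>

lemma norm_ratio_le:
  fixes w :: complex
  assumes w: "norm w < 1"
  shows "norm ((1 + w) / (1 - w)) \<le> (1 + norm w) / (1 - norm w) * exp (- 2 * (norm w - Re w))"
proof -
  define t where "t = norm w"
  have t: "0 \<le> t" "t < 1" using w by (auto simp: t_def)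
  define d :: "nat \<Rightarrow> real" where "d = (\<lambda>n. ((-1) ^ Suc n + 1) / of_nat n)"
  have ser: "(\<lambda>n. of_real (d n) * v ^ n) sums (ln (1 + v) - ln (1 - v))" if "norm v < 1" for v :: complex
  proof -
    have "(\<lambda>n. (-1) ^ Suc n / of_nat n * v ^ n - - ((- (-v)) ^ n) / of_nat n) sums (ln (1 + v) - ln (1 + - v))"
      using that by (intro sums_diff Ln_series Ln_series') auto
    moreover have "(-1) ^ Suc n / of_nat n * v ^ n - - ((- (-v)) ^ n) / of_nat n = of_real (d n) * v ^ n" for n
      by (cases "even n") (auto simp: d_def)
    ultimately show ?thesis by simp
  qed
  have lnabs: "exp (Re (ln (1 + v) - ln (1 - v))) = norm ((1 + v) / (1 - v))" if "norm v < 1" for v :: complex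
  proof -
    have "1 + v \<noteq> 0" "1 - v \<noteq> 0" using one_pm_power_neq_0[OF that, of 1] by simp_all
    then have "exp (ln (1 + v) - ln (1 - v)) = (1 + v) / (1 - v)" by (simp add: exp_diff)
    then show ?thesis by (metis norm_exp_eq_Re)
  qed
  have nt: "norm (complex_of_real t) < 1" using t by simp
  have s1: "(\<lambda>n. d n * Re (w ^ n)) sums Re (ln (1 + w) - ln (1 - w))"
    using sums_Re[OF ser[OF w]] by simp
  have s2: "(\<lambda>n. d n * t ^ n) sums Re (ln (1 + of_real t) - ln (1 - complex_of_real t))"
    using sums_Re[OF ser[OF nt]] by (simp flip: of_real_power)
  have "Re (ln (1 + w) - ln (1 - w)) - Re (ln (1 + of_real t) - ln (1 - complex_of_real t)) \<le> - 2 * (t - Re w)"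
  proof (rule sums_le[OF _ sums_diff[OF s1 s2] sums_single[of 1 "\<lambda>_. - 2 * (t - Re w)"]])
    fix n
    show "d n * Re (w ^ n) - d n * t ^ n \<le> (if n = 1 then - 2 * (t - Re w) else 0)"
    proof (cases "n = 1")
      case False
      have "0 \<le> d n" by (cases "even n") (auto simp: d_def)
      moreover have "Re (w ^ n) \<le> t ^ n"
        using complex_Re_le_cmod[of "w ^ n"] by (simp add: norm_power t_def)
      ultimately show ?thesis using False by (simp add: mult_left_mono)
    qed (simp add: d_def algebra_simps)
  qed
  then have "exp (Re (ln (1 + w) - ln (1 - w))) \<le>
      exp (Re (ln (1 + of_real t) - ln (1 - complex_of_real t)) + - 2 * (t - Re w))"
    by simp
  then have "norm ((1 + w) / (1 - w)) \<le> norm ((1 + complex_of_real t) / (1 - complex_of_real t)) * exp (- 2 * (t - Re w))"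
    by (simp only: exp_add lnabs[OF w] lnabs[OF nt])
  also have "norm ((1 + complex_of_real t) / (1 - complex_of_real t)) = (1 + t) / (1 - t)"
  proof -
    have "(1 + complex_of_real t) / (1 - complex_of_real t) = of_real ((1 + t) / (1 - t))" by simp
    then show ?thesis using t by (simp only: norm_of_real) simp
  qed
  finally show ?thesis by (simp add: t_def)
qed

text \<open>\<open>norm_ratio_le\<close> is multiplied over all factors. The exponents form two
  geometric series, which may start at \<open>k = 0\<close> because both have the term 1
  there.\<close>

lemma norm_overpart_gf_le:
  fixes q :: complex
  assumes q: "norm q < 1"
  shows "norm (overpart_gf q) \<le> overpart_gf (norm q) * exp (- 2 * (1 / (1 - norm q) - Re (1 / (1 - q))))"
proof (rule LIMSEQ_le)
  have q': "norm (norm q) < 1" using q by simp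
  show "(\<lambda>m. norm (overpart_prod m q)) \<longlonglongrightarrow> norm (overpart_gf q)"
    by (intro tendsto_norm overpart_prod_tendsto q)
  have g1: "(\<lambda>m. \<Sum>k<Suc m. norm q ^ k) \<longlonglongrightarrow> 1 / (1 - norm q)"
    using geometric_sums[OF q'] unfolding sums_def by (rule LIMSEQ_Suc)
  have g2: "(\<lambda>m. \<Sum>k<Suc m. Re (q ^ k)) \<longlonglongrightarrow> Re (1 / (1 - q))"
    using sums_Re[OF geometric_sums[OF q]] unfolding sums_def by (rule LIMSEQ_Suc)
  show "(\<lambda>m. overpart_prod m (norm q) * exp (- 2 * ((\<Sum>k<Suc m. norm q ^ k) - (\<Sum>k<Suc m. Re (q ^ k))))) \<longlonglongrightarrow>
      overpart_gf (norm q) * exp (- 2 * (1 / (1 - norm q) - Re (1 / (1 - q))))"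
    by (intro tendsto_intros overpart_prod_tendsto q' g1 g2)
  have "norm (overpart_prod m q) \<le>
      overpart_prod m (norm q) * exp (- 2 * ((\<Sum>k<Suc m. norm q ^ k) - (\<Sum>k<Suc m. Re (q ^ k))))" for m
  proof -
    have "norm (overpart_prod m q) = (\<Prod>k=1..m. norm ((1 + q ^ k) / (1 - q ^ k)))"
      by (simp only: overpart_prod_def prod_norm)
    also have "\<dots> \<le> (\<Prod>k=1..m. (1 + norm q ^ k) / (1 - norm q ^ k) * exp (- 2 * (norm q ^ k - Re (q ^ k))))"
    proof (intro prod_mono conjI)
      fix k assume "k \<in> {1..m}"
      then have "norm (q ^ k) < 1"
        using one_minus_power_pos[of "norm q" k] q by (simp add: norm_power)
      from norm_ratio_le[OF this]
      show "norm ((1 + q ^ k) / (1 - q ^ k)) \<le> (1 + norm q ^ k) / (1 - norm q ^ k) * exp (- 2 * (norm q ^ k - Re (q ^ k)))"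
        by (simp only: norm_power)
    qed simp
    also have "\<dots> = overpart_prod m (norm q) * exp (\<Sum>k=1..m. - 2 * (norm q ^ k - Re (q ^ k)))"
      by (simp only: prod.distrib overpart_prod_def exp_sum finite_atLeastAtMost)
    also have "(\<Sum>k=1..m. - 2 * (norm q ^ k - Re (q ^ k))) = - 2 * (\<Sum>k=1..m. norm q ^ k - Re (q ^ k))"
      by (rule sum_distrib_left[symmetric])
    also have "(\<Sum>k=1..m. norm q ^ k - Re (q ^ k)) = (\<Sum>k<Suc m. norm q ^ k - Re (q ^ k))"
    proof -
      have "{..<Suc m} = insert 0 {1..m}" by auto
      then show ?thesis by simp
    qed
    finally show ?thesis by (simp only: sum_subtractf)
  qed
  then show "\<exists>N. \<forall>m\<ge>N. norm (overpart_prod m q) \<le>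
      overpart_prod m (norm q) * exp (- 2 * ((\<Sum>k<Suc m. norm q ^ k) - (\<Sum>k<Suc m. Re (q ^ k))))"
    by blast
qed

text \<open>The transformed series of \<open>theta4\<close> has positive terms; its first term alone
  bounds \<open>theta4\<close> from below and the reciprocal from above.\<close>

lemma overpart_gf_exp_real_le:
  fixes x :: real
  assumes x: "0 < x"
  shows "overpart_gf (exp (- x)) \<le> sqrt (x / pi) / 2 * exp (pi\<^sup>2 / (4 * x))"
proof -
  define g where "g = (\<lambda>m. exp (- pi\<^sup>2 * (2 * real m + 1)\<^sup>2 / (4 * x)))"
  have sg: "summable g"
  proof (rule summable_comparison_test[OF _ summable_geometric[of "exp (- (pi\<^sup>2 / (4 * x)))"]])
    show "\<exists>N. \<forall>n\<ge>N. norm (g n) \<le> exp (- (pi\<^sup>2 / (4 * x))) ^ n"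
    proof (intro exI allI impI)
      fix n
      have "real n \<le> (2 * real n + 1)\<^sup>2" by (simp add: power2_eq_square algebra_simps)
      then have "real n * (pi\<^sup>2 / (4 * x)) \<le> (2 * real n + 1)\<^sup>2 * (pi\<^sup>2 / (4 * x))"
        using x by (intro mult_right_mono) auto
      then show "norm (g n) \<le> exp (- (pi\<^sup>2 / (4 * x))) ^ n"
        by (simp add: g_def exp_of_nat_mult[symmetric] mult.commute)
    qed
  qed (use x in auto)
  have g0: "g 0 = exp (- (pi\<^sup>2 / (4 * x)))" by (simp add: g_def)
  have "sum g {0} \<le> suminf g" by (rule sum_le_suminf[OF sg]) (auto simp: g_def)
  then have "2 * sqrt (pi / x) * g 0 \<le> 2 * sqrt (pi / x) * suminf g"
    using x by (intro mult_left_mono) auto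
  then have th: "2 * sqrt (pi / x) * g 0 \<le> theta4 (exp (- x))"
    using theta4_exp_real[OF x] by (simp add: g_def)
  have pos: "0 < 2 * sqrt (pi / x) * g 0" using x by (simp add: g0)
  have "overpart_gf (exp (- x)) = 1 / theta4 (exp (- x))"
    using theta4_mult_overpart_gf[of "exp (- x)"] x by (simp add: eq_divide_eq) (auto simp: mult.commute)
  also have "\<dots> \<le> 1 / (2 * sqrt (pi / x) * g 0)"
    using th pos by (intro frac_le) auto
  also have "\<dots> = sqrt (x / pi) / 2 * exp (pi\<^sup>2 / (4 * x))"
    by (simp add: g0 exp_minus real_sqrt_divide field_simps)
  finally show ?thesis .
qed

text \<open>\<open>sqrt 8\<close> is the tangent of the angle with cosine \<open>1 / 3\<close>. For
  small \<open>z = x + i y\<close>, the real part of \<open>1 / (1 - exp (- z))\<close> is about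
  \<open>1 / 2 + x / (x^2 + y^2)\<close>, hence about \<open>1 / 2 + 1 / (9 x)\<close> at
  \<open>y = sqrt 8 * x\<close>, against at least \<open>1 / x\<close> on the real axis. The term
  \<open>x / 9\<close> absorbs the Taylor errors.\<close>

lemma minor_arc_gain:
  fixes x y :: real
  assumes x: "0 < x" "x \<le> 1 / 2" and y: "sqrt 8 * x \<le> \<bar>y\<bar>" "\<bar>y\<bar> \<le> pi"
  shows "8 / (9 * x) - x / 9 - 1 / 2 \<le> 1 / (1 - exp (- x)) - Re (1 / (1 - exp (- Complex x y)))"
proof -
  define \<rho> where "\<rho> = exp (- x)"
  have \<rho>: "0 < \<rho>" "\<rho> < 1" using x by (auto simp: \<rho>_def)
  have "1 - x \<le> \<rho>" using exp_ge_add_one_self[of "- x"] by (simp add: \<rho>_def)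
  then have "1 / x \<le> 1 / (1 - \<rho>)" using \<rho> x by (intro divide_left_mono) auto
  moreover have "Re (1 / (1 - exp (- Complex x y))) \<le> 1 / 2 + 1 / (9 * x) + x / 9"
  proof -
    define c where "c = cos y"
    obtain t where t: "\<bar>t\<bar> \<le> \<bar>x\<bar>" "exp x = (\<Sum>m<4. x ^ m / fact m) + exp t / fact 4 * x ^ 4"
      using Maclaurin_exp_le[of x 4] by blast
    obtain t' where t': "exp (- x) = (\<Sum>m<4. (- x) ^ m / fact m) + exp t' / fact 4 * (- x) ^ 4"
      using Maclaurin_exp_le[of "- x" 4] by blast
    have e1: "exp x = 1 + x + x\<^sup>2 / 2 + x ^ 3 / 6 + exp t * (x ^ 4 / 24)"
      using t(2) by (simp add: eval_nat_numeral)
    have e2: "exp (- x) = 1 - x + x\<^sup>2 / 2 - x ^ 3 / 6 + exp t' * (x ^ 4 / 24)"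
      using t' by (simp add: eval_nat_numeral)
    have nn: "0 \<le> exp t * (x ^ 4 / 24)" "0 \<le> exp t' * (x ^ 4 / 24)" by simp_all
    have ch: "1 + x\<^sup>2 / 2 \<le> cosh x"
      unfolding cosh_field_def using e1 e2 nn by simp
    have sh: "sinh x \<le> x + x ^ 3 / 5"
    proof -
      have "exp t \<le> exp (1 / 2)" using t(1) x by simp
      then have "exp t \<le> 2" using exp_half_le2 by linarith
      then have "exp t * (x ^ 4 / 24) \<le> 2 * (x ^ 4 / 24)"
        by (intro mult_right_mono) auto
      moreover have "x ^ 4 \<le> x ^ 3 / 2"
        using x mult_left_mono[of x "1/2" "x ^ 3"] by (simp add: eval_nat_numeral)
      moreover have "0 < x ^ 3" using x by simp
      ultimately have "exp x - exp (- x) \<le> 2 * (x + x ^ 3 / 5)"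
      proof -
        define a where "a = exp t * (x ^ 4 / 24)"
        define b where "b = exp t' * (x ^ 4 / 24)"
        assume "exp t * (x ^ 4 / 24) \<le> 2 * (x ^ 4 / 24)" "x ^ 4 \<le> x ^ 3 / 2" "0 < x ^ 3"
        moreover have "0 \<le> b" by (simp add: b_def)
        ultimately show ?thesis unfolding e1 e2 a_def[symmetric] b_def[symmetric] by argo
      qed
      then show ?thesis by (simp add: sinh_field_def)
    qed
    have "exp (- Complex x y) = Complex (\<rho> * cos y) (- \<rho> * sin y)"
      by (simp add: \<rho>_def complex_eq_iff Re_exp Im_exp)
    then have "Re (1 / (1 - exp (- Complex x y))) = (1 - \<rho> * c) / ((1 - \<rho> * c)\<^sup>2 + (\<rho> * sin y)\<^sup>2)"
      by (simp add: Re_divide c_def)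
    \<comment> \<open>This aims at the closed form
      \<open>1 / 2 + sinh x / (2 (cosh x - cos y))\<close>, which increases with
      \<open>cos y\<close>, so that the smallest admissible \<open>y\<close> in absolute value is
      the worst case.\<close>
    also have "(1 - \<rho> * c)\<^sup>2 + (\<rho> * sin y)\<^sup>2 = 2 * \<rho> * (cosh x - c)"
    proof -
      have "(sin y)\<^sup>2 = 1 - c\<^sup>2" by (simp add: c_def sin_squared_eq)
      moreover have "2 * \<rho> * cosh x = 1 + \<rho>\<^sup>2"
        by (simp add: cosh_def \<rho>_def exp_minus power2_eq_square field_simps)
      ultimately show ?thesis by algebra
    qed
    also have "1 - \<rho> * c = \<rho> * (cosh x - c + sinh x)"
      by (simp add: cosh_def sinh_def \<rho>_def exp_minus field_simps)
    also have "\<rho> * (cosh x - c + sinh x) / (2 * \<rho> * (cosh x - c)) = 1 / 2 + sinh x / (2 * (cosh x - c))"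
    proof -
      have "1 < cosh x" using ch x by (smt (verit) zero_less_power half_gt_zero)
      then have "0 < cosh x - c" using cos_le_one[of y] unfolding c_def by linarith
      then show ?thesis using \<rho> by (simp add: field_simps)
    qed
    also have "sinh x / (2 * (cosh x - c)) \<le> 1 / (9 * x) + x / 9"
    proof -
      have x2: "x * x \<le> 1 / 4" using x mult_mono[of x "1/2" x "1/2"] by simp
      have "c \<le> cos (sqrt 8 * x)"
      proof -
        have "cos \<bar>y\<bar> \<le> cos (sqrt 8 * x)"
          using x y by (intro cos_monotone_0_pi_le) auto
        then show ?thesis by (simp add: c_def)
      qed
      also have "\<dots> \<le> 1 - 4 * x\<^sup>2 + 8 / 3 * x ^ 4"
      proof -
        define u where "u = sqrt 8 * x"
        have u: "u\<^sup>2 = 8 * x\<^sup>2" by (simp add: u_def power_mult_distrib)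
        obtain t where "cos u = (\<Sum>m<4. cos_coeff m * u ^ m) + cos (t + 1 / 2 * real 4 * pi) / fact 4 * u ^ 4"
          using Maclaurin_cos_expansion[of u 4] by blast
        moreover have "{..<4::nat} = {0, 1, 2, 3}" by auto
        moreover have "fact 4 = (24 :: real)" by (simp add: fact_numeral)
        ultimately have "cos u = 1 - u\<^sup>2 / 2 + cos (t + 2 * pi) * (u ^ 4 / 24)"
          by (simp add: cos_coeff_def)
        also have "\<dots> \<le> 1 - u\<^sup>2 / 2 + 1 * (u ^ 4 / 24)"
          by (intro add_left_mono mult_right_mono) auto
        also have "u ^ 4 = u\<^sup>2 * u\<^sup>2" by (simp add: power4_eq_xxxx power2_eq_square)
        finally show ?thesis
          unfolding u u_def[symmetric] by (simp add: power4_eq_xxxx power2_eq_square mult_ac)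
      qed
      finally have c: "c \<le> 1 - 4 * x\<^sup>2 + 8 / 3 * x ^ 4" .
      have den: "9 * x\<^sup>2 - 16 / 3 * x ^ 4 \<le> 2 * (cosh x - c)" using c ch by simp
      have x4: "x ^ 4 = x\<^sup>2 * x\<^sup>2" "x ^ 4 \<le> x\<^sup>2 / 4" "0 < x\<^sup>2"
        using x2 x mult_left_mono[OF x2, of "x * x"] by (simp_all add: power2_eq_square power4_eq_xxxx)
      have pos: "0 < 9 * x\<^sup>2 - 16 / 3 * x ^ 4" using x4 by linarith
      have "sinh x / (2 * (cosh x - c)) \<le> (x + x ^ 3 / 5) / (9 * x\<^sup>2 - 16 / 3 * x ^ 4)"
        using den pos sh x by (intro frac_le) auto
      also have "\<dots> \<le> 1 / (9 * x) + x / 9"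
      proof -
        have "9 * x * (x + x ^ 3 / 5) \<le> (1 + x\<^sup>2) * (9 * x\<^sup>2 - 16 / 3 * x ^ 4)"
        proof -
          have "(1 + x\<^sup>2) * (9 * x\<^sup>2 - 16 / 3 * x ^ 4) - 9 * x * (x + x ^ 3 / 5) = x ^ 4 * (28 / 15 - 16 / 3 * (x * x))"
            by (simp add: power2_eq_square power3_eq_cube power4_eq_xxxx algebra_simps)
          moreover have "0 \<le> x ^ 4 * (28 / 15 - 16 / 3 * (x * x))"
            using x2 by (intro mult_nonneg_nonneg) auto
          ultimately show ?thesis by linarith
        qed
        then have "(x + x ^ 3 / 5) / (9 * x\<^sup>2 - 16 / 3 * x ^ 4) \<le> (1 + x\<^sup>2) / (9 * x)"
          using pos x by (simp add: divide_le_eq le_divide_eq mult_ac)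
        also have "(1 + x\<^sup>2) / (9 * x) = 1 / (9 * x) + x / 9"
          using x by (simp add: field_simps power2_eq_square)
        finally show ?thesis .
      qed
      finally show ?thesis .
    qed
    finally show ?thesis by simp
  qed
  moreover have "1 / x = 8 / (9 * x) + 1 / (9 * x)" using x by (simp add: field_simps)
  ultimately show ?thesis unfolding \<rho>_def by linarith
qed

lemma norm_overpart_gf_minor_le:
  fixes x y :: real
  assumes x: "0 < x" "x \<le> 1 / 2" and y: "sqrt 8 * x \<le> \<bar>y\<bar>" "\<bar>y\<bar> \<le> pi"
  shows "norm (overpart_gf (exp (- Complex x y))) \<le>
    sqrt (x / pi) / 2 * exp ((pi\<^sup>2 / 4 - 16 / 9) / x + 2 * x / 9 + 1)"
proof -
  let ?q = "exp (- Complex x y)"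
  have nq: "norm ?q = exp (- x)" by simp
  have "norm (overpart_gf ?q) \<le> overpart_gf (norm ?q) * exp (- 2 * (1 / (1 - norm ?q) - Re (1 / (1 - ?q))))"
    by (rule norm_overpart_gf_le) (use x in simp)
  also have "\<dots> \<le> (sqrt (x / pi) / 2 * exp (pi\<^sup>2 / (4 * x))) * exp (- 2 * (8 / (9 * x) - x / 9 - 1 / 2))"
    unfolding nq using x
    by (intro mult_mono overpart_gf_exp_real_le) (use minor_arc_gain[OF assms] in auto)
  also have "\<dots> = sqrt (x / pi) / 2 * exp ((pi\<^sup>2 / 4 - 16 / 9) / x + 2 * x / 9 + 1)"
    using x by (simp add: mult.assoc exp_add[symmetric] diff_divide_distrib)
  finally show ?thesis .
qed

section \<open>The major arc\<close>

text \<open>In the tail the factor \<open>u / s\<close>, at least 1 there, is inserted; it makes the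
  integrand an exact derivative.\<close>

lemma gaussian_truncated_integral:
  fixes \<mu> s :: real
  assumes \<mu>: "0 < \<mu>" and s: "0 < s"
  shows "\<bar>integral {- s..s} (\<lambda>u. exp (- 2 * \<mu> * u\<^sup>2)) - sqrt (pi / (2 * \<mu>))\<bar> \<le> exp (- 2 * \<mu> * s\<^sup>2) / (2 * \<mu> * s)"
proof -
  define g where "g = (\<lambda>u. exp (- 2 * \<mu> * u\<^sup>2))"
  have int: "g integrable_on {a..b}" for a b
    unfolding g_def by (intro integrable_continuous_interval continuous_intros)
  have even: "integral {- s..s} g = 2 * integral {0..s} g"
  proof -
    have "integral {- s..s} g = integral {- s..0} g + integral {0..s} g"
      using Henstock_Kurzweil_Integration.integral_combine[of "- s" 0 s g] s int by simp
    also have "integral {- s..0} g = integral {- s..0} (\<lambda>x. g (- x))" by (simp add: g_def)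
    also have "\<dots> = integral {0..s} g"
      using Henstock_Kurzweil_Integration.integral_reflect_real[of s 0 g] by simp
    finally show ?thesis by simp
  qed
  have lim: "(\<lambda>N. integral {0..real N * pi} g) \<longlonglongrightarrow> sqrt (pi / (2 * \<mu>)) / 2"
    using gaussian_cosine_half_line[of "2 * \<mu>" 0] \<mu> by (simp add: g_def)
  have tail: "integral {s..b} g \<le> exp (- 2 * \<mu> * s\<^sup>2) / (4 * \<mu> * s)" if "s \<le> b" for b
  proof -
    define F where "F = (\<lambda>u. - exp (- 2 * \<mu> * u\<^sup>2) / (4 * \<mu> * s))"
    have "((\<lambda>u. u / s * g u) has_integral (F b - F s)) {s..b}"
    proof (rule fundamental_theorem_of_calculus[OF that])
      fix u
      show "(F has_vector_derivative u / s * g u) (at u within {s..b})"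
        unfolding has_real_derivative_iff_has_vector_derivative[symmetric] F_def g_def
        using \<mu> s by (auto intro!: derivative_eq_intros simp: field_simps)
    qed
    then have "integral {s..b} g \<le> F b - F s"
    proof (rule has_integral_le[OF integrable_integral[OF int]])
      fix u assume "u \<in> {s..b}"
      then have "1 \<le> u / s" using s by simp
      then show "g u \<le> u / s * g u" using mult_right_mono[of 1 "u / s" "g u"] by (simp add: g_def)
    qed
    also have "\<dots> \<le> exp (- 2 * \<mu> * s\<^sup>2) / (4 * \<mu> * s)"
      using \<mu> s by (simp add: F_def)
    finally show ?thesis .
  qed
  have ev: "\<forall>\<^sub>F N in sequentially. s \<le> real N * pi"
  proof -
    obtain N0 :: nat where N0: "s < real N0" using reals_Archimedean2 by blast
    show ?thesis
    proof (rule eventually_sequentiallyI[of N0])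
      fix N assume "N0 \<le> N"
      then show "s \<le> real N * pi"
        using N0 pi_ge_two mult_mono[of "real N0" "real N" 1 pi] by simp
    qed
  qed
  have split: "integral {0..b} g = integral {0..s} g + integral {s..b} g" if "s \<le> b" for b
    using Henstock_Kurzweil_Integration.integral_combine[of 0 s b g] s that int by simp
  have nonneg: "0 \<le> integral {s..b} g" for b
    by (rule integral_nonneg[OF int]) (simp add: g_def)
  have "integral {0..s} g \<le> sqrt (pi / (2 * \<mu>)) / 2"
  proof (rule tendsto_lowerbound[OF lim])
    show "\<forall>\<^sub>F N in sequentially. integral {0..s} g \<le> integral {0..real N * pi} g"
      using ev
    proof eventually_elim
      case (elim N)
      show ?case using split[OF elim] nonneg[of "real N * pi"] by linarith
    qed
  qed simp
  moreover have "sqrt (pi / (2 * \<mu>)) / 2 \<le> integral {0..s} g + exp (- 2 * \<mu> * s\<^sup>2) / (4 * \<mu> * s)"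
  proof (rule tendsto_upperbound[OF lim])
    show "\<forall>\<^sub>F N in sequentially. integral {0..real N * pi} g \<le> integral {0..s} g + exp (- 2 * \<mu> * s\<^sup>2) / (4 * \<mu> * s)"
      using ev
    proof eventually_elim
      case (elim N)
      show ?case using split[OF elim] tail[OF elim] by linarith
    qed
  qed simp
  ultimately have "\<bar>2 * integral {0..s} g - sqrt (pi / (2 * \<mu>))\<bar> \<le> 2 * (exp (- 2 * \<mu> * s\<^sup>2) / (4 * \<mu> * s))"
    by linarith
  then show ?thesis unfolding even[unfolded g_def] g_def by simp
qed

text \<open>The substitution \<open>s = sin (t / 2)\<close> turns the arc integral into a Gaussian integral,
  since \<open>cos t = 1 - 2 s\<^sup>2\<close> and \<open>cos (3 t / 2) = cos (t / 2) (1 - 4 s\<^sup>2)\<close>.\<close>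

lemma arc_main_integral:
  fixes \<mu> \<phi> :: real
  assumes \<mu>: "5 \<le> \<mu>" and \<phi>: "0 < \<phi>" "\<phi> < pi / 2" "cos \<phi> = 1 / 3"
  shows "\<bar>integral {- \<phi>..\<phi>} (\<lambda>t. exp (\<mu> * cos t) * cos (3 * t / 2))
    - 2 * exp \<mu> * (1 - 1 / \<mu>) * sqrt (pi / (2 * \<mu>))\<bar> \<le> exp (\<mu> / 3)"
proof -
  define s where "s = sin (\<phi> / 2)"
  have s2: "s\<^sup>2 = 1 / 3"
    using cos_double_sin[of "\<phi> / 2"] \<phi>(3) by (simp add: s_def)
  have s: "0 < s" using \<phi> by (simp add: s_def sin_gt_zero)
  have s23: "1 / 2 \<le> s" "s \<le> 3 / 5"
    using s2 s power2_le_imp_le[of "1/2" s] power2_le_imp_le[of s "3/5"] by (auto simp: power2_eq_square)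
  define e where "e = (\<lambda>u::real. exp (- 2 * \<mu> * u\<^sup>2))"
  have ce: "continuous_on A e" for A unfolding e_def by (intro continuous_intros)
  define f where "f = (\<lambda>u. 2 * exp \<mu> * (e u * (1 - 4 * u\<^sup>2)))"
  have cf: "continuous_on A f" for A unfolding f_def by (intro continuous_intros ce)
  have "((\<lambda>t. (cos (t / 2) / 2) *\<^sub>R f (sin (t / 2))) has_integral (integral {sin (- \<phi> / 2)..sin (\<phi> / 2)} f)) {- \<phi>..\<phi>}"
  proof (rule has_integral_substitution[where c = "-1" and d = 1])
    show "sin (- \<phi> / 2) \<le> sin (\<phi> / 2)" using s by (simp add: s_def)
    show "((\<lambda>t. sin (t / 2)) has_field_derivative cos (t / 2) / 2) (at t within {- \<phi>..\<phi>})" for t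
      by (auto intro!: derivative_eq_intros)
  qed (use \<phi> cf in auto)
  moreover have "(cos (t / 2) / 2) *\<^sub>R f (sin (t / 2)) = exp (\<mu> * cos t) * cos (3 * t / 2)" for t
  proof -
    define v where "v = t / 2"
    have t: "t = 2 * v" "3 * t / 2 = 3 * v" by (simp_all add: v_def)
    have "exp \<mu> * e (sin v) = exp (\<mu> * cos t)"
      unfolding t(1) cos_double_sin e_def exp_add[symmetric] by (simp add: algebra_simps)
    moreover have "cos v * (1 - 4 * (sin v)\<^sup>2) = cos (3 * t / 2)"
      unfolding t(2) cos_treble_cos sin_squared_eq by (simp add: algebra_simps power2_eq_square power3_eq_cube)
    moreover have "(cos (t / 2) / 2) *\<^sub>R f (sin (t / 2)) = (exp \<mu> * e (sin v)) * (cos v * (1 - 4 * (sin v)\<^sup>2))"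
      unfolding f_def v_def[symmetric] by simp
    ultimately show ?thesis by simp
  qed
  ultimately have K: "integral {- \<phi>..\<phi>} (\<lambda>t. exp (\<mu> * cos t) * cos (3 * t / 2)) = integral {- s..s} f"
    by (simp add: s_def integral_unique)
  define G where "G = integral {- s..s} e"
  \<comment> \<open>Since \<open>e u * (1 - 4 u^2)\<close> is \<open>(1 - 1 / \<mu>) * e u\<close>
    plus \<open>1 / \<mu>\<close> times the derivative of \<open>u * e u\<close>, everything reduces
    to the plain Gaussian integral. This is the origin of the factor
    \<open>1 - 1 / \<mu>\<close>.\<close>
  have ibp: "((\<lambda>u. e u * (1 - 4 * \<mu> * u\<^sup>2)) has_integral (s * e s - - s * e (- s))) {- s..s}"
  proof (rule fundamental_theorem_of_calculus)
    fix u
    show "((\<lambda>u. u * e u) has_vector_derivative e u * (1 - 4 * \<mu> * u\<^sup>2)) (at u within {- s..s})"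
      unfolding has_real_derivative_iff_has_vector_derivative[symmetric] e_def
      by (auto intro!: derivative_eq_intros simp: algebra_simps power2_eq_square)
  qed (use s in simp)
  have "((\<lambda>u. e u) has_integral G) {- s..s}"
    unfolding G_def by (intro integrable_integral integrable_continuous_interval ce)
  from has_integral_add[OF has_integral_mult_right[OF this, of "1 - 1 / \<mu>"] has_integral_mult_right[OF ibp, of "1 / \<mu>"]]
  have "((\<lambda>u. e u * (1 - 4 * u\<^sup>2)) has_integral ((1 - 1 / \<mu>) * G + 1 / \<mu> * (2 * s * e s))) {- s..s}"
    using \<mu> by (simp add: algebra_simps e_def)
  from has_integral_mult_right[OF this, of "2 * exp \<mu>"]
  have I: "integral {- s..s} f = 2 * exp \<mu> * ((1 - 1 / \<mu>) * G + 1 / \<mu> * (2 * s * e s))"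
    unfolding f_def by (rule integral_unique)
  define D where "D = G - sqrt (pi / (2 * \<mu>))"
  \<comment> \<open>As \<open>s^2 = (1 - cos \<phi>) / 2 = 1 / 3\<close>, boundary terms have the
    size \<open>exp \<mu> * e s = exp (\<mu> / 3)\<close>, the value of
    \<open>exp (\<mu> * cos t)\<close> at the ends of the arc.\<close>
  have es: "e s = exp (- (2 * \<mu> / 3))" by (simp add: e_def s2)
  have D: "\<bar>D\<bar> \<le> e s / \<mu>"
  proof -
    have "\<bar>D\<bar> \<le> e s / (2 * \<mu> * s)"
      using gaussian_truncated_integral[of \<mu> s] \<mu> s by (simp add: D_def G_def e_def)
    also have "\<dots> \<le> e s / \<mu>"
      using \<mu> s23 by (intro divide_left_mono) (auto simp: e_def)
    finally show ?thesis .
  qed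
  have "\<bar>(1 - 1 / \<mu>) * D + 1 / \<mu> * (2 * s * e s)\<bar> \<le> \<bar>D\<bar> + 1 / \<mu> * (2 * s * e s)"
  proof -
    have "\<bar>(1 - 1 / \<mu>) * D\<bar> \<le> \<bar>D\<bar>"
      using \<mu> by (simp add: abs_mult mult_left_le_one_le)
    moreover have "0 \<le> 1 / \<mu> * (2 * s * e s)" using \<mu> s by (simp add: e_def)
    ultimately show ?thesis by linarith
  qed
  also have "\<dots> \<le> e s / \<mu> + 1 / \<mu> * (2 * (3 / 5) * e s)"
    using D \<mu> s23 by (intro add_mono mult_left_mono mult_right_mono) (auto simp: e_def)
  also have "\<dots> \<le> e s / 2"
  proof -
    have "e s * (11 / 5) \<le> e s * (\<mu> / 2)" using \<mu> by (intro mult_left_mono) (auto simp: e_def)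
    then show ?thesis using \<mu> by (simp add: field_simps)
  qed
  finally have fin: "\<bar>(1 - 1 / \<mu>) * D + 1 / \<mu> * (2 * s * e s)\<bar> \<le> e s / 2" .
  have "integral {- s..s} f - 2 * exp \<mu> * (1 - 1 / \<mu>) * sqrt (pi / (2 * \<mu>)) =
      2 * exp \<mu> * ((1 - 1 / \<mu>) * D + 1 / \<mu> * (2 * s * e s))"
    unfolding I D_def by (simp add: algebra_simps)
  also have "\<bar>\<dots>\<bar> \<le> 2 * exp \<mu> * (e s / 2)"
    using fin by (simp only: abs_mult abs_exp_cancel abs_numeral) (intro mult_left_mono, auto)
  also have "\<dots> = exp (\<mu> / 3)"
    by (simp add: es exp_add[symmetric])
  finally show ?thesis unfolding K .
qed

text \<open>\<open>(m + 1) (m + 2) \<ge> 2 (m + 1)\<close> gives a geometric majorant with ratio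
  \<open>exp (- 2 h)\<close>, where \<open>h\<close> is the real part of \<open>pi^2 / z\<close>.
  The hypothesis on \<open>ln 2\<close> makes the ratio at most \<open>1 / 2\<close>, hence the
  factor 2.\<close>

lemma norm_theta_tail_le:
  assumes z: "0 < Re z" and big: "ln 2 \<le> 2 * Re ((of_real pi)\<^sup>2 / z)"
  shows "norm (theta_tail z) \<le> 2 * exp (- 2 * Re ((of_real pi)\<^sup>2 / z))"
proof -
  define h where "h = Re ((of_real pi)\<^sup>2 / z)"
  define x where "x = exp (- 2 * h)"
  have h: "0 < h" unfolding h_def by (rule Re_pi2_div_pos[OF z])
  have x: "0 < x" "x \<le> 1 / 2"
  proof -
    have "exp (- 2 * h) \<le> exp (- ln 2)" using big by (simp add: h_def)
    then show "x \<le> 1 / 2" by (simp add: x_def exp_minus)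
  qed (simp add: x_def)
  let ?t = "\<lambda>m. exp (- of_real (real (Suc m * Suc (Suc m))) * ((of_real pi)\<^sup>2 / z))"
  have bound: "norm (?t m) \<le> x ^ Suc m" for m
  proof -
    have "norm (?t m) = exp (- (real (Suc m * Suc (Suc m)) * h))"
    proof -
      have "Re (- of_real c * w) = - (c * Re w)" for c :: real and w :: complex by simp
      then show ?thesis by (simp only: norm_exp_eq_Re h_def)
    qed
    also have "\<dots> \<le> exp (real (Suc m) * (- 2 * h))"
    proof -
      have "real (2 * Suc m) * h \<le> real (Suc m * Suc (Suc m)) * h"
        using h by (intro mult_right_mono, simp only: of_nat_le_iff) auto
      then show ?thesis by (simp add: algebra_simps)
    qed
    finally show ?thesis by (simp only: x_def exp_of_nat_mult)
  qed
  have geo: "(\<lambda>m. x ^ Suc m) sums (x * (1 / (1 - x)))"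
    using sums_mult[OF geometric_sums[of x], of x] x by simp
  have "norm (theta_tail z) \<le> (\<Sum>m. x ^ Suc m)"
    unfolding theta_tail_def by (rule norm_suminf_le[OF bound]) (use geo in \<open>simp only: sums_iff\<close>)
  also have "\<dots> = x * (1 / (1 - x))" using geo by (simp only: sums_iff)
  also have "\<dots> \<le> x * 2" using x by (intro mult_left_mono) (auto simp: divide_le_eq)
  finally show ?thesis by (simp add: x_def h_def mult.commute)
qed

text \<open>This is \<open>1 / (4 pi)\<close> times the derivative of
  \<open>exp (pi sqrt x) / sqrt x\<close>, the growing half of the leading term in Zuckerman's exact
  series.\<close>

definition overpart_main :: "real \<Rightarrow> real" where
  "overpart_main x = exp (pi * sqrt x) / (8 * x) * (1 - 1 / (pi * sqrt x))"

text \<open>The radius satisfies \<open>n r = pi^2 / (4 r) = pi sqrt n / 2\<close>, so the two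
  exponents are complex conjugates. The other factor \<open>z / (2 csqrt (pi / z))\<close> is, up to
  a constant, \<open>z\<close> to the power \<open>3 / 2\<close>, which supplies
  \<open>cis (3 t / 2)\<close>.\<close>

lemma overpart_integrand_arc:
  fixes n :: nat and t r :: real
  assumes n: "0 < n" and t: "\<bar>t\<bar> < pi / 2"
  defines "r \<equiv> pi / (2 * sqrt n)"
  shows "overpart_integrand n (of_real r * cis t) * (of_real r * cis t) =
    of_real (r * sqrt (r / pi) / 2 * exp (pi * sqrt n * cos t)) * cis (3 * t / 2)
      / (1 + theta_tail (of_real r * cis t))"
proof -
  define z where "z = of_real r * cis t"
  have r: "0 < r" using n by (simp add: r_def)
  have Rez: "0 < Re z" using r t by (simp add: z_def cos_gt_zero_pi)
  then have z0: "z \<noteq> 0" by auto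
  define w where "w = of_real (sqrt (pi / r)) * cis (- t / 2)"
  have w: "csqrt (of_real pi / z) = w"
  proof (rule csqrt_unique)
    have "(of_real (sqrt (pi / r)))\<^sup>2 = complex_of_real (pi / r)"
      using r by (simp flip: of_real_power)
    moreover have "(cis (- t / 2))\<^sup>2 = inverse (cis t)"
      by (simp only: power2_eq_square cis_mult cis_inverse) simp
    ultimately have "w\<^sup>2 = of_real (pi / r) * inverse (cis t)"
      by (simp only: w_def power_mult_distrib)
    then show "w\<^sup>2 = of_real pi / z"
      by (simp add: z_def divide_inverse mult_ac)
    show "0 < Re w \<or> Re w = 0 \<and> 0 \<le> Im w"
      using r t by (simp add: w_def cos_gt_zero_pi)
  qed
  have q: "norm (exp (- z)) < 1" using Rez by simp
  have th: "theta4 (exp (- z)) * overpart_gf (exp (- z)) = 1"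
    by (rule theta4_mult_overpart_gf[OF q])
  define E where "E = 1 + theta_tail z"
  have th': "theta4 (exp (- z)) = 2 * w * exp (- ((of_real pi)\<^sup>2 / (4 * z))) * E"
    unfolding theta4_exp[OF Rez] w E_def ..
  \<comment> \<open>Neither factor can vanish, since
    \<open>theta4 * overpart_gf = 1\<close>.\<close>
  have nz: "E \<noteq> 0" "w \<noteq> 0" using th unfolding th' by auto
  have gf: "overpart_gf (exp (- z)) = exp ((of_real pi)\<^sup>2 / (4 * z)) / (2 * w * E)"
  proof -
    have "exp ((of_real pi)\<^sup>2 / (4 * z)) * (theta4 (exp (- z)) * overpart_gf (exp (- z))) = 2 * w * E * overpart_gf (exp (- z))"
      unfolding th' by (simp add: exp_minus)
    then show ?thesis unfolding th using nz by (simp add: field_simps)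
  qed
  have expo: "of_nat n * z + (of_real pi)\<^sup>2 / (4 * z) = of_real (pi * sqrt n * cos t)"
  proof -
    have nr: "real n * r = pi * sqrt n / 2"
    proof -
      have "real n = sqrt n * sqrt n" by simp
      then show ?thesis using n by (simp add: r_def field_simps)
    qed
    have pr: "pi\<^sup>2 / (4 * r) = pi * sqrt n / 2"
      using n by (simp add: r_def power2_eq_square field_simps)
    have "of_nat n * z = of_real (real n * r) * cis t" by (simp add: z_def)
    moreover have "(of_real pi)\<^sup>2 / (4 * z) = of_real (pi\<^sup>2 / (4 * r)) * cis (- t)"
      unfolding cis_inverse[symmetric] z_def
      by (simp only: of_real_divide of_real_power of_real_mult of_real_numeral divide_inverse inverse_mult_distrib of_real_inverse mult_ac)
    ultimately have "of_nat n * z + (of_real pi)\<^sup>2 / (4 * z) = of_real (pi * sqrt n / 2) * (cis t + cis (- t))"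
      by (simp only: nr pr distrib_left)
    also have "cis t + cis (- t) = of_real (2 * cos t)" by (simp add: complex_eq_iff)
    finally show ?thesis by simp
  qed
  have "overpart_integrand n z * z = exp (of_nat n * z + (of_real pi)\<^sup>2 / (4 * z)) * (z / (2 * w)) / E"
    unfolding overpart_integrand_def gf by (simp add: exp_add)
  also have "z / (2 * w) = of_real (r * sqrt (r / pi) / 2) * cis (3 * t / 2)"
  proof -
    have "cis t = cis (3 * t / 2) * cis (- t / 2)" by (simp add: cis_mult)
    moreover have "sqrt (r / pi) * sqrt (pi / r) = 1" using r by (simp flip: real_sqrt_mult)
    then have "complex_of_real (sqrt (r / pi)) * of_real (sqrt (pi / r)) = 1"
      by (metis of_real_1 of_real_mult)
    ultimately have "z = of_real (r * sqrt (r / pi) / 2) * cis (3 * t / 2) * (2 * w)"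
      unfolding w_def z_def by (simp add: mult_ac)
    then show ?thesis using nz by simp
  qed
  finally have "overpart_integrand n z * z =
     of_real (exp (pi * sqrt n * cos t)) * (of_real (r * sqrt (r / pi) / 2) * cis (3 * t / 2)) / E"
    unfolding expo by (simp only: exp_of_real)
  then show ?thesis unfolding z_def E_def by (simp add: mult_ac)
qed

text \<open>The term with \<open>13 / 10\<close> comes from the vertical segments. The theta tail on
  the arc and the truncation of the Gaussian integral fit together into
  \<open>exp (pi sqrt n / 3)\<close>.\<close>

lemma overpart_approx:
  fixes n :: nat
  assumes n: "576 \<le> n"
  shows "\<bar>real (overpart n) - overpart_main n\<bar> \<le> 13 / 100 * exp (pi * sqrt n - 13 / 10 * sqrt n) + exp (pi * sqrt n / 3)"
proof -
  define q where "q = sqrt n"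
  define \<mu> where "\<mu> = pi * q"
  define r where "r = pi / (2 * q)"
  define \<phi> where "\<phi> = arccos (1 / 3)"
  define \<kappa> where "\<kappa> = r * sqrt (r / pi) / 2"
  have q: "24 \<le> q" unfolding q_def using n by (intro real_le_rsqrt) simp
  have qn: "q * q = n" by (simp add: q_def)
  have \<mu>: "72 \<le> \<mu>" using q pi_gt3 mult_mono[of 3 pi 24 q] by (simp add: \<mu>_def)
  have r: "0 < r" "r \<le> 1 / 12"
    using q pi_less_4 by (auto simp: r_def field_simps)
  have cos\<phi>: "cos \<phi> = 1 / 3" by (simp add: \<phi>_def)
  have \<phi>: "0 < \<phi>" "\<phi> < pi / 2"
  proof -
    show "0 < \<phi>" using arccos_lt_bounded[of "1/3"] by (simp add: \<phi>_def)
    have "arccos (1 / 3) < arccos 0" by (rule arccos_less_arccos) auto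
    then show "\<phi> < pi / 2" by (simp add: \<phi>_def)
  qed
  have sin\<phi>: "sin \<phi> = sqrt 8 / 3"
  proof -
    have "sin \<phi> = sqrt (1 - (cos \<phi>)\<^sup>2)" using \<phi> by (intro sin_cos_sqrt sin_ge_zero) auto
    also have "1 - (cos \<phi>)\<^sup>2 = 8 / 3\<^sup>2" by (simp add: cos\<phi> power2_eq_square)
    finally show ?thesis by (simp add: real_sqrt_divide)
  qed
  have \<kappa>: "0 < \<kappa>" "\<kappa> \<le> 1 / 2"
  proof -
    have "sqrt (r / pi) \<le> 1" using r pi_gt3 by (intro real_le_lsqrt) auto
    then show "\<kappa> \<le> 1 / 2" using r mult_mono[of r 1 "sqrt (r / pi)" 1] by (simp add: \<kappa>_def)
    show "0 < \<kappa>" using r by (simp add: \<kappa>_def)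
  qed
  define x where "x = r * cos \<phi>"
  have x: "x = pi / (6 * q)" by (simp add: x_def r_def cos\<phi>)
  have x0: "0 < x" "x \<le> 1 / 36" using r by (simp_all add: x_def cos\<phi>)
  define B where "B = 13 / 100 * exp (\<mu> - 13 / 10 * q)"
  have minor: "norm (overpart_integrand n (Complex (r * cos \<phi>) y)) \<le> B"
    if y: "r * sin \<phi> \<le> \<bar>y\<bar>" "\<bar>y\<bar> \<le> pi" for y
  proof -
    have "norm (overpart_integrand n (Complex x y)) = exp (real n * x) * norm (overpart_gf (exp (- Complex x y)))"
      by (simp add: overpart_integrand_def norm_mult)
    also have "\<dots> \<le> exp (real n * x) * (sqrt (x / pi) / 2 * exp ((pi\<^sup>2 / 4 - 16 / 9) / x + 2 * x / 9 + 1))"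
      using x0 y by (intro mult_left_mono norm_overpart_gf_minor_le) (auto simp: x_def cos\<phi> sin\<phi> mult.commute)
    also have "\<dots> = sqrt (x / pi) / 2 * exp (real n * x + ((pi\<^sup>2 / 4 - 16 / 9) / x + 2 * x / 9 + 1))"
      by (simp add: exp_add)
    \<comment> \<open>Here \<open>x / pi = 1 / (6 q) \<le> 1 / 144\<close> gives the factor
      \<open>1 / 24\<close>, and \<open>2 x / 9 + 1 \<le> 11 / 10\<close>.\<close>
    also have "\<dots> \<le> 1 / 24 * exp (\<mu> - 13 / 10 * q + 11 / 10)"
    proof (intro mult_mono)
      have "x / pi \<le> (1 / 12)\<^sup>2" using q by (simp add: x power2_eq_square divide_le_eq)
      then have "sqrt (x / pi) \<le> 1 / 12" by (intro real_le_lsqrt) auto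
      then show "sqrt (x / pi) / 2 \<le> 1 / 24" by simp
      have e1: "real n * x = pi / 6 * q" using q by (simp add: x qn[symmetric])
      have e2: "(pi\<^sup>2 / 4 - 16 / 9) / x = (3 * pi / 2 - 32 / (3 * pi)) * q"
        using q by (simp add: x field_simps power2_eq_square)
      have d: "13 / 10 \<le> 32 / (3 * pi) - 2 * pi / 3"
      proof -
        have "32 / (3 * (31416 / 10000)) \<le> 32 / (3 * pi)"
          using pi_approx(2) by (intro divide_left_mono) auto
        then show ?thesis using pi_approx(2) by simp
      qed
      have "pi / 6 * q + (3 * pi / 2 - 32 / (3 * pi)) * q = \<mu> - (32 / (3 * pi) - 2 * pi / 3) * q"
        by (simp add: \<mu>_def algebra_simps)
      also have "\<dots> \<le> \<mu> - 13 / 10 * q"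
        using mult_right_mono[OF d, of q] q by simp
      finally show "exp (real n * x + ((pi\<^sup>2 / 4 - 16 / 9) / x + 2 * x / 9 + 1)) \<le> exp (\<mu> - 13 / 10 * q + 11 / 10)"
        unfolding e1 e2 using x0 by simp
    qed (use x0 in auto)
    also have "\<dots> = 1 / 24 * exp (11 / 10) * exp (\<mu> - 13 / 10 * q)" by (simp add: exp_add)
    also have "\<dots> \<le> 13 / 100 * exp (\<mu> - 13 / 10 * q)"
    proof (intro mult_right_mono)
      have "exp (1 / 10) \<le> 1 + 1 / 10 + (1 / 10 :: real)\<^sup>2" by (rule exp_bound) auto
      then have "exp 1 * exp (1 / 10) \<le> 272 / 100 * (1 + 1 / 10 + (1 / 10 :: real)\<^sup>2)"
        using e_less_272 by (intro mult_mono) auto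
      moreover have "exp (11 / 10) = exp 1 * exp (1 / 10 :: real)" by (simp flip: exp_add)
      ultimately show "1 / 24 * exp (11 / 10) \<le> (13 / 100 :: real)" by (simp add: power2_eq_square)
    qed auto
    finally show ?thesis by (simp add: x_def B_def)
  qed
  have rs: "r * sin \<phi> \<le> pi"
    using r sin_le_one[of \<phi>] pi_gt3 mult_mono[of r 1 "sin \<phi>" 1] sin_ge_zero[of \<phi>] \<phi> by simp
  obtain I where I: "((\<lambda>t. overpart_integrand n (of_real r * cis t) * (of_real r * cis t)) has_integral I) {- \<phi>..\<phi>}"
    and nI: "norm (I - 2 * pi * of_nat (overpart n)) \<le> 2 * pi * B"
    using overpart_arc_integral[OF r(1) \<phi> rs minor] by blast
  define K where "K = integral {- \<phi>..\<phi>} (\<lambda>t. exp (\<mu> * cos t) * cos (3 * t / 2))"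
  have K: "((\<lambda>t. \<kappa> * (exp (\<mu> * cos t) * cos (3 * t / 2))) has_integral (\<kappa> * K)) {- \<phi>..\<phi>}"
    unfolding K_def
    by (intro has_integral_mult_right integrable_integral integrable_continuous_interval continuous_intros) auto
  let ?F = "\<lambda>t. overpart_integrand n (of_real r * cis t) * (of_real r * cis t)"
  have ReI: "((\<lambda>t. Re (?F t)) has_integral Re I) {- \<phi>..\<phi>}"
    using has_integral_linear[OF I bounded_linear_Re] by (simp add: o_def)
  \<comment> \<open>Dividing by \<open>1 + E\<close> causes a relative change of at most
    \<open>4 exp (- 4 \<mu> cos t)\<close>; against the growth \<open>exp (\<mu> cos t)\<close> this
    leaves \<open>exp (- 3 \<mu> cos t) \<le> exp (- \<mu>)\<close>, because
    \<open>cos t \<ge> 1 / 3\<close> on the arc.\<close>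
  have diff: "\<bar>Re (?F t) - \<kappa> * (exp (\<mu> * cos t) * cos (3 * t / 2))\<bar> \<le> 2 * exp (- \<mu>)" if t: "t \<in> {- \<phi>..\<phi>}" for t
  proof -
    have t': "\<bar>t\<bar> < pi / 2" using t \<phi> by auto
    have ct: "1 / 3 \<le> cos t"
    proof -
      have "cos \<phi> \<le> cos \<bar>t\<bar>" using t \<phi> by (intro cos_monotone_0_pi_le) auto
      then show ?thesis by (simp add: cos\<phi>)
    qed
    define z where "z = of_real r * cis t"
    define E where "E = theta_tail z"
    have Rez: "0 < Re z" using r ct by (simp add: z_def)
    have h: "Re ((of_real pi)\<^sup>2 / z) = 2 * \<mu> * cos t"
    proof -
      have "(of_real pi)\<^sup>2 / z = of_real (pi\<^sup>2 / r) * cis (- t)"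
        unfolding cis_inverse[symmetric] z_def
        by (simp only: of_real_divide of_real_power of_real_mult divide_inverse inverse_mult_distrib of_real_inverse mult_ac)
      moreover have "pi\<^sup>2 / r = 2 * \<mu>" using q by (simp add: r_def \<mu>_def power2_eq_square)
      ultimately show ?thesis by simp
    qed
    have mc: "24 \<le> \<mu> * cos t" using mult_mono[OF \<mu> ct] \<mu> by simp
    have E: "norm E \<le> 2 * exp (- 4 * (\<mu> * cos t))"
      unfolding E_def using norm_theta_tail_le[OF Rez] mc ln_2_less_1 by (simp add: h)
    have "exp (- 4 * (\<mu> * cos t)) \<le> exp (- ln 4)"
      using mc ln_le_minus_one[of 4] by simp
    then have E4: "exp (- 4 * (\<mu> * cos t)) \<le> 1 / 4" by (simp add: exp_minus)
    then have E2: "norm E \<le> 1 / 2" using E by linarith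
    then have E1: "1 / 2 \<le> norm (1 + E)" using norm_diff_ineq[of 1 E] by simp
    then have nz: "1 + E \<noteq> 0" by auto
    have F: "?F t = of_real (\<kappa> * exp (\<mu> * cos t)) * cis (3 * t / 2) / (1 + E)"
      using overpart_integrand_arc[of n t] n t' unfolding E_def z_def \<kappa>_def r_def \<mu>_def q_def by simp
    have "Re (?F t) - \<kappa> * (exp (\<mu> * cos t) * cos (3 * t / 2)) =
        Re (?F t - of_real (\<kappa> * exp (\<mu> * cos t)) * cis (3 * t / 2))" by simp
    also have "?F t - of_real (\<kappa> * exp (\<mu> * cos t)) * cis (3 * t / 2) =
        - (of_real (\<kappa> * exp (\<mu> * cos t)) * cis (3 * t / 2) * (E / (1 + E)))"
      unfolding F using nz by (simp add: field_simps)
    also have "\<bar>Re \<dots>\<bar> \<le> norm (of_real (\<kappa> * exp (\<mu> * cos t)) * cis (3 * t / 2) * (E / (1 + E)))"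
      using abs_Re_le_cmod[of "- (of_real (\<kappa> * exp (\<mu> * cos t)) * cis (3 * t / 2) * (E / (1 + E)))"]
      by (simp only: norm_minus_cancel)
    also have "\<dots> = \<kappa> * exp (\<mu> * cos t) * (norm E / norm (1 + E))"
      using \<kappa> by (simp add: norm_mult norm_divide)
    also have "\<dots> \<le> 1 / 2 * exp (\<mu> * cos t) * (2 * exp (- 4 * (\<mu> * cos t)) / (1 / 2))"
      using \<kappa> E E1 by (intro mult_mono frac_le) auto
    also have "\<dots> = 2 * exp (- 3 * (\<mu> * cos t))"
      by (simp flip: exp_add)
    also have "\<dots> \<le> 2 * exp (- \<mu>)"
      using mult_left_mono[OF ct, of \<mu>] \<mu> by simp
    finally show ?thesis .
  qed
  have d1: "\<bar>Re I - \<kappa> * K\<bar> \<le> 2 * pi * exp (- \<mu>)"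
  proof -
    have "norm (Re I - \<kappa> * K) \<le> 2 * exp (- \<mu>) * (\<phi> - - \<phi>)"
      using has_integral_bound_real[OF _ finite.emptyI has_integral_diff[OF ReI K], of "2 * exp (- \<mu>)"] diff \<phi> by simp
    also have "\<dots> \<le> 2 * exp (- \<mu>) * pi" using \<phi> by (intro mult_left_mono) auto
    finally show ?thesis by (simp add: mult_ac)
  qed
  have d2: "\<bar>Re I - 2 * pi * real (overpart n)\<bar> \<le> 2 * pi * B"
    using abs_Re_le_cmod[of "I - 2 * pi * of_nat (overpart n)"] nI by simp
  have d3: "\<bar>\<kappa> * K - \<kappa> * (2 * exp \<mu> * (1 - 1 / \<mu>) * sqrt (pi / (2 * \<mu>)))\<bar> \<le> 1 / 2 * exp (\<mu> / 3)"
  proof -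
    have "\<bar>K - 2 * exp \<mu> * (1 - 1 / \<mu>) * sqrt (pi / (2 * \<mu>))\<bar> \<le> exp (\<mu> / 3)"
      unfolding K_def by (rule arc_main_integral) (use \<mu> \<phi> cos\<phi> in auto)
    then have "\<kappa> * \<bar>K - 2 * exp \<mu> * (1 - 1 / \<mu>) * sqrt (pi / (2 * \<mu>))\<bar> \<le> 1 / 2 * exp (\<mu> / 3)"
      using \<kappa> by (intro mult_mono) auto
    then show ?thesis using \<kappa> by (simp add: abs_mult flip: right_diff_distrib)
  qed
  have M: "\<kappa> * (2 * exp \<mu> * (1 - 1 / \<mu>) * sqrt (pi / (2 * \<mu>))) = 2 * pi * overpart_main n"
  proof -
    have "r / pi = 1 / (2 * q)" "pi / (2 * \<mu>) = 1 / (2 * q)" by (simp_all add: r_def \<mu>_def)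
    then have "sqrt (r / pi) * sqrt (pi / (2 * \<mu>)) = 1 / (2 * q)"
      using q by (simp only: real_sqrt_mult[symmetric]) (simp add: real_sqrt_mult real_sqrt_divide)
    moreover have "\<kappa> * sqrt (pi / (2 * \<mu>)) = r * (sqrt (r / pi) * sqrt (pi / (2 * \<mu>))) / 2"
      by (simp add: \<kappa>_def)
    ultimately have "\<kappa> * sqrt (pi / (2 * \<mu>)) = r * (1 / (2 * q)) / 2" by (simp only:)
    also have "\<dots> = pi / (8 * n)" using q by (simp add: r_def qn[symmetric])
    finally have "\<kappa> * sqrt (pi / (2 * \<mu>)) * (2 * exp \<mu> * (1 - 1 / \<mu>)) = pi / (8 * n) * (2 * exp \<mu> * (1 - 1 / \<mu>))"
      by simp
    then show ?thesis by (simp add: overpart_main_def \<mu>_def q_def mult_ac)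
  qed
  have "2 * pi * \<bar>real (overpart n) - overpart_main n\<bar> = \<bar>2 * pi * real (overpart n) - 2 * pi * overpart_main n\<bar>"
    by (simp add: abs_mult flip: right_diff_distrib)
  also have "\<dots> \<le> 2 * pi * B + 2 * pi * exp (- \<mu>) + 1 / 2 * exp (\<mu> / 3)"
    using d1 d2 d3 unfolding M by linarith
  also have "\<dots> \<le> 2 * pi * B + 2 * pi * exp (\<mu> / 3)"
  proof -
    define e where "e = exp (\<mu> / 3)"
    have "exp (- \<mu>) \<le> 1 / 2"
    proof -
      have "exp (- \<mu>) \<le> exp (- ln 2)" using \<mu> ln_2_less_1 by simp
      then show ?thesis by (simp add: exp_minus)
    qed
    moreover have "1 \<le> e" using \<mu> by (simp add: e_def)
    ultimately have "2 * pi * exp (- \<mu>) \<le> 2 * pi * (1 / 2 * e)" by (intro mult_left_mono) auto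
    then have "2 * pi * exp (- \<mu>) \<le> pi * e" by simp
    moreover have "1 * e \<le> pi * e" using pi_gt3 \<open>1 \<le> e\<close> by (intro mult_right_mono) auto
    ultimately show ?thesis unfolding e_def[symmetric] using \<open>1 \<le> e\<close> by linarith
  qed
  also have "\<dots> = 2 * pi * (B + exp (\<mu> / 3))" by (simp add: algebra_simps)
  finally have "\<bar>real (overpart n) - overpart_main n\<bar> \<le> B + exp (\<mu> / 3)" by simp
  then show ?thesis by (simp add: B_def \<mu>_def q_def)
qed

section \<open>Second differences of the logarithm\<close>

text \<open>Division by the main term, about \<open>exp (pi q) / (8 n)\<close> with
  \<open>q = sqrt n\<close>, leaves at most \<open>2 n exp (- 13 / 10 q)\<close>; the claim then
  amounts to \<open>80 n^4 \<le> exp (13 / 10 q)\<close>.\<close>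

lemma overpart_relative_error:
  fixes n :: nat
  assumes n: "576 \<le> n"
  shows "0 < overpart_main n" "\<bar>overpart n / overpart_main n - 1\<bar> \<le> 1 / (40 * real n ^ 3)"
proof -
  define q where "q = sqrt n"
  define \<mu> where "\<mu> = pi * q"
  have q: "24 \<le> q" unfolding q_def using n by (intro real_le_rsqrt) simp
  have qn: "q * q = n" by (simp add: q_def)
  have \<mu>: "72 \<le> \<mu>" using q pi_gt3 mult_mono[of 3 pi 24 q] by (simp add: \<mu>_def)
  define M where "M = overpart_main n"
  have M: "M = exp \<mu> / (8 * n) * (1 - 1 / \<mu>)" by (simp add: M_def overpart_main_def \<mu>_def q_def)
  have fac: "71 / 72 \<le> 1 - 1 / \<mu>" using \<mu> by (simp add: field_simps)
  have M1: "exp \<mu> / (8 * n) * (71 / 72) \<le> M"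
    unfolding M using fac by (intro mult_left_mono) auto
  have pos: "0 < exp \<mu> / (8 * n) * (71 / 72)" using n by simp
  then have Mpos: "0 < M" using M1 by linarith
  then show "0 < overpart_main n" by (simp add: M_def)
  have e1: "exp (\<mu> - 13 / 10 * q) = exp \<mu> * exp (- (13 / 10 * q))" by (simp flip: exp_add)
  have e2: "exp (\<mu> / 3) \<le> exp \<mu> * (1 / 100 * exp (- (13 / 10 * q)))"
  proof -
    have "2 * q \<le> 2 / 3 * \<mu>" using pi_gt3 q by (simp add: \<mu>_def)
    then have "exp (\<mu> / 3) \<le> exp (\<mu> + (- (7 / 10 * q) - 13 / 10 * q))" by simp
    also have "\<dots> = exp \<mu> * (exp (- (7 / 10 * q)) * exp (- (13 / 10 * q)))"
      by (simp flip: exp_add)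
    also have "\<dots> \<le> exp \<mu> * (1 / 100 * exp (- (13 / 10 * q)))"
    proof (intro mult_left_mono mult_right_mono)
      show "exp (- (7 / 10 * q)) \<le> 1 / 100"
      proof -
        have "(1 + 7 / 40 * q) ^ 4 \<le> exp (7 / 40 * q) ^ 4"
          using q exp_ge_add_one_self[of "7 / 40 * q"] by (intro power_mono) auto
        also have "\<dots> = exp (7 / 10 * q)" by (simp flip: exp_of_nat_mult)
        finally have "(1 + 7 / 40 * q) ^ 4 \<le> exp (7 / 10 * q)" .
        moreover have "(52 / 10) ^ 4 \<le> (1 + 7 / 40 * q) ^ 4" using q by (intro power_mono) auto
        ultimately have "100 \<le> exp (7 / 10 * q)" by (simp add: power4_eq_xxxx)
        then show ?thesis by (simp add: exp_minus field_simps)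
      qed
    qed auto
    finally show ?thesis .
  qed
  have "\<bar>real (overpart n) - M\<bar> \<le> 13 / 100 * exp (\<mu> - 13 / 10 * q) + exp (\<mu> / 3)"
    using overpart_approx[OF n] by (simp add: M_def \<mu>_def q_def)
  also have "\<dots> \<le> 14 / 100 * (exp \<mu> * exp (- (13 / 10 * q)))"
    using e2 unfolding e1 by simp
  finally have err: "\<bar>real (overpart n) - M\<bar> \<le> 14 / 100 * (exp \<mu> * exp (- (13 / 10 * q)))" .
  \<comment> \<open>With \<open>q = 24 + s\<close> the power becomes
    \<open>24^8 (1 + s / 24)^8\<close>. The starting value \<open>80 * 24^8\<close> is below
    \<open>(27 / 10)^31 \<le> exp 31\<close>, and the growth in \<open>s\<close> is absorbed because
    \<open>1 / 24 \<le> 13 / 80\<close>.\<close>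
  have big: "80 * real n ^ 4 \<le> exp (13 / 10 * q)"
  proof -
    define s where "s = q - 24"
    have s: "0 \<le> s" using q by (simp add: s_def)
    have "1 + s / 24 \<le> exp (13 / 80 * s)"
      using s exp_ge_add_one_self[of "13 / 80 * s"] by linarith
    then have "(1 + s / 24) ^ 8 \<le> exp (13 / 80 * s) ^ 8"
      using s by (intro power_mono) auto
    also have "\<dots> = exp (13 / 10 * s)" by (simp flip: exp_of_nat_mult)
    finally have 1: "(1 + s / 24) ^ 8 \<le> exp (13 / 10 * s)" .
    have "27 / 10 \<le> (exp 1 :: real)" using e_approx_32 by (simp add: abs_if split: if_splits)
    then have "(27 / 10) ^ 31 \<le> (exp 1 :: real) ^ 31" by (intro power_mono) auto
    also have "\<dots> = exp 31" by (simp flip: exp_of_nat_mult)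
    finally have "(27 / 10) ^ 31 \<le> (exp 31 :: real)" .
    moreover have "80 * 24 ^ 8 \<le> (27 / 10 :: real) ^ 31"
      by (simp only: power_divide) simp
    ultimately have "80 * 24 ^ 8 \<le> (exp 31 :: real)" by linarith
    also have "\<dots> \<le> exp (13 / 10 * 24)" by simp
    finally have "80 * 24 ^ 8 * (1 + s / 24) ^ 8 \<le> exp (13 / 10 * 24) * exp (13 / 10 * s)"
      using 1 s by (intro mult_mono) auto
    also have "\<dots> = exp (13 / 10 * q)"
    proof -
      have "13 / 10 * 24 + 13 / 10 * s = 13 / 10 * q" unfolding s_def by argo
      then show ?thesis by (simp only: exp_add[symmetric])
    qed
    also have "80 * 24 ^ 8 * (1 + s / 24) ^ 8 = 80 * q ^ 8"
    proof -
      have "24 * (1 + s / 24) = q" unfolding s_def by argo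
      then have "24 ^ 8 * (1 + s / 24) ^ 8 = q ^ 8" by (simp only: power_mult_distrib[symmetric])
      then show ?thesis by simp
    qed
    also have "q ^ 8 = real n ^ 4"
    proof -
      have "q ^ 8 = (q * q) ^ 4" by (simp only: power_mult_distrib power_add[symmetric]) simp
      then show ?thesis by (simp only: qn)
    qed
    finally show ?thesis .
  qed
  have "\<bar>overpart n / M - 1\<bar> = \<bar>real (overpart n) - M\<bar> / M"
    using Mpos by (simp add: abs_if field_simps)
  also have "\<dots> \<le> 14 / 100 * (exp \<mu> * exp (- (13 / 10 * q))) / (exp \<mu> / (8 * n) * (71 / 72))"
    using err M1 pos by (intro frac_le) auto
  also have "\<dots> = 14 / 100 * 8 * 72 / 71 * real n * exp (- (13 / 10 * q))"
    using n by (simp add: field_simps)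
  also have "\<dots> \<le> 2 * real n * exp (- (13 / 10 * q))" by (intro mult_right_mono) auto
  also have "\<dots> \<le> 2 * real n * (1 / (80 * real n ^ 4))"
    using big n by (intro mult_left_mono) (auto simp: exp_minus inverse_eq_divide intro!: divide_left_mono)
  also have "\<dots> = 1 / (40 * real n ^ 3)" using n by (simp add: power4_eq_xxxx power3_eq_cube)
  finally show "\<bar>overpart n / overpart_main n - 1\<bar> \<le> 1 / (40 * real n ^ 3)" by (simp add: M_def)
qed

section \<open>Finite differences bounded by derivatives\<close>

definition second_diff :: "(real \<Rightarrow> real) \<Rightarrow> real \<Rightarrow> real" where
  "second_diff f x = f (x + 1) - 2 * f x + f (x - 1)"

text \<open>Subtracting \<open>m / 2 * t^2\<close> leaves a convex function; midpoint convexity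
  gives the bound.\<close>

lemma second_diff_ge:
  fixes f f' f'' :: "real \<Rightarrow> real"
  assumes d1: "\<And>t. t \<in> {x - 1..x + 1} \<Longrightarrow> (f has_real_derivative f' t) (at t)"
    and d2: "\<And>t. t \<in> {x - 1..x + 1} \<Longrightarrow> (f' has_real_derivative f'' t) (at t)"
    and ge: "\<And>t. t \<in> {x - 1..x + 1} \<Longrightarrow> m \<le> f'' t"
  shows "m \<le> second_diff f x"
proof -
  define g where "g = (\<lambda>t. f t - m / 2 * t\<^sup>2)"
  have "convex_on {x - 1..x + 1} g"
  proof (rule f''_ge0_imp_convex)
    fix t assume t: "t \<in> {x - 1..x + 1}"
    show "(g has_real_derivative (f' t - m * t)) (at t)"
      unfolding g_def by (rule derivative_eq_intros d1[OF t] refl | simp)+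
    show "((\<lambda>t. f' t - m * t) has_real_derivative (f'' t - m)) (at t)"
      by (rule derivative_eq_intros d2[OF t] refl | simp)+
    show "0 \<le> f'' t - m" using ge[OF t] by simp
  qed auto
  from convex_onD[OF this, of "1/2" "x - 1" "x + 1"]
  have "g ((1 / 2) * (x - 1) + (1 / 2) * (x + 1)) \<le> 1 / 2 * g (x - 1) + 1 / 2 * g (x + 1)" by simp
  then have "g x \<le> (g (x - 1) + g (x + 1)) / 2" by (simp add: field_simps)
  then show ?thesis by (simp add: g_def second_diff_def power2_eq_square field_simps)
qed

text \<open>\<open>second_diff\<close> commutes with differentiation, so the bound for second
  differences can be used twice.\<close>

lemma fourth_diff_ge:
  fixes f0 f1 f2 f3 f4 :: "real \<Rightarrow> real"
  assumes d: "\<And>t. t \<in> {x - 2..x + 2} \<Longrightarrow> (f0 has_real_derivative f1 t) (at t)"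
    "\<And>t. t \<in> {x - 2..x + 2} \<Longrightarrow> (f1 has_real_derivative f2 t) (at t)"
    "\<And>t. t \<in> {x - 2..x + 2} \<Longrightarrow> (f2 has_real_derivative f3 t) (at t)"
    "\<And>t. t \<in> {x - 2..x + 2} \<Longrightarrow> (f3 has_real_derivative f4 t) (at t)"
    and ge: "\<And>t. t \<in> {x - 2..x + 2} \<Longrightarrow> m \<le> f4 t"
  shows "m \<le> second_diff (second_diff f0) x"
proof (rule second_diff_ge)
  have shift: "((\<lambda>t. second_diff f t) has_real_derivative second_diff f' t) (at t)"
    if t: "t \<in> {x - 1..x + 1}" and D: "\<And>t. t \<in> {x - 2..x + 2} \<Longrightarrow> (f has_real_derivative f' t) (at t)" for f f' t
  proof -
    have "((\<lambda>t. f (t + 1)) has_real_derivative f' (t + 1)) (at t)" "((\<lambda>t. f (t - 1)) has_real_derivative f' (t - 1)) (at t)"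
      using D[of "t + 1"] D[of "t - 1"] t DERIV_shift[of f "f' (t + 1)" t 1] DERIV_shift[of f "f' (t - 1)" t "-1"] by auto
    moreover have "(f has_real_derivative f' t) (at t)" using t by (intro D) auto
    ultimately show ?thesis unfolding second_diff_def by (auto intro!: derivative_eq_intros)
  qed
  fix t assume t: "t \<in> {x - 1..x + 1}"
  show "(second_diff f0 has_real_derivative second_diff f1 t) (at t)" using shift[OF t d(1)] by simp
  show "(second_diff f1 has_real_derivative second_diff f2 t) (at t)" using shift[OF t d(2)] by simp
  show "m \<le> second_diff f2 t"
    by (rule second_diff_ge[of t f2 f3 f4]) (use t d ge in auto)
qed

text \<open>Up to a constant, \<open>ln (overpart_main x)\<close> is \<open>s - 3 ln s + ln (s - 1)\<close> with \<open>s = pi sqrt x\<close>, and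
  \<open>d/dx = (pi\<^sup>2 / 2) s\<^sup>-\<^sup>1 d/ds\<close>. The derivatives are written as polynomials in \<open>1/s\<close> and \<open>1/(s - 1)\<close>.\<close>

definition main_log :: "nat \<Rightarrow> real \<Rightarrow> real" where
  "main_log k x = (let s = pi * sqrt x; a = inverse s; b = inverse (s - 1) in (pi\<^sup>2 / 2) ^ k *
    (if k = 0 then s - 3 * ln s + ln (s - 1)
     else if k = 1 then a - 3 * a ^ 2 + a * b
     else if k = 2 then - (a ^ 3) + 6 * a ^ 4 - a ^ 3 * b - a ^ 2 * b ^ 2
     else if k = 3 then 3 * a ^ 5 - 24 * a ^ 6 + 3 * a ^ 5 * b + 3 * a ^ 4 * b ^ 2 + 2 * a ^ 3 * b ^ 3
     else - 15 * a ^ 7 + 144 * a ^ 8 - 15 * a ^ 7 * b - 15 * a ^ 6 * b ^ 2 - 12 * a ^ 5 * b ^ 3 - 6 * a ^ 4 * b ^ 4))"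

lemma main_log_deriv:
  assumes "1 \<le> x" "k < 4"
  shows "(main_log k has_real_derivative main_log (Suc k) x) (at x)"
proof -
  define s where "s = pi * sqrt x"
  have "1 \<le> sqrt x" using assms by simp
  then have s: "3 < s" using pi_gt3 mult_mono[of 3 pi 1 "sqrt x"] unfolding s_def
    by (smt (verit) mult_left_mono mult_cancel_left2)
  have ds: "((\<lambda>x. pi * sqrt x) has_real_derivative (pi\<^sup>2 / 2 * inverse s)) (at x)"
    using assms by (auto intro!: derivative_eq_intros simp: s_def field_simps power2_eq_square)
  have chain: "((\<lambda>x. (pi\<^sup>2 / 2) ^ j * F (pi * sqrt x)) has_real_derivative (pi\<^sup>2 / 2) ^ Suc j * (inverse s * D)) (at x)"
    if "(F has_real_derivative D) (at s)" for F D j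
  proof -
    have "((\<lambda>x. F (pi * sqrt x)) has_real_derivative D * (pi\<^sup>2 / 2 * inverse s)) (at x)"
      by (rule DERIV_chain2[OF _ ds]) (use that in \<open>simp add: s_def\<close>)
    from DERIV_cmult[OF this, of "(pi\<^sup>2 / 2) ^ j"] show ?thesis by (simp add: mult_ac)
  qed
  have nz: "s \<noteq> 0" "s - 1 \<noteq> 0" using s by auto
  define a where "a = inverse s"
  define b where "b = inverse (s - 1)"
  have da: "((\<lambda>s. inverse s) has_real_derivative - (a ^ 2)) (at s)"
    using DERIV_inverse[OF nz(1)] by (simp add: a_def numeral_2_eq_2)
  have db: "((\<lambda>s. inverse (s - 1)) has_real_derivative - (b ^ 2)) (at s)"
    using nz by (auto intro!: derivative_eq_intros simp: b_def power2_eq_square)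
  note dd = derivative_eq_intros da db refl
  consider "k = 0" | "k = 1" | "k = 2" | "k = 3" using assms(2) by linarith
  then show ?thesis
  proof cases
    case 1
    have "((\<lambda>s. s - 3 * ln s + ln (s - 1)) has_real_derivative 1 - 3 * a + b) (at s)"
      using s by (auto intro!: derivative_eq_intros simp: a_def b_def inverse_eq_divide)
    from chain[OF this, of 0] show ?thesis
      unfolding 1 main_log_def Let_def s_def[symmetric] a_def[symmetric] b_def[symmetric]
      by (simp add: algebra_simps power2_eq_square)
  next
    case 2
    have "((\<lambda>s. inverse s - 3 * inverse s ^ 2 + inverse s * inverse (s - 1)) has_real_derivative
        - (a ^ 2) + 6 * a ^ 3 - a ^ 2 * b - a * b ^ 2) (at s)"
      by (rule dd | simp add: a_def[symmetric] b_def[symmetric] eval_nat_numeral algebra_simps)+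
    from chain[OF this, of 1] show ?thesis
      unfolding 2 main_log_def Let_def s_def[symmetric] a_def[symmetric] b_def[symmetric]
      by (simp add: algebra_simps eval_nat_numeral)
  next
    case 3
    have "((\<lambda>s. - (inverse s ^ 3) + 6 * inverse s ^ 4 - inverse s ^ 3 * inverse (s - 1) - inverse s ^ 2 * inverse (s - 1) ^ 2)
      has_real_derivative 3 * a ^ 4 - 24 * a ^ 5 + 3 * a ^ 4 * b + 3 * a ^ 3 * b ^ 2 + 2 * a ^ 2 * b ^ 3) (at s)"
      by (rule dd | simp add: a_def[symmetric] b_def[symmetric] eval_nat_numeral algebra_simps)+
    from chain[OF this, of 2] show ?thesis
      unfolding 3 main_log_def Let_def s_def[symmetric] a_def[symmetric] b_def[symmetric]
      by (simp add: algebra_simps eval_nat_numeral)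
  next
    case 4
    have "((\<lambda>s. 3 * inverse s ^ 5 - 24 * inverse s ^ 6 + 3 * inverse s ^ 5 * inverse (s - 1)
        + 3 * inverse s ^ 4 * inverse (s - 1) ^ 2 + 2 * inverse s ^ 3 * inverse (s - 1) ^ 3) has_real_derivative
        - 15 * a ^ 6 + 144 * a ^ 7 - 15 * a ^ 6 * b - 15 * a ^ 5 * b ^ 2 - 12 * a ^ 4 * b ^ 3 - 6 * a ^ 3 * b ^ 4) (at s)"
      by (rule dd | simp add: a_def[symmetric] b_def[symmetric] eval_nat_numeral algebra_simps)+
    from chain[OF this, of 3] show ?thesis
      unfolding 4 main_log_def Let_def s_def[symmetric] a_def[symmetric] b_def[symmetric]
      by (simp add: algebra_simps eval_nat_numeral)
  qed
qed

lemma main_log_eq: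
  assumes "1 \<le> x"
  shows "ln (overpart_main x) = main_log 0 x + ln (pi\<^sup>2 / 8)"
proof -
  define s where "s = pi * sqrt x"
  have "pi * 1 \<le> s" unfolding s_def using assms by (intro mult_left_mono) auto
  then have s: "3 < s" using pi_gt3 by linarith
  have x: "x = s\<^sup>2 / pi\<^sup>2" using assms by (simp add: s_def power_mult_distrib)
  have "overpart_main x = exp s * (s - 1) / s ^ 3 * (pi\<^sup>2 / 8)"
    unfolding overpart_main_def s_def[symmetric] using s by (simp add: x field_simps power2_eq_square power3_eq_cube)
  then have "ln (overpart_main x) = s + ln (s - 1) - 3 * ln s + ln (pi\<^sup>2 / 8)"
    using s by (simp add: ln_mult ln_div ln_realpow)
  then show ?thesis by (simp add: main_log_def Let_def s_def)
qed

text \<open>In the application \<open>q^2 = n - 2\<close>, so \<open>x\<close> covers all arguments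
  from \<open>n - 2\<close> to \<open>n + 2\<close>. The leading term is
  \<open>- (pi / 4) x powr (- 3 / 2)\<close>; the slack down to \<open>73 / 100\<close> pays for the
  next order and for passing from \<open>sqrt x\<close> to \<open>q\<close>.\<close>

lemma main_log_2_le:
  assumes q: "24 \<le> q" and x: "q\<^sup>2 \<le> x" "x \<le> q\<^sup>2 + 4"
  shows "main_log 2 x \<le> - (73 / 100) / q ^ 3"
proof -
  define y where "y = sqrt x"
  define s where "s = pi * y"
  define a where "a = inverse s"
  define b where "b = inverse (s - 1)"
  have y: "q \<le> y" unfolding y_def using x q by (intro real_le_rsqrt) auto
  have y2: "y \<le> 1004 / 1000 * q"
  proof -
    have "4 \<le> 2 * (4 / 1000) * q\<^sup>2" using q power_mono[of 24 q 2] by simp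
    then have "x \<le> (1004 / 1000 * q)\<^sup>2" using x by (simp add: power2_eq_square)
    then show ?thesis unfolding y_def using q by (intro real_le_lsqrt) auto
  qed
  have s: "3 < s" using pi_gt3 y q mult_mono[of 3 pi 24 y] by (simp add: s_def)
  have ab: "0 < a" "a \<le> b" using s by (auto simp: a_def b_def)
  have "a ^ 3 * a \<le> a ^ 3 * b" using ab by (intro mult_left_mono) auto
  moreover have "a ^ 2 * a ^ 2 \<le> a ^ 2 * b ^ 2" using ab by (intro mult_left_mono power_mono) auto
  ultimately have "- (a ^ 3) + 6 * a ^ 4 - a ^ 3 * b - a ^ 2 * b ^ 2 \<le> - (a ^ 3) + 4 * a ^ 4"
    by (simp add: eval_nat_numeral mult_ac)
  then have "main_log 2 x \<le> (pi\<^sup>2 / 2) ^ 2 * (- (a ^ 3) + 4 * a ^ 4)"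
    unfolding main_log_def Let_def y_def[symmetric] s_def[symmetric] a_def[symmetric] b_def[symmetric]
    by (simp add: mult_left_mono)
  also have "\<dots> = - (pi / 4 - 1 / y) / y ^ 3"
    using y q by (simp add: a_def s_def field_simps eval_nat_numeral)
  also have "\<dots> \<le> - (743 / 1000) / y ^ 3"
  proof (rule divide_right_mono)
    have "1 / y \<le> 1 / 24" using y q by (intro divide_left_mono) auto
    then show "- (pi / 4 - 1 / y) \<le> - (743 / 1000)" using pi_approx(1) by simp
  qed (use y q in auto)
  also have "\<dots> \<le> - (73 / 100) / q ^ 3"
  proof -
    have "y ^ 3 \<le> (1004 / 1000 * q) ^ 3" using y2 y q by (intro power_mono) auto
    then have "y ^ 3 \<le> 15813251 / 15625000 * q ^ 3" by (simp add: power_mult_distrib power_divide)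
    moreover have "0 < q ^ 3" using q by simp
    ultimately have "73 / 100 * y ^ 3 \<le> 743 / 1000 * q ^ 3" by linarith
    then show ?thesis using y q by (simp add: field_simps)
  qed
  finally show ?thesis .
qed

text \<open>The leading term is \<open>- (15 pi / 16) x powr (- 7 / 2)\<close>. One factor
  \<open>1 / sqrt x \<le> 1 / 24\<close> is given up to reach \<open>1 / q^6\<close>, the order of
  the squared second difference. The terms of total degree 8 in \<open>a\<close> and
  \<open>b\<close> are positive together, as \<open>144\<close> outweighs the others when
  \<open>b \<le> 5 / 4 * a\<close>.\<close>

lemma main_log_4_ge:
  assumes q: "24 \<le> q" and x: "q\<^sup>2 \<le> x"
  shows "- (124 / 1000) / q ^ 6 \<le> main_log 4 x"
proof -
  define y where "y = sqrt x"
  define s where "s = pi * y"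
  define a where "a = inverse s"
  define b where "b = inverse (s - 1)"
  have y: "q \<le> y" unfolding y_def using x q by (intro real_le_rsqrt) auto
  have s: "72 \<le> s" using pi_gt3 y q mult_mono[of 3 pi 24 y] by (simp add: s_def)
  have ab: "0 < a" "0 < b" "b \<le> 5 / 4 * a" using s by (auto simp: a_def b_def field_simps)
  have "a ^ 7 * b \<le> a ^ 7 * (5 / 4 * a)" "a ^ 6 * b ^ 2 \<le> a ^ 6 * (5 / 4 * a) ^ 2"
    "a ^ 5 * b ^ 3 \<le> a ^ 5 * (5 / 4 * a) ^ 3" "a ^ 4 * b ^ 4 \<le> a ^ 4 * (5 / 4 * a) ^ 4"
    using ab by (auto intro!: mult_left_mono power_mono)
  moreover have "a ^ 7 * (5 / 4 * a) = 5 / 4 * a ^ 8" "a ^ 6 * (5 / 4 * a) ^ 2 = 25 / 16 * a ^ 8"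
    "a ^ 5 * (5 / 4 * a) ^ 3 = 125 / 64 * a ^ 8" "a ^ 4 * (5 / 4 * a) ^ 4 = 625 / 256 * a ^ 8"
    by (simp_all add: eval_nat_numeral)
  moreover have "0 < a ^ 8" using ab by simp
  ultimately have "- 15 * a ^ 7 \<le> - 15 * a ^ 7 + 144 * a ^ 8 - 15 * a ^ 7 * b - 15 * a ^ 6 * b ^ 2 - 12 * a ^ 5 * b ^ 3 - 6 * a ^ 4 * b ^ 4"
    by linarith
  then have "(pi\<^sup>2 / 2) ^ 4 * (- 15 * a ^ 7) \<le> (pi\<^sup>2 / 2) ^ 4 *
      (- 15 * a ^ 7 + 144 * a ^ 8 - 15 * a ^ 7 * b - 15 * a ^ 6 * b ^ 2 - 12 * a ^ 5 * b ^ 3 - 6 * a ^ 4 * b ^ 4)"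
    by (rule mult_left_mono) simp
  also have "\<dots> = main_log 4 x"
    unfolding main_log_def Let_def y_def[symmetric] s_def[symmetric] a_def[symmetric] b_def[symmetric]
    by simp
  finally have "(pi\<^sup>2 / 2) ^ 4 * (- 15 * a ^ 7) \<le> main_log 4 x" .
  moreover have "(pi\<^sup>2 / 2) ^ 4 * (- 15 * a ^ 7) = - (15 * pi / 16 / y ^ 7)"
    using y q by (simp add: a_def s_def field_simps eval_nat_numeral)
  moreover have "15 * pi / 16 / y ^ 7 \<le> (124 / 1000) / q ^ 6"
  proof -
    have "15 * pi / 16 \<le> 124 / 1000 * 24" using pi_approx(2) by simp
    moreover have "q ^ 7 \<le> y ^ 7" using y q by (intro power_mono) auto
    ultimately have "15 * pi / 16 / y ^ 7 \<le> 124 / 1000 * 24 / q ^ 7" using q by (intro frac_le) auto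
    also have "\<dots> \<le> 124 / 1000 * q / q ^ 7" using q by (intro divide_right_mono) auto
    also have "\<dots> = (124 / 1000) / q ^ 6" using q by (simp add: eval_nat_numeral)
    finally show ?thesis .
  qed
  ultimately show ?thesis by simp
qed

section \<open>From the asymptotics to the inequality for large arguments\<close>

lemma abs_ln_le:
  fixes e t :: real
  assumes "\<bar>t - 1\<bar> \<le> e" "e \<le> 1 / 40"
  shows "\<bar>ln t\<bar> \<le> 40 / 39 * e"
proof -
  have t: "0 < t" "39 / 40 \<le> t" using assms by linarith+
  have "ln t \<le> t - 1" using t by (intro ln_le_minus_one) auto
  moreover have "- ln t \<le> inverse t - 1"
    using ln_le_minus_one[of "inverse t"] t by (simp add: ln_inverse)
  moreover have "inverse t - 1 \<le> 40 / 39 * e"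
  proof -
    have "inverse t - 1 = (1 - t) / t" using t by (simp add: field_simps)
    also have "\<dots> \<le> e / (39 / 40)" using assms t by (intro frac_le) auto
    finally show ?thesis by simp
  qed
  ultimately show ?thesis using assms by linarith
qed

lemma exp_add_exp_minus_ge: "2 + m\<^sup>2 \<le> exp m + exp (- m)" for m :: real
proof -
  obtain t where t: "exp m = (\<Sum>k<4. m ^ k / fact k) + exp t / fact 4 * m ^ 4"
    using Maclaurin_exp_le[of m 4] by blast
  obtain t' where t': "exp (- m) = (\<Sum>k<4. (- m) ^ k / fact k) + exp t' / fact 4 * (- m) ^ 4"
    using Maclaurin_exp_le[of "- m" 4] by blast
  have "exp m = 1 + m + m\<^sup>2 / 2 + m ^ 3 / 6 + exp t * (m ^ 4 / 24)"
    "exp (- m) = 1 - m + m\<^sup>2 / 2 - m ^ 3 / 6 + exp t' * (m ^ 4 / 24)"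
    using t t' by (simp_all add: eval_nat_numeral)
  moreover have "0 \<le> exp t * (m ^ 4 / 24)" "0 \<le> exp t' * (m ^ 4 / 24)" by simp_all
  ultimately show ?thesis by linarith
qed

text \<open>With \<open>h n = - ln (u_op n)\<close> and \<open>H\<close> the mean of \<open>h (n - 1)\<close> and \<open>h (n + 1)\<close>, the claim
  \<open>(1 - u)\<^sup>2 > (1 - v) (1 - w) u\<^sup>2\<close> follows from \<open>exp h + exp (- H) > 2\<close>.\<close>

lemma second_order_log_concavity:
  fixes h h1 h2 m \<eta> :: real
  assumes h: "0 < h" and m: "2 * m = h + (h1 + h2) / 2" and \<eta>: "\<eta> = (h1 + h2) / 2 - h"
    and h12: "0 \<le> h1" "0 \<le> h2" and key: "\<eta> < (1 - \<eta> / 2) * m\<^sup>2"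
  shows "(1 - exp (- h1)) * (1 - exp (- h2)) * (exp (- h))\<^sup>2 < (1 - exp (- h))\<^sup>2"
proof -
  define H where "H = (h1 + h2) / 2"
  have H: "0 \<le> H" using h12 by (simp add: H_def)
  \<comment> \<open>With \<open>H = m + \<eta> / 2\<close> and \<open>h = m - \<eta> / 2\<close>,
    the sum \<open>exp h + exp (- H)\<close> becomes \<open>exp (- \<eta> / 2) * 2 cosh m\<close>,
    so the gain \<open>m^2\<close> competes with the loss \<open>\<eta>\<close>.\<close>
  have e: "h = m + - (\<eta> / 2)" "- H = - m + - (\<eta> / 2)"
    using m \<eta> H_def by linarith+
  have "exp h + exp (- H) = exp (- (\<eta> / 2)) * (exp m + exp (- m))"
    unfolding e exp_add by (simp add: algebra_simps)
  moreover have "2 < exp (- (\<eta> / 2)) * (exp m + exp (- m))"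
  proof -
    have "\<eta> < 2"
    proof (rule ccontr)
      assume "\<not> \<eta> < 2"
      then have "(1 - \<eta> / 2) * m\<^sup>2 \<le> 0" by (intro mult_nonpos_nonneg) auto
      then show False using key \<open>\<not> \<eta> < 2\<close> by linarith
    qed
    then have "(1 - \<eta> / 2) * (2 + m\<^sup>2) \<le> exp (- (\<eta> / 2)) * (exp m + exp (- m))"
      using exp_ge_add_one_self[of "- (\<eta> / 2)"] exp_add_exp_minus_ge[of m]
      by (intro mult_mono) auto
    then show ?thesis using key by (simp add: algebra_simps)
  qed
  ultimately have "1 - exp (- H) < exp h - 1" by linarith
  then have "(1 - exp (- H)) * exp (- h) < (exp h - 1) * exp (- h)" by (intro mult_strict_right_mono) auto
  then have "(1 - exp (- H)) * exp (- h) < 1 - exp (- h)"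
    by (simp add: left_diff_distrib flip: exp_add)
  then have less: "((1 - exp (- H)) * exp (- h))\<^sup>2 < (1 - exp (- h))\<^sup>2"
    using H by (intro power_strict_mono) auto
  \<comment> \<open>Replaces \<open>h1\<close> and \<open>h2\<close> by their mean: for
    \<open>a^2 = exp (- h1)\<close> and \<open>b^2 = exp (- h2)\<close> it is
    \<open>(a - b)^2 \<ge> 0\<close>.\<close>
  have "(1 - exp (- h1)) * (1 - exp (- h2)) \<le> (1 - exp (- H))\<^sup>2"
  proof -
    define a where "a = exp (- h1 / 2)"
    define b where "b = exp (- h2 / 2)"
    have "exp (- h1) = a\<^sup>2" "exp (- h2) = b\<^sup>2" "exp (- H) = a * b"
      by (simp_all add: a_def b_def H_def power2_eq_square add_divide_distrib flip: exp_add)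
    moreover have "(1 - a\<^sup>2) * (1 - b\<^sup>2) \<le> (1 - a * b)\<^sup>2"
      using zero_le_power2[of "a - b"] by (simp add: power2_eq_square algebra_simps)
    ultimately show ?thesis by simp
  qed
  then have "(1 - exp (- h1)) * (1 - exp (- h2)) * (exp (- h))\<^sup>2 \<le> (1 - exp (- H))\<^sup>2 * (exp (- h))\<^sup>2"
    by (intro mult_right_mono) auto
  then show ?thesis using less[unfolded power_mult_distrib] by (rule order.strict_trans1)
qed

text \<open>With \<open>Q = 1 / q^3\<close> the numbers are: \<open>h \<ge> 72 / 100 * Q\<close> at
  the three arguments, hence \<open>m^2 \<ge> 518 / 1000 * Q^2\<close>; and
  \<open>\<eta> \<le> (62 / 1000 + 8 / 39) * Q^2\<close>, half the fourth difference plus the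
  weighted errors \<open>d\<close>, which is below \<open>9 / 10 * m^2\<close>. Taking
  \<open>q^2 = n - 2\<close> makes the bounds uniform over the five arguments involved.\<close>

lemma turan_of_large:
  fixes n :: nat
  assumes n: "578 \<le> n"
  shows "s_op n * (u_op n)\<^sup>2 - 2 * u_op n + 1 > 0"
proof -
  define q where "q = sqrt (real n - 2)"
  have q2: "q\<^sup>2 = real n - 2" using n by (simp add: q_def)
  have q: "24 \<le> q" unfolding q_def using n by (intro real_le_rsqrt) simp
  define L where "L = main_log 0"
  define d where "d = 1 / (39 * q ^ 6)"
  define \<delta> where "\<delta> = (\<lambda>k::nat. ln (overpart k / overpart_main k))"
  define g where "g = (\<lambda>k::nat. ln (real (overpart k)))"
  have pos: "0 < real (overpart k)" "0 < overpart_main k" and \<delta>: "\<bar>\<delta> k\<bar> \<le> d"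
    and g: "g k = L k + ln (pi\<^sup>2 / 8) + \<delta> k" if "n - 2 \<le> k" for k
  proof -
    have k: "576 \<le> k" using that n by linarith
    note err = overpart_relative_error[OF k]
    have k1: "1 / (40 * real k ^ 3) \<le> 1 / 40" using k by (simp add: field_simps)
    show M: "0 < overpart_main k" by (rule err)
    have "0 < real (overpart k) / overpart_main k" using err(2) k1 by linarith
    then show p: "0 < real (overpart k)" using M by (simp add: zero_less_divide_iff)
    have "\<bar>\<delta> k\<bar> \<le> 40 / 39 * (1 / (40 * real k ^ 3))"
      unfolding \<delta>_def by (rule abs_ln_le[OF err(2) k1])
    also have "\<dots> \<le> 1 / (39 * (q\<^sup>2) ^ 3)"
    proof -
      have "(q\<^sup>2) ^ 3 \<le> real k ^ 3" unfolding q2 using that n by (intro power_mono) auto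
      then show ?thesis using q by (simp add: frac_le)
    qed
    finally show "\<bar>\<delta> k\<bar> \<le> d" by (simp add: d_def flip: power_mult)
    have "\<delta> k = g k - ln (overpart_main k)" using p M by (simp add: \<delta>_def g_def ln_div)
    then show "g k = L k + ln (pi\<^sup>2 / 8) + \<delta> k"
      using main_log_eq[of k] k by (simp add: L_def)
  qed
  have D: "(main_log k has_real_derivative main_log (Suc k) t) (at t)" if "1 \<le> t" "k < 4" for k t
    by (rule main_log_deriv[OF that])
  define h where "h = (\<lambda>k::nat. 2 * g k - g (k - 1) - g (k + 1))"
  define Q where "Q = 1 / q ^ 3"
  have "24 ^ 3 \<le> q ^ 3" using q by (intro power_mono) auto
  then have Q: "0 < Q" "Q \<le> 1 / 10000" using q by (auto simp: Q_def divide_le_eq)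
  have Q2: "1 / q ^ 6 = Q\<^sup>2" using q by (simp add: Q_def power_divide flip: power_mult)
  have d: "d = Q\<^sup>2 / 39" by (simp add: d_def Q2[symmetric])
  have QQ: "Q\<^sup>2 \<le> Q / 10000" using Q by (simp add: power2_eq_square mult_left_mono)
  have h_ge: "72 / 100 * Q \<le> h k" if k: "n - 1 \<le> k" "k \<le> n + 1" for k
  proof -
    have k': "real n - 1 \<le> real k" "real k \<le> real n + 1" using k n by linarith+
    have "73 / 100 / q ^ 3 \<le> second_diff (\<lambda>t. - L t) (real k)"
    proof (rule second_diff_ge)
      fix t assume t: "t \<in> {real k - 1..real k + 1}"
      then have t': "1 \<le> t" "q\<^sup>2 \<le> t" "t \<le> q\<^sup>2 + 4" using k' n by (auto simp: q2)
      show "((\<lambda>t. - L t) has_real_derivative - main_log 1 t) (at t)"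
        unfolding L_def using D[of t 0] t' by (auto intro!: derivative_eq_intros)
      show "((\<lambda>t. - main_log 1 t) has_real_derivative - main_log 2 t) (at t)"
        using D[of t 1] t' by (auto intro!: derivative_eq_intros simp: numeral_2_eq_2)
      show "73 / 100 / q ^ 3 \<le> - main_log 2 t"
        using main_log_2_le[OF q t'(2,3)] by simp
    qed
    then have "73 / 100 * Q \<le> 2 * L k - L (real k - 1) - L (real k + 1)"
      by (simp add: second_diff_def Q_def)
    moreover have "h k = 2 * L k - L (real k - 1) - L (real k + 1) + (2 * \<delta> k - \<delta> (k - 1) - \<delta> (k + 1))"
    proof -
      have "real (k - 1) = real k - 1" using k n by simp
      then show ?thesis using g[of k] g[of "k - 1"] g[of "k + 1"] k by (simp add: h_def add.commute)
    qed
    moreover have "\<bar>\<delta> k\<bar> \<le> d" "\<bar>\<delta> (k - 1)\<bar> \<le> d" "\<bar>\<delta> (k + 1)\<bar> \<le> d"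
      using k by (auto intro!: \<delta>)
    moreover have "4 * d \<le> 1 / 100 * Q" unfolding d using QQ Q by linarith
    ultimately show ?thesis by linarith
  qed
  define \<eta> where "\<eta> = (h (n - 1) + h (n + 1)) / 2 - h n"
  define m where "m = (h n + (h (n - 1) + h (n + 1)) / 2) / 2"
  have \<eta>: "\<eta> \<le> 27 / 100 * Q\<^sup>2"
  proof -
    have "- (124 / 1000) / q ^ 6 \<le> second_diff (second_diff (main_log 0)) (real n)"
    proof (rule fourth_diff_ge)
      fix t assume t: "t \<in> {real n - 2..real n + 2}"
      then have t': "1 \<le> t" "q\<^sup>2 \<le> t" using n by (auto simp: q2)
      show "(main_log 0 has_real_derivative main_log 1 t) (at t)" "(main_log 1 has_real_derivative main_log 2 t) (at t)"
        "(main_log 2 has_real_derivative main_log 3 t) (at t)" "(main_log 3 has_real_derivative main_log 4 t) (at t)"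
        using D[OF t'(1), of 0] D[OF t'(1), of 1] D[OF t'(1), of 2] D[OF t'(1), of 3]
        by (simp_all add: eval_nat_numeral)
      show "- (124 / 1000) / q ^ 6 \<le> main_log 4 t" by (rule main_log_4_ge[OF q t'(2)])
    qed
    then have 1: "- (124 / 1000) * Q\<^sup>2 \<le> L (real n + 2) - 4 * L (real n + 1) + 6 * L n - 4 * L (real n - 1) + L (real n - 2)"
      by (simp add: second_diff_def L_def Q2[symmetric] algebra_simps)
    have r: "real (n - 1) = real n - 1" "real (n - 1 - 1) = real n - 2" "real (n - 1 + 1) = real n"
      "real (n + 1) = real n + 1" "real (n + 1 + 1) = real n + 2" "n + 1 - 1 = n" "n - 1 + 1 = n"
      using n by auto
    have 2: "\<eta> = - (L (real n + 2) - 4 * L (real n + 1) + 6 * L n - 4 * L (real n - 1) + L (real n - 2)) / 2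
        - (\<delta> (n + 1 + 1) - 4 * \<delta> (n + 1) + 6 * \<delta> n - 4 * \<delta> (n - 1) + \<delta> (n - 1 - 1)) / 2"
      unfolding \<eta>_def h_def r(6,7)
      using g[of "n - 1 - 1"] g[of "n - 1"] g[of n] g[of "n + 1"] g[of "n + 1 + 1"] r by (simp add: field_simps)
    have "- d \<le> \<delta> k \<and> \<delta> k \<le> d" if "n - 2 \<le> k" for k
      using \<delta>[OF that] by linarith
    then have "- d \<le> \<delta> (n - 1 - 1)" "\<delta> (n - 1) \<le> d" "- d \<le> \<delta> n" "\<delta> (n + 1) \<le> d" "- d \<le> \<delta> (n + 1 + 1)"
      by simp_all
    then have "\<eta> \<le> 62 / 1000 * Q\<^sup>2 + 8 * d" using 1 unfolding 2 by argo
    then show ?thesis unfolding d using zero_le_power2[of Q] by linarith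
  qed
  have hs: "72 / 100 * Q \<le> h (n - 1)" "72 / 100 * Q \<le> h n" "72 / 100 * Q \<le> h (n + 1)"
    by (intro h_ge; use n in linarith)+
  have "72 / 100 * Q \<le> m" using hs unfolding m_def by argo
  then have "(72 / 100 * Q)\<^sup>2 \<le> m\<^sup>2" using Q by (intro power_mono) auto
  then have m2: "518 / 1000 * Q\<^sup>2 \<le> m\<^sup>2"
  proof -
    have "(72 / 100 * Q)\<^sup>2 = 5184 / 10000 * Q\<^sup>2" by (simp add: power_mult_distrib power_divide)
    then show ?thesis using \<open>(72 / 100 * Q)\<^sup>2 \<le> m\<^sup>2\<close> zero_le_power2[of Q] by linarith
  qed
  have "9 / 10 \<le> 1 - \<eta> / 2" using \<eta> QQ Q by linarith
  then have "9 / 10 * (518 / 1000 * Q\<^sup>2) \<le> (1 - \<eta> / 2) * m\<^sup>2" using m2 by (intro mult_mono) auto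
  moreover have "0 < Q\<^sup>2" using Q by simp
  ultimately have key: "\<eta> < (1 - \<eta> / 2) * m\<^sup>2" using \<eta> by linarith
  have main: "(1 - exp (- h (n - 1))) * (1 - exp (- h (n + 1))) * (exp (- h n))\<^sup>2 < (1 - exp (- h n))\<^sup>2"
    by (rule second_order_log_concavity[OF _ _ \<eta>_def _ _ key]) (use hs Q in \<open>auto simp: m_def\<close>)
  have u: "u_op k = exp (- h k)" if k: "n - 1 \<le> k" for k
  proof -
    have p: "exp (g j) = real (overpart j)" if "n - 2 \<le> j" for j
      using pos(1)[OF that] by (simp add: g_def)
    have e: "exp (x + y - 2 * z) = exp x * exp y / (exp z)\<^sup>2" for x y z :: real
      by (simp only: exp_diff exp_add exp_double)
    have "n - 2 \<le> k" "n - 2 \<le> k - 1" "n - 2 \<le> k + 1" using k by linarith+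
    then have "u_op k = exp (g (k - 1) + g (k + 1) - 2 * g k)"
      unfolding u_op_def e by (simp only: p)
    then show ?thesis by (simp add: h_def algebra_simps)
  qed
  have "s_op n * (u_op n)\<^sup>2 - 2 * u_op n + 1 = (1 - u_op n)\<^sup>2 - (1 - u_op (n - 1)) * (1 - u_op (n + 1)) * (u_op n)\<^sup>2"
    unfolding s_op_def by (simp add: power2_eq_square algebra_simps)
  then show ?thesis using main u[of n] u[of "n - 1"] u[of "n + 1"] by simp
qed

section \<open>Computation of small values\<close>

text \<open>For a square \<open>k = j\<^sup>2\<close> the sign \<open>(-1) ^ Suc j\<close> equals \<open>(-1) ^ Suc k\<close>.\<close>

definition square_sign :: "nat \<Rightarrow> int" where
  "square_sign k = (if \<exists>j>0. k = j\<^sup>2 then (-1) ^ Suc k else 0)"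

lemma square_sign_sums:
  fixes q :: real
  assumes "norm q < 1"
  shows "(\<lambda>k. - (of_int (square_sign k) * q ^ k)) sums (\<Sum>j. (-1) ^ Suc j * q ^ (Suc j)\<^sup>2)"
proof -
  have "(\<lambda>j. (-1) ^ Suc j * q ^ (Suc j)\<^sup>2) sums (\<Sum>j. (-1) ^ Suc j * q ^ (Suc j)\<^sup>2)"
    by (rule summable_sums[OF summable_power_squares[OF assms]])
  moreover have "(-1) ^ Suc j * q ^ (Suc j)\<^sup>2 = - (of_int (square_sign ((Suc j)\<^sup>2)) * q ^ (Suc j)\<^sup>2)" for j
  proof -
    have "\<exists>i>0. (Suc j)\<^sup>2 = i\<^sup>2" by blast
    then have "square_sign ((Suc j)\<^sup>2) = (-1) ^ Suc ((Suc j)\<^sup>2)"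
      by (simp only: square_sign_def if_True)
    moreover have "(-1) ^ Suc j = (-1 :: real) ^ ((Suc j)\<^sup>2)" by (simp only: minus_one_power_iff) simp
    ultimately show ?thesis by simp
  qed
  ultimately have "(\<lambda>j. - (of_int (square_sign ((Suc j)\<^sup>2)) * q ^ (Suc j)\<^sup>2)) sums (\<Sum>j. (-1) ^ Suc j * q ^ (Suc j)\<^sup>2)"
    by (simp only:)
  moreover have "strict_mono (\<lambda>j. (Suc j)\<^sup>2)" by (rule strict_monoI) (simp add: power_strict_mono)
  moreover have "- (of_int (square_sign k) * q ^ k) = 0" if "k \<notin> range (\<lambda>j. (Suc j)\<^sup>2)" for k
  proof -
    have "\<nexists>j. 0 < j \<and> k = j\<^sup>2" using that by (metis gr0_implies_Suc rangeI)
    then have "square_sign k = 0" by (simp add: square_sign_def)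
    then show ?thesis by simp
  qed
  ultimately show ?thesis by (subst (asm) sums_mono_reindex) auto
qed

text \<open>Compares coefficients in \<open>theta4 q * overpart_gf q = 1\<close>; the summand
  \<open>i = 0\<close> of the Cauchy product is the value at \<open>n\<close> itself.\<close>

lemma overpart_recurrence_sum:
  assumes "0 < n"
  shows "int (overpart n) = 2 * (\<Sum>i<n. square_sign (Suc i) * int (overpart (n - Suc i)))"
proof -
  define c :: "nat \<Rightarrow> real" where "c = (\<lambda>k. (if k = 0 then 1 else 0) + 2 * - of_int (square_sign k))"
  define a where "a = (\<lambda>m. \<Sum>i\<le>m. c i * real (overpart (m - i)))"
  have prod: "(\<lambda>m. (a m - (if m = 0 then 1 else 0)) * q ^ m) sums 0" if q: "norm q < 1" for q :: real
  proof -
    have "(\<lambda>k. (if k = 0 then 1 else 0) + 2 * - (of_int (square_sign k) * q ^ k)) sums theta4 q"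
      unfolding theta4_def using sums_single[of 0 "\<lambda>_. 1 :: real"]
      by (intro sums_add sums_mult square_sign_sums q) simp
    moreover have "(if k = 0 then 1 else 0) + 2 * - (of_int (square_sign k) * q ^ k) = c k * q ^ k" for k
      by (simp add: c_def algebra_simps)
    ultimately have th: "(\<lambda>k. c k * q ^ k) sums theta4 q" by simp
    have "summable (\<lambda>k. norm (c k * q ^ k))"
    proof (rule summable_comparison_test[OF _ summable_mult[of "\<lambda>k. norm q ^ k" 3]])
      show "\<exists>N. \<forall>k\<ge>N. norm (norm (c k * q ^ k)) \<le> 3 * norm q ^ k"
      proof (intro exI allI impI)
        fix k
        have "\<bar>square_sign k\<bar> \<le> 1" by (simp add: square_sign_def abs_mult power_abs)
        then have "\<bar>c k\<bar> \<le> 3" unfolding c_def by (auto simp: abs_le_iff)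
        then show "norm (norm (c k * q ^ k)) \<le> 3 * norm q ^ k"
          by (simp add: abs_mult power_abs mult_right_mono)
      qed
      show "summable (\<lambda>k. norm q ^ k)" using q by simp
    qed
    from Cauchy_product_sums[OF this summable_norm_overpart[OF q]]
    have "(\<lambda>k. \<Sum>i\<le>k. c i * q ^ i * (real (overpart (k - i)) * q ^ (k - i))) sums (theta4 q * overpart_gf q)"
      using th by (simp add: sums_iff overpart_gf_def)
    moreover have "(\<Sum>i\<le>k. c i * q ^ i * (real (overpart (k - i)) * q ^ (k - i))) = a k * q ^ k" for k
      unfolding a_def sum_distrib_right
    proof (rule sum.cong[OF refl])
      fix i assume "i \<in> {..k}"
      then have "q ^ k = q ^ i * q ^ (k - i)" by (simp flip: power_add)
      then show "c i * q ^ i * (real (overpart (k - i)) * q ^ (k - i)) = c i * real (overpart (k - i)) * q ^ k"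
        by (simp only: mult_ac)
    qed
    ultimately have "(\<lambda>k. a k * q ^ k) sums 1"
      using theta4_mult_overpart_gf[OF q] by simp
    from sums_diff[OF this sums_single[of 0 "\<lambda>_. 1 :: real"]]
    have "(\<lambda>k. a k * q ^ k - (if k = 0 then 1 else 0)) sums 0" by simp
    moreover have "a k * q ^ k - (if k = 0 then 1 else 0) = (a k - (if k = 0 then 1 else 0)) * q ^ k" for k
      by (simp add: algebra_simps)
    ultimately show ?thesis by simp
  qed
  have "a n = 0"
  proof (rule ccontr)
    assume "a n \<noteq> 0"
    then have "a n - (if n = 0 then 1 else 0) \<noteq> 0" using assms by simp
    \<comment> \<open>A power series with a nonzero coefficient has no zeros in some punctured disc,
      whereas this one vanishes identically.\<close>
    then obtain s where s: "0 < s" "\<And>z::real. z \<in> cball 0 s - {0} \<Longrightarrow> (0 :: real) \<noteq> 0"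
      using powser_0_nonzero[of 1 0 "\<lambda>m. a m - (if m = 0 then 1 else 0)" "\<lambda>_. 0 :: real" n] prod assms by auto
    from s(2)[of s] s(1) show False by simp
  qed
  also have "a n = real (overpart n) - 2 * (\<Sum>i<n. of_int (square_sign (Suc i)) * real (overpart (n - Suc i)))"
  proof -
    have "a n = c 0 * real (overpart n) + (\<Sum>i<n. c (Suc i) * real (overpart (n - Suc i)))"
      unfolding a_def by (simp add: sum.atMost_shift)
    then show ?thesis by (simp add: c_def square_sign_def sum_distrib_left mult_ac sum_negf)
  qed
  finally have "real_of_int (int (overpart n)) =
      real_of_int (2 * (\<Sum>i<n. square_sign (Suc i) * int (overpart (n - Suc i))))"
    by simp
  then show ?thesis by (simp only: of_int_eq_iff)
qed

section \<open>Evaluation of the recurrence by rewriting\<close>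

datatype coeff = Zero | Plus | Minus

primrec coeff_val :: "coeff \<Rightarrow> int" where
  "coeff_val Zero = 0"
| "coeff_val Plus = 1"
| "coeff_val Minus = -1"

text \<open>Signs are constructors rather than integers, so zeros are skipped by pattern matching
  and no multiplication occurs.\<close>

fun coeff_dot :: "coeff list \<Rightarrow> int list \<Rightarrow> int" where
  "coeff_dot [] ys = 0"
| "coeff_dot (c # cs) [] = 0"
| "coeff_dot (Zero # cs) (y # ys) = coeff_dot cs ys"
| "coeff_dot (Plus # cs) (y # ys) = coeff_dot cs ys + y"
| "coeff_dot (Minus # cs) (y # ys) = coeff_dot cs ys - y"

lemma coeff_dot_eq:
  "length ys \<le> length cs \<Longrightarrow> coeff_dot cs ys = (\<Sum>i<length ys. coeff_val (cs ! i) * ys ! i)"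
  by (induction cs ys rule: coeff_dot.induct) (simp_all add: sum.lessThan_Suc_shift del: sum.lessThan_Suc)

text \<open>Position \<open>i\<close> belongs to the index \<open>Suc i\<close>. Between
  \<open>m^2\<close> and \<open>(m + 1)^2\<close> lie \<open>2 * m\<close> nonsquares, and
  \<open>(m + 1)^2\<close> is odd, hence has sign plus, exactly for even \<open>m\<close>.\<close>

primrec square_coeffs :: "nat \<Rightarrow> coeff list" where
  "square_coeffs 0 = []"
| "square_coeffs (Suc m) = square_coeffs m @ replicate (2 * m) Zero @ [if even m then Plus else Minus]"

lemma length_square_coeffs: "length (square_coeffs m) = m\<^sup>2"
  by (induction m) (simp_all add: power2_eq_square)

lemma square_coeffs_nth: "i < m\<^sup>2 \<Longrightarrow> coeff_val (square_coeffs m ! i) = square_sign (Suc i)"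
proof (induction m)
  case (Suc m)
  consider "i < m\<^sup>2" | "m\<^sup>2 \<le> i" "i < m\<^sup>2 + 2 * m" | "i = m\<^sup>2 + 2 * m"
  proof -
    have "(Suc m)\<^sup>2 = m\<^sup>2 + 2 * m + 1" by (simp add: power2_eq_square)
    then show ?thesis using Suc.prems that by linarith
  qed
  then show ?case
  proof cases
    case 1
    then show ?thesis using Suc.IH by (simp add: nth_append length_square_coeffs)
  next
    case 2
    have "Suc i \<noteq> j\<^sup>2" for j
    proof
      assume j: "Suc i = j\<^sup>2"
      have "m\<^sup>2 < j\<^sup>2" "j\<^sup>2 < (Suc m)\<^sup>2" unfolding j[symmetric] using 2 by (auto simp: power2_eq_square)
      then have "m < j" "j < Suc m" using power2_less_imp_less by blast+
      then show False by simp
    qed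
    then have "square_sign (Suc i) = 0" by (simp add: square_sign_def)
    moreover have "square_coeffs (Suc m) ! i = Zero"
      using 2 by (simp add: nth_append length_square_coeffs)
    ultimately show ?thesis by simp
  next
    case 3
    then have si: "Suc i = (Suc m)\<^sup>2" by (simp add: power2_eq_square)
    then have "\<exists>j>0. Suc i = j\<^sup>2" by blast
    then have "square_sign (Suc i) = (-1) ^ Suc (Suc i)" by (simp only: square_sign_def if_True)
    moreover have "even (Suc i) \<longleftrightarrow> odd m" unfolding si by simp
    moreover have "square_coeffs (Suc m) ! i = (if even m then Plus else Minus)"
      using 3 by (simp add: nth_append length_square_coeffs)
    ultimately show ?thesis by (cases "even m") simp_all
  qed
qed simp

text \<open>The newest value comes first, so a recurrence step is one scalar product with the list
  followed by a \<open>Cons\<close>.\<close>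

definition overpart_list :: "nat \<Rightarrow> int list" where
  "overpart_list n = map (\<lambda>i. int (overpart (n - i))) [0..<Suc n]"

lemma overpart_list_Suc: "overpart_list (Suc n) = int (overpart (Suc n)) # overpart_list n"
  by (simp add: overpart_list_def upt_conv_Cons del: upt_Suc) (simp add: map_Suc_upt[symmetric] del: upt_Suc)

lemma coeff_dot_overpart_list:
  assumes "n < m\<^sup>2"
  shows "2 * coeff_dot (square_coeffs m) (overpart_list n) = int (overpart (Suc n))"
proof -
  have l: "length (overpart_list n) = Suc n" by (simp add: overpart_list_def)
  have "coeff_dot (square_coeffs m) (overpart_list n) =
      (\<Sum>i<Suc n. coeff_val (square_coeffs m ! i) * overpart_list n ! i)"
    using assms by (subst coeff_dot_eq) (auto simp: l length_square_coeffs)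
  also have "\<dots> = (\<Sum>i<Suc n. square_sign (Suc i) * int (overpart (Suc n - Suc i)))"
  proof (rule sum.cong[OF refl])
    fix i assume "i \<in> {..<Suc n}"
    then show "coeff_val (square_coeffs m ! i) * overpart_list n ! i = square_sign (Suc i) * int (overpart (Suc n - Suc i))"
      using assms by (simp add: square_coeffs_nth overpart_list_def del: upt_Suc)
  qed
  finally show ?thesis using overpart_recurrence_sum[of "Suc n"] by simp
qed

text \<open>The \<open>unit list\<close> is a step counter consumed by pattern matching, so counting
  needs no arithmetic.\<close>

fun run :: "coeff list \<Rightarrow> int \<Rightarrow> int list \<Rightarrow> unit list \<Rightarrow> int list" where
  "run cs x L [] = x # L"
| "run cs x L (t # ts) = run cs (2 * coeff_dot cs (x # L)) (x # L) ts"

lemma run_overpart: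
  assumes "n + length ts \<le> m\<^sup>2" "x # L = overpart_list n"
  shows "run (square_coeffs m) x L ts = overpart_list (n + length ts)"
  using assms
proof (induction ts arbitrary: n x L)
  case (Cons t ts)
  have "2 * coeff_dot (square_coeffs m) (x # L) = int (overpart (Suc n))"
    unfolding Cons.prems(2) using Cons.prems(1) by (intro coeff_dot_overpart_list) simp
  then have "2 * coeff_dot (square_coeffs m) (x # L) # (x # L) = overpart_list (Suc n)"
    by (simp add: overpart_list_Suc Cons.prems(2))
  from Cons.IH[OF _ this] Cons.prems(1) show ?case by simp
qed simp

text \<open>A window moving downwards: \<open>D1\<close>, \<open>D2\<close>, \<open>D3\<close> stand
  for \<open>turan\<close> at \<open>n + 1\<close>, \<open>n\<close>, \<open>n - 1\<close>, and
  \<open>b\<close>, \<open>c\<close> for \<open>overpart\<close> at \<open>n - 1\<close>,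
  \<open>n - 2\<close>. Each step computes only one new value of \<open>turan\<close>.\<close>

fun check_turan :: "int \<Rightarrow> int \<Rightarrow> int \<Rightarrow> int \<Rightarrow> int \<Rightarrow> int list \<Rightarrow> unit list \<Rightarrow> bool" where
  "check_turan D1 D2 D3 b c L [] = (D1 * D3 < D2 * D2)"
| "check_turan D1 D2 D3 b c [] (t # ts) = False"
| "check_turan D1 D2 D3 b c (d # L) (t # ts) =
     (D1 * D3 < D2 * D2 \<and> check_turan D2 D3 (c * c - b * d) c d L ts)"

text \<open>This is \<open>(overpart n)^2 * (1 - u_op n)\<close>. Multiplied by
  \<open>(overpart n)^4\<close>, the claim becomes the integer inequality tested by
  \<open>check_turan\<close>.\<close>

definition turan :: "nat \<Rightarrow> int" where
  "turan n = int (overpart n) * int (overpart n) - int (overpart (n + 1)) * int (overpart (n - 1))"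

text \<open>\<open>j\<close> is the number of places by which the window has moved down from
  \<open>n\<close>.\<close>

lemma check_turan_imp:
  assumes "check_turan (turan (n + 1)) (turan n) (turan (n - 1)) b c L ts"
    and "b # c # L = overpart_list (n - 1)" "j \<le> length ts" "length ts + 2 \<le> n"
  shows "turan (n - j + 1) * turan (n - j - 1) < turan (n - j) * turan (n - j)"
  using assms
proof (induction ts arbitrary: n b c L j)
  case (Cons t ts)
  have "3 \<le> n" using Cons.prems(4) by simp
  then obtain n' where "n = 3 + n'" using le_Suc_ex by blast
  then have n: "n = Suc (Suc (Suc n'))" by simp
  have bc: "b = int (overpart (Suc (Suc n')))" "c # L = overpart_list (Suc n')"
    using Cons.prems(2) by (simp_all add: n overpart_list_Suc)
  then have c: "c = int (overpart (Suc n'))" "L = overpart_list n'"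
    by (simp_all add: overpart_list_Suc)
  obtain d L' where d: "L = d # L'" "d = int (overpart n')"
    unfolding c by (simp add: overpart_list_def upt_conv_Cons del: upt_Suc)
  have D: "c * c - b * d = turan (n - 1 - 1)"
    by (simp add: turan_def n bc c d)
  show ?case
  proof (cases j)
    case 0
    then show ?thesis using Cons.prems(1) by (simp add: d(1))
  next
    case (Suc j')
    have "turan (n - 1 - j' + 1) * turan (n - 1 - j' - 1) < turan (n - 1 - j') * turan (n - 1 - j')"
    proof (rule Cons.IH)
      show "check_turan (turan (n - 1 + 1)) (turan (n - 1)) (turan (n - 1 - 1)) c d L' ts"
        using Cons.prems(1) unfolding d(1) check_turan.simps D by (simp add: n)
      show "c # d # L' = overpart_list (n - 1 - 1)" using bc d(1) by (simp add: n)
    qed (use Cons.prems Suc in auto)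
    then show ?thesis by (simp add: Suc)
  qed
qed simp

fun check_list :: "int list \<Rightarrow> unit list \<Rightarrow> bool" where
  "check_list (a # b # c # d # e # L) ts = check_turan (b * b - a * c) (c * c - b * d) (d * d - c * e) d e L ts"
| "check_list _ _ = False"

lemma overpart_pos: "0 < overpart n"
proof -
  have "(replicate_mset n 1, {}) \<in> overpartitions n"
    by (auto simp: overpartitions_def)
  moreover have "finite (overpartitions n)"
    by (simp add: overpartitions_eq_bounded[of n n] finite_bounded_overpartitions)
  ultimately show ?thesis unfolding overpart_def by (auto simp: card_gt_0_iff)
qed

lemma overpart_list_0: "overpart_list 0 = [1]"
  by (simp add: overpart_list_def overpart_eq_bounded[of 0 0] bounded_overpart_0)

lemma turan_of_check:
  assumes "check_list (overpart_list (n + 2)) ts" "j \<le> length ts" "length ts + 2 \<le> n"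
  shows "turan (n - j + 1) * turan (n - j - 1) < turan (n - j) * turan (n - j)"
proof -
  have "2 \<le> n" using assms(3) by simp
  then obtain n' where "n = 2 + n'" using le_Suc_ex by blast
  then have n: "n = Suc (Suc n')" by simp
  obtain L where L: "overpart_list n' = int (overpart n') # L"
    by (simp add: overpart_list_def upt_conv_Cons del: upt_Suc)
  have ol: "overpart_list (n + 2) = int (overpart (n + 2)) # int (overpart (n + 1)) # int (overpart n) #
      int (overpart (n - 1)) # int (overpart (n - 2)) # L"
    by (simp add: n overpart_list_Suc L)
  have "check_turan (turan (n + 1)) (turan n) (turan (n - 1)) (int (overpart (n - 1))) (int (overpart (n - 2))) L ts"
    using assms(1) unfolding ol check_list.simps by (simp add: turan_def n)
  then show ?thesis
    by (rule check_turan_imp) (use assms in \<open>simp_all add: n overpart_list_Suc L\<close>)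
qed

lemma square_coeffs_numeral:
  "square_coeffs (numeral k) = square_coeffs (pred_numeral k) @ replicate (2 * pred_numeral k) Zero
    @ [if even (pred_numeral k) then Plus else Minus]"
  by (simp add: numeral_eq_Suc)

lemma replicate_numeral: "replicate (numeral k) x = x # replicate (pred_numeral k) x"
  by (simp add: numeral_eq_Suc)

\<comment> \<open>The schematic right-hand side is instantiated with the normal form. The argument
  25 suffices because \<open>25^2 = 625\<close> exceeds the largest index 579.\<close>
schematic_goal square_coeffs_25: "square_coeffs 25 = ?cs"
  by (simp add: square_coeffs_numeral replicate_numeral)

\<comment> \<open>\<open>579 = 577 + 2\<close>: the inequality at 577 involves
  \<open>overpart\<close> up to 579.\<close>
schematic_goal replicate_579: "replicate 579 () = ?ts"
  by (simp add: replicate_numeral)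

\<comment> \<open>\<open>535 = 577 - 42\<close>: the window moves from 577 down to 42.\<close>
schematic_goal replicate_535: "replicate 535 () = ?ts"
  by (simp add: replicate_numeral)

lemma overpart_list_eq_run: "overpart_list 579 = run (square_coeffs 25) 1 [] (replicate 579 ())"
proof -
  have "run (square_coeffs 25) 1 [] (replicate 579 ()) = overpart_list (0 + length (replicate 579 ()))"
    by (rule run_overpart) (simp_all only: overpart_list_0 length_replicate, simp)
  then show ?thesis by (simp only: length_replicate add_0)
qed

schematic_goal overpart_list_579: "overpart_list 579 = ?L"
  unfolding overpart_list_eq_run square_coeffs_25 replicate_579
  by (simp only: run.simps coeff_dot.simps arith_simps arith_special mult_1 mult_1_right)

lemma check_overpart_list: "check_list (overpart_list 579) (replicate 535 ())"
  unfolding overpart_list_579 replicate_535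
  by (simp only: check_list.simps check_turan.simps arith_simps arith_special mult_1 mult_1_right rel_simps simp_thms)

theorem theorem2p4:
  fixes n :: nat
  assumes "n \<ge> 42"
  shows "s_op n * (u_op n)^2 - 2 * u_op n + 1 > 0"
proof (cases "n \<le> 577")
  case True
  \<comment> \<open>The window centred at \<open>n\<close> is reached from 577 after
    \<open>577 - n\<close> steps.\<close>
  have T: "turan (n + 1) * turan (n - 1) < turan n * turan n"
    using turan_of_check[of 577 "replicate 535 ()" "577 - n"] check_overpart_list assms True by simp
  have pos: "0 < real (overpart k)" for k
    using overpart_pos by simp
  define P where "P = (\<lambda>k. real (overpart k))"
  have u: "1 - u_op k = real_of_int (turan k) / P k ^ 2" for k
    using pos[of k] by (simp add: u_op_def turan_def P_def power2_eq_square field_simps)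
  have "real_of_int (turan (n + 1)) * turan (n - 1) < (real_of_int (turan n))\<^sup>2"
    using T by (simp add: power2_eq_square flip: of_int_mult)
  moreover have "s_op n * (u_op n)\<^sup>2 - 2 * u_op n + 1 =
      (1 - u_op n)\<^sup>2 - (1 - u_op (n - 1)) * (1 - u_op (n + 1)) * (u_op n)\<^sup>2"
    unfolding s_op_def by (simp add: power2_eq_square algebra_simps)
  moreover have "\<dots> = ((real_of_int (turan n))\<^sup>2 - real_of_int (turan (n + 1)) * turan (n - 1)) / P n ^ 4"
  proof -
    \<comment> \<open>The factor \<open>u_op n ^ 2\<close> contains the squares of both neighbours
      \<open>x\<close> and \<open>y\<close>, which cancel the denominators of
      \<open>1 - u_op (n - 1)\<close> and \<open>1 - u_op (n + 1)\<close>; only \<open>p ^ 4\<close>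
      remains.\<close>
    have "(t / p\<^sup>2)\<^sup>2 - a / x\<^sup>2 * (b / y\<^sup>2) * (x * y / p\<^sup>2)\<^sup>2 = (t\<^sup>2 - b * a) / p ^ 4"
      if "x \<noteq> 0" "y \<noteq> 0" "p \<noteq> 0" for t p a b x y :: real
      using that by (simp add: field_simps power2_eq_square power4_eq_xxxx)
    moreover have "u_op n = P (n - 1) * P (n + 1) / (P n)\<^sup>2" by (simp add: u_op_def P_def)
    ultimately show ?thesis unfolding u using pos by (simp add: P_def)
  qed
  ultimately show ?thesis using pos[of n] by (simp add: P_def)
next
  case False
  then show ?thesis by (intro turan_of_large) simp
qed

end
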